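(* Let $\mathbf{h}\in\mathcal{H}^{m,\star}$ and let $(P^\star(\mathbf{h}),Q^\star(\mathbf{h}))=\star(\mathbf{h})$. For $1\leqslant i<m$: (1) $f^\star_i(\mathbf{h})\neq0$ if and only if $f_i(Q^\star(\mathbf{h}))\neq0$; (2) if $f^\star_i(\mathbf{h})\neq0$, then $Q^\star(f^\star_i(\mathbf{h}))=f_i(Q^\star(\mathbf{h}))$.
   Context: The 0-Hecke monoid: words in positive integers modulo the equivalence generated by $pq=qp$ ($|p-q|>1$), $pqp=qpq$, $pp=p$ on consecutive subwords; a word is fully-commutative if no minimal-length word equivalent to it contains a consecutive subword $i(i+1)i$ or $i(i-1)i$. $\mathcal{H}^{m,\star}$ is the set of decreasing factorizations $\mathbf{h}=h^m\cdots h^1$ (each $h^i$ a possibly empty strictly decreasing word) whose concatenation is fully-commutative. $\star$-crystal operator $f^\star_i$: pair letters $b$ of $h^{i+1}$, in decreasing order, each with the smallest not-yet-paired letter $a\geqslant b$ of $h^i$ if one exists. If all letters of $h^i$ are paired, $f^\star_i(\mathbf{h})=0$; else with $x$ the largest unpaired letter of $h^i$: if $x+1\in h^i\cap h^{i+1}$, remove $x+1$ from $h^i$ and add $x$ to $h^{i+1}$; otherwise move $x$ from $h^i$ to $h^{i+1}$. $\star$-insertion of $\mathbf{h}$: regard $\mathbf{h}$ as the sequence of pairs (factor index $q$, letter $x$) listing the letters of $h^m$, then of $h^{m-1}$, ..., then of $h^1$, in the order written. Process these pairs from last to first, starting with empty tableaux $P,Q$ (French notation, rows from the bottom): insert $x$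 into the bottom row of $P$, where inserting $x$ into a row $R$ means: Case 1: if $R$ is empty or $x>\max(R)$, append $x$ to $R$, add a cell with entry $q$ to $Q$ at the same position, and stop; Case 2: otherwise if $x\notin R$, replace the smallest $y\in R$ with $y>x$ by $x$ and insert $y$ into the next row up; Case 3: if $x\in R$, leave $R$ unchanged and insert into the next row up the smallest $y\in R$ with $[y,x]\subseteq R$. The result $Q^\star(\mathbf{h})$ is a semistandard Young tableau with entries in $[m]$. On semistandard Young tableaux with entries in $[m]$, $f_i$ denotes the standard type $A_{m-1}$ (Kashiwara–Nakashima) crystal operator defined via the signature rule on $i$ and $i+1$, with $f_i(Q)=0$ when it is not defined. *)

theory Defs
  imports Main "HOL-Library.Sublist"
begin

inductive hecke_step :: "nat list \<Rightarrow> nat list \<Rightarrow> bool" where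
  commute: "Suc p < q \<or> Suc q < p \<Longrightarrow> hecke_step (u @ [p, q] @ v) (u @ [q, p] @ v)"
| braid: "hecke_step (u @ [p, q, p] @ v) (u @ [q, p, q] @ v)"
| idem: "hecke_step (u @ [p, p] @ v) (u @ [p] @ v)"

(* Equivalent words have the same set of letters, so a word in positive integers is equivalent
   only to words in positive integers. *)
definition hecke_equiv :: "nat list \<Rightarrow> nat list \<Rightarrow> bool" where
  "hecke_equiv = equivclp hecke_step"

definition hecke_reduced :: "nat list \<Rightarrow> bool" where
  "hecke_reduced w \<longleftrightarrow> (\<forall>w'. hecke_equiv w w' \<longrightarrow> length w \<le> length w')"

definition fully_commutative :: "nat list \<Rightarrow> bool" where
  "fully_commutative w \<longleftrightarrow>
    (\<forall>v. hecke_equiv w v \<and> hecke_reduced v \<longrightarrow>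
      (\<forall>j. \<not> sublist [j, Suc j, j] v \<and> \<not> sublist [Suc j, j, Suc j] v))"

(* A factorization h^m ... h^1 is the list of its factors as written, [h^m, ..., h^1]. *)
definition star_factorizations :: "nat \<Rightarrow> nat list list set" where
  "star_factorizations m =
    {h. length h = m \<and> (\<forall>w \<in> set h. sorted_wrt (>) w \<and> (\<forall>x \<in> set w. 1 \<le> x)) \<and>
        fully_commutative (concat h)}"

(* The factor h^i, for 1 \<le> i \<le> m. *)
definition factor :: "nat list list \<Rightarrow> nat \<Rightarrow> nat list" where
  "factor h i = h ! (length h - i)"

definition set_factor :: "nat list list \<Rightarrow> nat \<Rightarrow> nat list \<Rightarrow> nat list list" where
  "set_factor h i w = h[length h - i := w]"

definition add_letter :: "nat \<Rightarrow> nat list \<Rightarrow> nat list" where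
  "add_letter x w = [a \<leftarrow> w. a > x] @ x # [a \<leftarrow> w. a < x]"

(* First argument: letters of h^(i+1) still to be processed, in decreasing order;
   second argument: not-yet-paired letters of h^i. *)
fun unpaired :: "nat list \<Rightarrow> nat set \<Rightarrow> nat set" where
  "unpaired [] A = A"
| "unpaired (b # bs) A =
    (if \<exists>a \<in> A. b \<le> a then unpaired bs (A - {Min {a \<in> A. b \<le> a}}) else unpaired bs A)"

(* The value 0 of a crystal operator is None. *)
definition f_star :: "nat \<Rightarrow> nat list list \<Rightarrow> nat list list option" where
  "f_star i h =
    (let u = factor h i; v = factor h (Suc i); U = unpaired v (set u)
     in if U = {} then None
        else let x = Max U; z = (if Suc x \<in> set u \<inter> set v then Suc x else x)
             in Some (set_factor (set_factor h i (removeAll z u)) (Suc i) (add_letter x v)))"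

(* Tableaux are lists of rows, bottom row first (French notation).
   star_insert x P is the new tableau together with the index of the row that gained a cell. *)
fun star_insert :: "nat \<Rightarrow> nat list list \<Rightarrow> nat list list \<times> nat" where
  "star_insert x [] = ([[x]], 0)"
| "star_insert x (R # P) =
    (if R = [] \<or> Max (set R) < x then ((R @ [x]) # P, 0)
     else if x \<notin> set R then
       (let y = Min {y \<in> set R. x < y}; (P', r) = star_insert y P
        in (map (\<lambda>z. if z = y then x else z) R # P', Suc r))
     else
       (let y = Min {y \<in> set R. y \<le> x \<and> {y..x} \<subseteq> set R}; (P', r) = star_insert y P
        in (R # P', Suc r)))"

(* P and Q have the same shape throughout the insertion, so the new cell is at the end of row r. *)
definition add_cell :: "nat \<Rightarrow> nat \<Rightarrow> nat list list \<Rightarrow> nat list list" where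
  "add_cell r q Q = (if r < length Q then Q[r := Q ! r @ [q]] else Q @ [[q]])"

definition biword :: "nat list list \<Rightarrow> (nat \<times> nat) list" where
  "biword h = concat (map (\<lambda>q. map (\<lambda>x. (q, x)) (factor h q)) (rev [1..<Suc (length h)]))"

(* foldr processes the pairs from last to first. *)
definition star_insertion :: "nat list list \<Rightarrow> nat list list \<times> nat list list" where
  "star_insertion h =
    foldr (\<lambda>(q, x) (P, Q). let (P', r) = star_insert x P in (P', add_cell r q Q))
      (biword h) ([], [])"

definition P_star :: "nat list list \<Rightarrow> nat list list" where
  "P_star h = fst (star_insertion h)"

definition Q_star :: "nat list list \<Rightarrow> nat list list" where
  "Q_star h = snd (star_insertion h)"

(* Cells (row, column) with their entries, in the order of the row reading word:
   rows from top to bottom, each from left to right. *)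
definition reading :: "nat list list \<Rightarrow> ((nat \<times> nat) \<times> nat) list" where
  "reading T = concat (map (\<lambda>r. map (\<lambda>c. ((r, c), T ! r ! c)) [0..<length (T ! r)])
    (rev [0..<length T]))"

(* Signature rule: in the reading word each i+1 is an opening and each i a closing bracket.
   The result lists the cells of the unmatched i's from left to right;
   k is the number of currently open brackets. *)
fun unmatched :: "nat \<Rightarrow> nat \<Rightarrow> ((nat \<times> nat) \<times> nat) list \<Rightarrow> (nat \<times> nat) list" where
  "unmatched i k [] = []"
| "unmatched i k ((c, a) # w) =
    (if a = Suc i then unmatched i (Suc k) w
     else if a = i then (if k = 0 then c # unmatched i 0 w else unmatched i (k - 1) w)
     else unmatched i k w)"

definition f_tab :: "nat \<Rightarrow> nat list list \<Rightarrow> nat list list option" where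
  "f_tab i T =
    (let U = unmatched i 0 (reading T)
     in if U = [] then None
        else let (r, c) = last U in Some (T[r := (T ! r)[c := Suc i]]))"

end

theory Submission
  imports Defs
begin

text \<open>
  Full commutativity of the factorization says that between two consecutive occurrences of a letter
  \<open>i\<close> in its word the letter \<open>i - 1\<close> occurs if and only if \<open>i + 1\<close> does. This condition on words is
  invariant under Hecke equivalence and, unlike full commutativity itself, evidently passes to factors.

  The insertion of \<open>h^i\<close> and then \<open>h^(i+1)\<close> is studied one row at a time: a row \<open>R\<close> turns the pair
  \<open>(h^(i+1), h^i)\<close> into the pair of words bumped into the next row, and \<open>h^(i+1) h^i R\<close> is
  Hecke equivalent to the new row followed by the bumped words. The heart of the proof is that
  this map commutes with \<open>f^*_i\<close> and leaves the final row unchanged. To treat the letters appended to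
  the row in the same way as those bumped, the row is padded by infinitely many large letters, so that
  every insertion bumps. A large letter bumped from a row is a new cell of that row, and the pairing of
  the large letters with the small ones is exactly the signature rule for this row.
\<close>

section \<open>Balanced words\<close>

text \<open>The operator changes a single cell of \<open>Q\<close>, so one row has to be singled
  out. As long as the moved letter is among the small letters bumped from a row, the small words
  bumped on the two sides are again related by the operator, and the row gains the same cells on
  both sides. In the row where the moved letter is a large one, the small words agree, so everything
  above is identical and one cell of this row changes its label. Which of the two happens depends on
  how many letters of \<open>h^(i+1)\<close> the small letters leave unpaired, so this number is
  carried through the induction. The obstacle is the third insertion case: inserting
  \<open>x\<close> into a row that contains both \<open>x\<close> and \<open>x + 1\<close> does not
  respect Hecke equivalence. Only balance of the word followed by the row excludes this, so every
  rearrangement of letters comes with a Hecke equivalence that transports balance. Runs of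
  consecutive entries are also what creates the exceptional clause of the operator: they can turn an
  ordinary move of one row into an exceptional move of the next.\<close>

datatype segment = Fresh | Open bool bool | Bad

text \<open>
  The state \<open>Open l u\<close> of the scan for \<open>i\<close> records whether \<open>i - 1\<close> and \<open>i + 1\<close> have occurred since the
  last \<open>i\<close>.
\<close>

fun scan_step :: "nat \<Rightarrow> nat \<Rightarrow> segment \<Rightarrow> segment" where
  "scan_step i x Fresh = (if x = i then Open False False else Fresh)"
| "scan_step i x (Open l u) =
    (if x = i then (if l = u then Open False False else Bad) else Open (l \<or> Suc x = i) (u \<or> x = Suc i))"
| "scan_step i x Bad = Bad"

abbreviation scan :: "nat \<Rightarrow> nat list \<Rightarrow> segment \<Rightarrow> segment" where
  "scan i \<equiv> fold (scan_step i)"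

definition balanced :: "nat list \<Rightarrow> bool" where
  "balanced w \<longleftrightarrow> (\<forall>i. scan i w Fresh \<noteq> Bad)"

lemma scan_Bad [simp]: "scan i w Bad = Bad"
  by (induction w) auto

lemma scan_Open: "i \<notin> set w \<Longrightarrow>
  scan i w (Open l u) = Open (l \<or> (\<exists>j\<in>set w. Suc j = i)) (u \<or> Suc i \<in> set w)"
  by (induction w arbitrary: l u) auto

lemma scan_Fresh: "i \<notin> set w \<Longrightarrow> scan i w Fresh = Fresh"
  by (induction w) auto

text \<open>Starting from \<open>Fresh\<close> forgets the past. The past can only add a violation,
  and from the next \<open>i\<close> on the two scans agree unless one has failed. This gives
  balance of suffixes.\<close>

lemma scan_Fresh_not_Bad: "scan i w s \<noteq> Bad \<Longrightarrow> scan i w Fresh \<noteq> Bad"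
proof (induction w arbitrary: s)
  case (Cons x w)
  show ?case
  proof (cases "x = i")
    case True
    then show ?thesis using Cons.prems by (cases s) (auto split: if_splits)
  next
    case False
    then show ?thesis using Cons by auto
  qed
qed auto

lemma balanced_suffix: "balanced (u @ v) \<Longrightarrow> balanced v"
  unfolding balanced_def fold_append comp_def by (metis scan_Fresh_not_Bad)

lemma balanced_prefix: "balanced (u @ v) \<Longrightarrow> balanced u"
  unfolding balanced_def fold_append comp_def by (metis scan_Bad)

lemma balanced_pattern:
  assumes "balanced (a @ i # s @ i # c)" "i \<notin> set s"
  shows "(\<exists>j\<in>set s. Suc j = i) \<longleftrightarrow> Suc i \<in> set s"
proof -
  have "balanced (i # s @ i # c)" using assms(1) by (rule balanced_suffix)
  then have "balanced (i # s @ [i])" using balanced_prefix[of "i # s @ [i]" c] by simp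
  then have "scan i (i # s @ [i]) Fresh \<noteq> Bad" unfolding balanced_def by blast
  then show ?thesis using assms(2) by (auto simp: scan_Open split: if_splits)
qed

lemma scan_Open_D:
  assumes "scan i w Fresh = Open l u"
  obtains a s where "w = a @ i # s" "i \<notin> set s"
    "l \<longleftrightarrow> (\<exists>j\<in>set s. Suc j = i)" "u \<longleftrightarrow> Suc i \<in> set s"
proof -
  have "i \<in> set w" using assms scan_Fresh by fastforce
  then obtain a s where w: "w = a @ i # s" "i \<notin> set s" by (meson split_list_last)
  then have "scan i s (scan_step i i (scan i a Fresh)) = Open l u" using assms by simp
  moreover have "scan_step i i t = Open False False \<or> scan_step i i t = Bad" for t by (cases t) auto
  ultimately have "scan i s (Open False False) = Open l u"
    by (metis scan_Bad segment.distinct(5))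
  then show ?thesis using that[OF w] scan_Open[OF w(2)] by auto
qed

lemma not_balanced_pattern:
  assumes "\<not> balanced w"
  shows "\<exists>a i s c. w = a @ i # s @ i # c \<and> i \<notin> set s \<and>
    ((\<exists>j\<in>set s. Suc j = i) \<noteq> (Suc i \<in> set s))"
proof -
  obtain i where "scan i w Fresh = Bad" using assms unfolding balanced_def by blast
  then have "\<exists>a s c. w = a @ i # s @ i # c \<and> i \<notin> set s \<and>
    ((\<exists>j\<in>set s. Suc j = i) \<noteq> (Suc i \<in> set s))"
  proof (induction w rule: rev_induct)
    case (snoc x w)
    show ?case
    proof (cases "scan i w Fresh")
      case Fresh
      then show ?thesis using snoc.prems by (simp split: if_splits)
    next
      case (Open l u)
      then obtain a s where as: "w = a @ i # s" "i \<notin> set s"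
        "l \<longleftrightarrow> (\<exists>j\<in>set s. Suc j = i)" "u \<longleftrightarrow> Suc i \<in> set s" by (rule scan_Open_D)
      have "x = i" "l \<noteq> u" using snoc.prems Open by (simp_all split: if_splits)
      then have "w @ [x] = a @ i # s @ i # []" "(\<exists>j\<in>set s. Suc j = i) \<noteq> (Suc i \<in> set s)"
        using as by auto
      then show ?thesis using as(2) by blast
    next
      case Bad
      then obtain a s c where *: "w = a @ i # s @ i # c" "i \<notin> set s"
        "(\<exists>j\<in>set s. Suc j = i) \<noteq> (Suc i \<in> set s)" using snoc.IH by blast
      have "w @ [x] = a @ i # s @ i # (c @ [x])" using *(1) by simp
      with *(2,3) show ?thesis by blast
    qed
  qed simp
  then show ?thesis by blast
qed

lemma not_balanced_braid:
  assumes "q = Suc p \<or> p = Suc q"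
  shows "\<not> balanced (u @ [p, q, p] @ v)"
  using balanced_pattern[of u p "[q]" v] assms by auto

lemma scan_step_commute: "Suc p < q \<or> Suc q < p \<Longrightarrow> scan_step i q (scan_step i p s) = scan_step i p (scan_step i q s)"
  by (cases s) auto

lemma scan_step_idem: "scan_step i p (scan_step i p s) = scan_step i p s"
  by (cases s) auto

text \<open>Letters at distance at least two do not interfere in a scan; \<open>i - 1\<close> and
  \<open>i + 1\<close> set independent flags. A braid of adjacent letters relates two unbalanced
  words, since \<open>p q p\<close> encloses exactly one neighbour of \<open>p\<close>. A braid of
  distant letters reduces to commutation and idempotence.\<close>

lemma balanced_step: "hecke_step w w' \<Longrightarrow> balanced w \<longleftrightarrow> balanced w'"
proof (induction rule: hecke_step.induct)
  case (commute p q u v)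
  then show ?case unfolding balanced_def by (simp add: scan_step_commute)
next
  case (braid u p q v)
  consider "q = Suc p \<or> p = Suc q" | "p = q" | "Suc p < q \<or> Suc q < p" by linarith
  then show ?case
  proof cases
    case 1
    then show ?thesis using not_balanced_braid by metis
  next
    case 3
    then have "scan_step i p (scan_step i q (scan_step i p s)) = scan_step i q (scan_step i p (scan_step i q s))" for i s
      by (metis scan_step_commute scan_step_idem)
    then show ?thesis unfolding balanced_def by simp
  qed simp
next
  case (idem u p v)
  then show ?case unfolding balanced_def by (simp add: scan_step_idem)
qed

lemma balanced_equiv: "hecke_equiv w w' \<Longrightarrow> balanced w \<longleftrightarrow> balanced w'"
  unfolding hecke_equiv_def
  by (induction rule: equivclp_induct) (use balanced_step in blast)+

section \<open>Hecke equivalence as a congruence, and balance of fully commutative words\<close>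

lemma hecke_equiv_refl [simp]: "hecke_equiv w w"
  unfolding hecke_equiv_def by simp

lemma hecke_equiv_sym: "hecke_equiv w w' \<Longrightarrow> hecke_equiv w' w"
  unfolding hecke_equiv_def by (rule equivclp_sym)

lemma hecke_equiv_trans [trans]: "hecke_equiv u v \<Longrightarrow> hecke_equiv v w \<Longrightarrow> hecke_equiv u w"
  unfolding hecke_equiv_def by (rule equivclp_trans)

lemma hecke_step_context: "hecke_step w w' \<Longrightarrow> hecke_step (a @ w @ b) (a @ w' @ b)"
proof (induction rule: hecke_step.induct)
  case (commute p q u v)
  then show ?case using hecke_step.commute[of p q "a @ u" "v @ b"] by simp
next
  case (braid u p q v)
  then show ?case using hecke_step.braid[of "a @ u" p q "v @ b"] by simp
next
  case (idem u p v)
  then show ?case using hecke_step.idem[of "a @ u" p "v @ b"] by simp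
qed

lemma hecke_equiv_context: "hecke_equiv w w' \<Longrightarrow> hecke_equiv (a @ w @ b) (a @ w' @ b)"
  unfolding hecke_equiv_def
proof (induction rule: equivclp_induct)
  case (step y z)
  then have "equivclp hecke_step (a @ y @ b) (a @ z @ b)"
    using hecke_step_context by (metis r_into_equivclp equivclp_sym)
  with step show ?case by (metis equivclp_trans)
qed simp

lemma hecke_equiv_append: "hecke_equiv u u' \<Longrightarrow> hecke_equiv v v' \<Longrightarrow> hecke_equiv (u @ v) (u' @ v')"
  using hecke_equiv_context[of u u' "[]" v] hecke_equiv_context[of v v' u' "[]"] hecke_equiv_trans
  by simp

lemma hecke_equiv_Cons: "hecke_equiv v v' \<Longrightarrow> hecke_equiv (x # v) (x # v')"
  using hecke_equiv_context[of v v' "[x]" "[]"] by simp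

lemma hecke_equiv_idem: "hecke_equiv (x # x # w) (x # w)"
  unfolding hecke_equiv_def using hecke_step.idem[of "[]" x w] by (simp add: r_into_equivclp)

lemma hecke_equiv_commute:
  "(\<And>q. q \<in> set s \<Longrightarrow> Suc p < q \<or> Suc q < p) \<Longrightarrow> hecke_equiv (p # s) (s @ [p])"
proof (induction s)
  case (Cons q s)
  have "hecke_step ([] @ [p, q] @ s) ([] @ [q, p] @ s)"
    using Cons.prems by (intro hecke_step.commute) auto
  then have "hecke_equiv (p # q # s) (q # p # s)"
    unfolding hecke_equiv_def by (simp add: r_into_equivclp)
  also have "hecke_equiv (q # p # s) (q # s @ [p])"
    using Cons by (intro hecke_equiv_Cons) auto
  finally show ?case by simp
qed simp

lemma hecke_equiv_commute_context:
  "(\<And>q. q \<in> set s \<Longrightarrow> Suc p < q \<or> Suc q < p) \<Longrightarrow> hecke_equiv (a @ p # s @ b) (a @ s @ p # b)"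
  using hecke_equiv_context[OF hecke_equiv_commute, of s p a b] by simp

text \<open>A violation with the shortest possible gap \<open>s\<close> has exactly one neighbour
  \<open>j\<close> of \<open>i\<close> in the gap. If \<open>j\<close> occurs twice there,
  minimality makes the letters between two occurrences commute with \<open>j\<close>, so these merge
  and \<open>v\<close> is not reduced. If \<open>j\<close> occurs once, all other letters of the gap
  commute with \<open>i\<close>, and commutations produce the forbidden subword
  \<open>i j i\<close>.\<close>

lemma balanced_if_minimal:
  assumes fc: "fully_commutative w" and vw: "hecke_equiv w v" and red: "hecke_reduced v"
  shows "balanced v"
proof (rule ccontr)
  assume "\<not> balanced v"
  define bad where "bad a i s c \<longleftrightarrow> v = a @ i # s @ i # c \<and> i \<notin> set s \<and>
    ((\<exists>j\<in>set s. Suc j = i) \<noteq> (Suc i \<in> set s))" for a i s c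
  have "\<exists>n a i s c. bad a i s c \<and> length s = n"
    using not_balanced_pattern[OF \<open>\<not> balanced v\<close>] unfolding bad_def by blast
  then obtain n where n: "\<exists>a i s c. bad a i s c \<and> length s = n"
    and least: "\<And>m. m < n \<Longrightarrow> \<not> (\<exists>a i s c. bad a i s c \<and> length s = m)"
    using exists_least_iff[of "\<lambda>n. \<exists>a i s c. bad a i s c \<and> length s = n"] by blast
  from n obtain a i s c where b: "bad a i s c" "length s = n" by blast
  have v: "v = a @ i # s @ i # c" and i: "i \<notin> set s" using b unfolding bad_def by auto
  have short: "length v \<le> length v'" if "hecke_equiv v v'" for v'
    using red that unfolding hecke_reduced_def by blast
  obtain j where j: "j \<in> set s" "Suc j = i \<or> j = Suc i"
    and other: "\<And>k. k \<in> set s \<Longrightarrow> k \<noteq> j \<Longrightarrow> Suc i < k \<or> Suc k < i"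
  proof (cases "Suc i \<in> set s")
    case True
    then have "\<forall>k\<in>set s. Suc k \<noteq> i" using b unfolding bad_def by auto
    with True i show ?thesis using that[of "Suc i"] by (metis Suc_lessI linorder_neqE_nat)
  next
    case False
    then obtain k where "k \<in> set s" "Suc k = i" using b unfolding bad_def by auto
    with False i show ?thesis using that[of k] by (metis Suc_lessI linorder_neqE_nat old.nat.inject)
  qed
  obtain s1 s2 where s: "s = s1 @ j # s2" "j \<notin> set s1" using split_list_first[OF j(1)] by blast
  show False
  proof (cases "j \<in> set s2")
    case True
    then obtain s3 s4 where s2: "s2 = s3 @ j # s4" "j \<notin> set s3" using split_list_first by metis
    have "v = (a @ i # s1) @ j # s3 @ j # (s4 @ i # c)" using v s s2 by simp
    moreover have "length s3 < n" using b s s2 by simp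
    ultimately have iff: "(\<exists>k\<in>set s3. Suc k = j) \<longleftrightarrow> Suc j \<in> set s3"
      using least[of "length s3"] s2 unfolding bad_def by blast
    \<comment> \<open>The letter \<open>i\<close> is one neighbour of \<open>j\<close>; by
      \<open>iff\<close> its absence excludes the other neighbour as well.\<close>
    have "i \<notin> set s3" using i s s2 by auto
    then have "\<forall>k\<in>set s3. Suc k \<noteq> j \<and> k \<noteq> Suc j" using iff j(2) by auto
    then have far: "Suc j < q \<or> Suc q < j" if "q \<in> set s3" for q
      using that s2 by (metis Suc_lessI linorder_neqE_nat)
    have "hecke_equiv v ((a @ i # s1) @ s3 @ j # j # (s4 @ i # c))"
      using hecke_equiv_commute_context[of s3 j "a @ i # s1" "j # s4 @ i # c", OF far] v s s2 by simp
    also have "hecke_equiv \<dots> ((a @ i # s1) @ s3 @ j # (s4 @ i # c))"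
      using hecke_equiv_context[OF hecke_equiv_idem, of "(a @ i # s1) @ s3" j "s4 @ i # c" "[]"] by simp
    finally show False using short v s s2 by fastforce
  next
    case False
    have far1: "Suc i < q \<or> Suc q < i" if "q \<in> set s1" for q using that other s by auto
    have far2: "Suc i < q \<or> Suc q < i" if "q \<in> set s2" for q using that other s False by auto
    have "hecke_equiv v (a @ s1 @ i # j # s2 @ i # c)"
      using hecke_equiv_commute_context[of s1 i a "j # s2 @ i # c", OF far1] v s by simp
    also have "hecke_equiv \<dots> (a @ s1 @ i # j # i # s2 @ c)"
      using hecke_equiv_sym[OF hecke_equiv_commute_context[of s2 i "a @ s1 @ [i, j]" c, OF far2]] by simp
    finally have eq: "hecke_equiv v (a @ s1 @ i # j # i # s2 @ c)" (is "hecke_equiv v ?v") .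
    have "length ?v = length v" using v s by simp
    then have "hecke_reduced ?v"
      using short hecke_equiv_trans[OF eq] unfolding hecke_reduced_def by simp
    moreover have "hecke_equiv w ?v" using vw eq by (rule hecke_equiv_trans)
    moreover have "sublist [i, j, i] ?v"
      unfolding sublist_def by (metis append.assoc append_Cons append_Nil)
    ultimately show False using fc j(2) unfolding fully_commutative_def by blast
  qed
qed

lemma fully_commutative_balanced:
  assumes "fully_commutative w"
  shows "balanced w"
proof -
  define v where "v = arg_min length (hecke_equiv w)"
  have v: "hecke_equiv w v" unfolding v_def by (rule arg_min_natI[of _ w]) simp
  have "hecke_reduced v"
    unfolding hecke_reduced_def v_def
    by (metis arg_min_nat_le hecke_equiv_trans v v_def)
  with v show ?thesis using balanced_if_minimal[OF assms] balanced_equiv by blast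
qed

section \<open>Adding and deleting isolated large letters\<close>

lemma scan_filter:
  assumes "N \<notin> set w" "i < N"
  shows "scan i (filter (\<lambda>x. x < N) w) s = scan i w s"
  using assms(1)
proof (induction w arbitrary: s)
  case (Cons x w)
  \<comment> \<open>The absent letter \<open>N\<close> is a buffer: \<open>x > N > i\<close>, so
    \<open>x\<close> is at distance at least two from \<open>i\<close>.\<close>
  have "scan_step i x s = s" if "\<not> x < N"
    using that Cons.prems assms(2) by (cases s) auto
  then show ?case using Cons by auto
qed simp

lemma scan_single:
  assumes "distinct (filter (\<lambda>x. x = i) w)"
  shows "scan i w Fresh \<noteq> Bad"
proof (cases "i \<in> set w")
  case True
  then obtain a b where w: "w = a @ i # b" "i \<notin> set a" by (meson split_list_first)
  moreover have "i \<notin> set b" using assms w by auto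
  ultimately show ?thesis by (simp add: scan_Fresh scan_Open)
qed (simp add: scan_Fresh)

text \<open>Needed in both directions: to add the padding of a row without losing balance, and to
  discard the large letters bumped from it.\<close>

lemma balanced_filter_iff:
  assumes "N \<notin> set w" "distinct (filter (\<lambda>x. N \<le> x) w)"
  shows "balanced (filter (\<lambda>x. x < N) w) \<longleftrightarrow> balanced w"
proof -
  have "scan i w Fresh \<noteq> Bad" "scan i (filter (\<lambda>x. x < N) w) Fresh = Fresh" if "N \<le> i" for i
  proof -
    have "filter (\<lambda>x. x = i) w = filter (\<lambda>x. x = i) (filter (\<lambda>x. N \<le> x) w)"
      using that by (induction w) auto
    then show "scan i w Fresh \<noteq> Bad" using assms(2) by (metis distinct_filter scan_single)
    show "scan i (filter (\<lambda>x. x < N) w) Fresh = Fresh" using that by (intro scan_Fresh) auto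
  qed
  then show ?thesis unfolding balanced_def using scan_filter[OF assms(1)]
    by (metis linorder_not_less segment.distinct(3))
qed

section \<open>Insertion into a row\<close>

text \<open>Meant for infinite rows, where some entry above \<open>x\<close> always exists. For
  \<open>x \<in> R\<close> it is the lowest entry of the run of consecutive entries ending in
  \<open>x\<close>; the empty intervals with \<open>y > x\<close> do not matter, since
  \<open>y = x\<close> already qualifies.\<close>

definition bump :: "nat set \<Rightarrow> nat \<Rightarrow> nat" where
  "bump R x = (if x \<in> R then (LEAST y. {y..x} \<subseteq> R) else (LEAST y. y \<in> R \<and> x < y))"

definition row_insert :: "nat set \<Rightarrow> nat \<Rightarrow> nat set" where
  "row_insert R x = (if x \<in> R then R else insert x (R - {bump R x}))"

lemma bump_newI:
  assumes "x \<notin> R" "y \<in> R" "x < y" "\<And>z. z \<in> R \<Longrightarrow> x < z \<Longrightarrow> y \<le> z"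
  shows "bump R x = y"
  unfolding bump_def using assms by (auto intro!: Least_equality)

lemma bump_oldI:
  assumes "{y..x} \<subseteq> R" "y \<le> x" "\<And>k. y = Suc k \<Longrightarrow> k \<notin> R"
  shows "bump R x = y"
proof -
  have "(LEAST y. {y..x} \<subseteq> R) = y"
  proof (rule Least_equality)
    fix z assume z: "{z..x} \<subseteq> R"
    show "y \<le> z"
    proof (rule ccontr)
      assume "\<not> y \<le> z"
      then obtain k where "y = Suc k" "z \<le> k" by (metis Suc_diff_1 Suc_leI diff_Suc_1 leD leI less_Suc_eq_le not_less_zero zero_less_iff_neq_zero)
      then have "k \<in> R" using z assms(2) by auto
      then show False using assms(3) \<open>y = Suc k\<close> by blast
    qed
  qed (rule assms(1))
  then show ?thesis unfolding bump_def using assms(1,2) by auto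
qed

lemma bump_new:
  assumes "infinite R" "x \<notin> R"
  shows "bump R x \<in> R" "x < bump R x" "\<And>z. z \<in> R \<Longrightarrow> x < z \<Longrightarrow> bump R x \<le> z"
proof -
  obtain y where y: "y \<in> R \<and> x < y" using assms(1) by (meson finite_nat_set_iff_bounded_le not_le)
  have b: "bump R x = (LEAST y. y \<in> R \<and> x < y)" unfolding bump_def using assms(2) by simp
  show "bump R x \<in> R" "x < bump R x"
    using LeastI[of "\<lambda>y. y \<in> R \<and> x < y", OF y] b by auto
  show "\<And>z. z \<in> R \<Longrightarrow> x < z \<Longrightarrow> bump R x \<le> z" unfolding b by (rule Least_le) simp
qed

lemma bump_old:
  assumes "x \<in> R"
  shows "bump R x \<le> x" "{bump R x..x} \<subseteq> R" "\<And>k. bump R x = Suc k \<Longrightarrow> k \<notin> R"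
    "\<And>y. {y..x} \<subseteq> R \<Longrightarrow> bump R x \<le> y"
proof -
  have b: "bump R x = (LEAST y. {y..x} \<subseteq> R)" unfolding bump_def using assms by simp
  have x: "{x..x} \<subseteq> R" using assms by simp
  show le: "\<And>y. {y..x} \<subseteq> R \<Longrightarrow> bump R x \<le> y" unfolding b by (rule Least_le)
  show bx: "bump R x \<le> x" using le[OF x] .
  show sub: "{bump R x..x} \<subseteq> R" unfolding b using x by (rule LeastI)
  show "k \<notin> R" if "bump R x = Suc k" for k
  proof
    assume "k \<in> R"
    have "{k..x} = insert k {bump R x..x}" using that bx by auto
    then have "{k..x} \<subseteq> R" using sub \<open>k \<in> R\<close> by simp
    then show False using le[of k] that by simp
  qed
qed

lemma bump_in: "infinite R \<Longrightarrow> bump R x \<in> R"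
  using bump_new[of R x] bump_old[of x R] by (cases "x \<in> R") auto

lemma infinite_row_insert: "infinite R \<Longrightarrow> infinite (row_insert R x)"
  unfolding row_insert_def by simp

lemma row_insert_in [simp]: "x \<in> row_insert R x"
  unfolding row_insert_def by simp

text \<open>If \<open>x\<close> is new, an entry \<open>x + 1\<close> is the least one above it and
  gets bumped.\<close>

lemma row_insert_Suc: "infinite R \<Longrightarrow> \<not> (x \<in> R \<and> Suc x \<in> R) \<Longrightarrow> Suc x \<notin> row_insert R x"
  using bump_newI[of x R "Suc x"] unfolding row_insert_def by auto

lemma row_insert_subset: "row_insert R x \<subseteq> insert x R"
  unfolding row_insert_def by auto

section \<open>Row insertion as a Hecke equivalence\<close>

definition dec :: "nat set \<Rightarrow> nat list" where
  "dec S = rev (sorted_list_of_set S)"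

lemma dec_Un:
  assumes "finite A" "finite B" "\<And>a b. a \<in> A \<Longrightarrow> b \<in> B \<Longrightarrow> b < a"
  shows "dec (A \<union> B) = dec A @ dec B"
proof -
  have "sorted_list_of_set (A \<union> B) = sorted_list_of_set B @ sorted_list_of_set A"
  proof (rule sorted_distinct_set_unique)
    show "sorted (sorted_list_of_set B @ sorted_list_of_set A)"
      using assms by (auto simp: sorted_append intro: less_imp_le)
    show "distinct (sorted_list_of_set B @ sorted_list_of_set A)"
      using assms by auto
  qed (use assms in auto)
  then show ?thesis unfolding dec_def by simp
qed

lemma set_dec [simp]: "finite S \<Longrightarrow> set (dec S) = S"
  unfolding dec_def by simp

lemma dec_singleton [simp]: "dec {x} = [x]"
  unfolding dec_def by simp

lemma dec_insert_max: "finite B \<Longrightarrow> (\<And>b. b \<in> B \<Longrightarrow> b < x) \<Longrightarrow> dec (insert x B) = x # dec B"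
  using dec_Un[of "{x}" B] by simp

lemma dec_insert_min: "finite A \<Longrightarrow> (\<And>a. a \<in> A \<Longrightarrow> x < a) \<Longrightarrow> dec (insert x A) = dec A @ [x]"
  using dec_Un[of A "{x}"] by simp

text \<open>With \<open>y\<close> the bumped entry, \<open>x\<close> passes the entries above
  \<open>y\<close>, all greater than \<open>x + 1\<close>, and then \<open>y\<close> passes the
  entries below \<open>x\<close>.\<close>

lemma row_word_new:
  assumes R: "infinite R" and x: "x \<notin> R" and M: "bump R x < M"
  shows "hecke_equiv (x # dec (R \<inter> {..<M})) (dec (row_insert R x \<inter> {..<M}) @ [bump R x])"
proof -
  define y where "y = bump R x"
  define A where "A = R \<inter> {y<..<M}"
  define B where "B = R \<inter> {..<x}"
  have y: "y \<in> R" "x < y" "\<And>z. z \<in> R \<Longrightarrow> x < z \<Longrightarrow> y \<le> z"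
    using bump_new[OF R x] unfolding y_def by auto
  have fin: "finite A" "finite B" unfolding A_def B_def by auto
  have "R \<inter> {..<M} = A \<union> insert y B"
    using y x M unfolding A_def B_def y_def[symmetric] by (auto) (metis le_neq_implies_less not_le nat_neq_iff)
  moreover have "dec (A \<union> insert y B) = dec A @ y # dec B"
    using dec_Un[of A "insert y B"] dec_insert_max[of B y] fin y unfolding A_def B_def by fastforce
  ultimately have 1: "dec (R \<inter> {..<M}) = dec A @ y # dec B" by simp
  have "row_insert R x \<inter> {..<M} = A \<union> insert x B"
    using y x M unfolding A_def B_def row_insert_def y_def[symmetric] by auto (metis le_neq_implies_less not_le nat_neq_iff)
  moreover have "dec (A \<union> insert x B) = dec A @ x # dec B"
    using dec_Un[of A "insert x B"] dec_insert_max[of B x] fin y unfolding A_def B_def by fastforce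
  ultimately have 2: "dec (row_insert R x \<inter> {..<M}) = dec A @ x # dec B" by simp
  have "hecke_equiv (x # dec A @ y # dec B) (dec A @ x # y # dec B)"
    using hecke_equiv_commute_context[of "dec A" x "[]" "y # dec B"] fin y unfolding A_def by fastforce
  also have "hecke_equiv \<dots> (dec A @ x # dec B @ [y])"
    using hecke_equiv_commute_context[of "dec B" y "dec A @ [x]" "[]"] fin y unfolding B_def by fastforce
  finally show ?thesis unfolding 1 2 y_def by simp
qed

text \<open>As \<open>x + 1\<close> is missing, \<open>x\<close> passes the entries above it and is
  absorbed by the top of its run. A second copy of the lowest entry \<open>y\<close> of the run is
  then split off, and it passes the entries below because \<open>y - 1\<close> is missing.\<close>

lemma row_word_old:
  assumes x: "x \<in> R" "Suc x \<notin> R" and M: "x < M"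
  shows "hecke_equiv (x # dec (R \<inter> {..<M})) (dec (row_insert R x \<inter> {..<M}) @ [bump R x])"
proof -
  define y where "y = bump R x"
  define A where "A = R \<inter> {x<..<M}"
  define B where "B = R \<inter> {..<y}"
  have y: "y \<le> x" "{y..x} \<subseteq> R" "\<And>k. y = Suc k \<Longrightarrow> k \<notin> R"
    using bump_old[OF x(1)] unfolding y_def by auto
  have fin: "finite A" "finite B" unfolding A_def B_def by auto
  have "R \<inter> {..<M} = A \<union> ({y..x} \<union> B)"
    using y x M unfolding A_def B_def by auto
  moreover have "dec (A \<union> ({y..x} \<union> B)) = dec A @ dec {y..x} @ dec B"
    using dec_Un[of A "{y..x} \<union> B"] dec_Un[of "{y..x}" B] fin y unfolding A_def B_def by fastforce
  ultimately have 1: "dec (R \<inter> {..<M}) = dec A @ dec {y..x} @ dec B" by simp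
  have 2: "row_insert R x = R" using x unfolding row_insert_def by simp
  have "{y..x} = insert x {y..<x}" "{y..x} = insert y {Suc y..x}" using y(1) by auto
  then have 3: "dec {y..x} = x # dec {y..<x}" "dec {y..x} = dec {Suc y..x} @ [y]"
    using dec_insert_max[of "{y..<x}" x] dec_insert_min[of "{Suc y..x}" y] by auto
  have farA: "Suc x < q" if "q \<in> A" for q
    using that x(2) unfolding A_def by (auto intro: Suc_lessI)
  have farB: "Suc q < y" if "q \<in> B" for q
    using that y(3)[of q] unfolding B_def by (auto intro: Suc_lessI)
  have "hecke_equiv (x # dec A @ dec {y..x} @ dec B) (dec A @ x # dec {y..x} @ dec B)"
    using hecke_equiv_commute_context[of "dec A" x "[]" "dec {y..x} @ dec B"] fin farA by simp
  also have "hecke_equiv \<dots> (dec A @ dec {y..x} @ dec B)"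
    using hecke_equiv_context[OF hecke_equiv_idem, of "dec A" x "dec {y..<x} @ dec B" "[]"] 3(1) by simp
  also have "hecke_equiv \<dots> (dec A @ dec {Suc y..x} @ y # y # dec B)"
    using hecke_equiv_sym[OF hecke_equiv_context[OF hecke_equiv_idem, of "dec A @ dec {Suc y..x}" y "dec B" "[]"]] 3(2)
    by simp
  also have "hecke_equiv \<dots> (dec A @ dec {y..x} @ dec B @ [y])"
    using hecke_equiv_commute_context[of "dec B" y "dec A @ dec {Suc y..x} @ [y]" "[]"] 3(2) fin farB by simp
  finally show ?thesis unfolding 1 2 y_def by simp
qed

text \<open>The row \<open>R\<close> is infinite, so only its truncations are words.\<close>

definition balanced_row :: "nat list \<Rightarrow> nat set \<Rightarrow> nat list \<Rightarrow> bool" where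
  "balanced_row w R t \<longleftrightarrow> (\<exists>M0. \<forall>M\<ge>M0. balanced (w @ dec (R \<inter> {..<M}) @ t))"

lemma balanced_row_equiv:
  assumes "hecke_equiv w w'" "balanced_row w R t"
  shows "balanced_row w' R t"
proof -
  have "hecke_equiv (w @ s) (w' @ s)" for s using hecke_equiv_append[OF assms(1)] by simp
  then show ?thesis using assms(2) balanced_equiv unfolding balanced_row_def by blast
qed

lemma balanced_row_balanced: "balanced_row w R t \<Longrightarrow> balanced w"
  unfolding balanced_row_def using balanced_prefix by blast

text \<open>Between the inserted \<open>x\<close> and the entry \<open>x\<close> the word has only
  row entries above \<open>x\<close>. So \<open>x - 1\<close> does not occur there, and balance
  rules out \<open>x + 1\<close>.\<close>

lemma balanced_row_separated:
  assumes "balanced_row (w @ [x]) R t" "x \<in> R"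
  shows "Suc x \<notin> R"
proof
  assume "Suc x \<in> R"
  obtain M where M: "Suc x < M" "balanced ((w @ [x]) @ dec (R \<inter> {..<M}) @ t)"
    using assms(1) unfolding balanced_row_def by (metis lessI less_imp_le max.cobounded1 max.cobounded2 max.strict_coboundedI1)
  define A where "A = R \<inter> {x<..<M}"
  define B where "B = R \<inter> {..<x}"
  have "R \<inter> {..<M} = A \<union> insert x B" using assms(2) M unfolding A_def B_def by auto
  moreover have "dec (A \<union> insert x B) = dec A @ x # dec B"
    using dec_Un[of A "insert x B"] dec_insert_max[of B x] unfolding A_def B_def by fastforce
  ultimately have "balanced (w @ x # dec A @ x # (dec B @ t))" using M by simp
  moreover have A: "set (dec A) = A" unfolding A_def by simp
  ultimately have "(\<exists>j\<in>A. Suc j = x) \<longleftrightarrow> Suc x \<in> A"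
    using balanced_pattern[of w x "dec A" "dec B @ t"] unfolding A_def by simp
  then show False using \<open>Suc x \<in> R\<close> M unfolding A_def by auto
qed

lemma balanced_row_step:
  assumes "infinite R" "balanced_row (w @ [x]) R t"
  shows "balanced_row w (row_insert R x) (bump R x # t)"
proof -
  obtain M0 where M0: "\<And>M. M \<ge> M0 \<Longrightarrow> balanced ((w @ [x]) @ dec (R \<inter> {..<M}) @ t)"
    using assms(2) unfolding balanced_row_def by blast
  have "balanced (w @ dec (row_insert R x \<inter> {..<M}) @ bump R x # t)"
    if "M \<ge> max M0 (Suc (max x (bump R x)))" for M
  proof -
    have M: "M0 \<le> M" "x < M" "bump R x < M" using that by auto
    have "hecke_equiv (x # dec (R \<inter> {..<M})) (dec (row_insert R x \<inter> {..<M}) @ [bump R x])"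
      using row_word_new[OF assms(1) _ M(3)] row_word_old[OF _ balanced_row_separated[OF assms(2)] M(2)] by blast
    from hecke_equiv_context[OF this, of w t] balanced_equiv M0[OF M(1)]
    show ?thesis by simp
  qed
  then show ?thesis unfolding balanced_row_def by blast
qed

section \<open>Inserting whole words into a row\<close>

fun bumped :: "nat set \<Rightarrow> nat list \<Rightarrow> nat list" where
  "bumped R [] = []"
| "bumped R (x # xs) = bump R x # bumped (row_insert R x) xs"

fun row_inserts :: "nat set \<Rightarrow> nat list \<Rightarrow> nat set" where
  "row_inserts R [] = R"
| "row_inserts R (x # xs) = row_inserts (row_insert R x) xs"

text \<open>The condition under which the third insertion case respects Hecke equivalence, required
  of each letter at the moment of its insertion.\<close>

fun separated :: "nat set \<Rightarrow> nat list \<Rightarrow> bool" where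
  "separated R [] = True"
| "separated R (x # xs) = (\<not> (x \<in> R \<and> Suc x \<in> R) \<and> separated (row_insert R x) xs)"

lemma length_bumped [simp]: "length (bumped R xs) = length xs"
  by (induction xs arbitrary: R) auto

lemma infinite_row_inserts: "infinite R \<Longrightarrow> infinite (row_inserts R xs)"
  by (induction xs arbitrary: R) (auto simp: infinite_row_insert)

lemma row_inserts_subset: "row_inserts R xs \<subseteq> set xs \<union> R"
proof (induction xs arbitrary: R)
  case (Cons x xs)
  then show ?case using row_insert_subset[of R x] by fastforce
qed simp

lemma balanced_row_steps:
  assumes "infinite R" "balanced_row (w @ rev xs) R t"
  shows "balanced_row w (row_inserts R xs) (rev (bumped R xs) @ t)" "separated R xs"
proof -
  have "balanced_row w (row_inserts R xs) (rev (bumped R xs) @ t) \<and> separated R xs"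
    using assms
  proof (induction xs arbitrary: R t)
    case (Cons x xs)
    then have g: "balanced_row ((w @ rev xs) @ [x]) R t" by simp
    then show ?case
      using Cons.IH[OF infinite_row_insert[OF Cons.prems(1)] balanced_row_step[OF Cons.prems(1) g]]
        balanced_row_separated[OF g] by auto
  qed simp
  then show "balanced_row w (row_inserts R xs) (rev (bumped R xs) @ t)" "separated R xs" by auto
qed

text \<open>A gap of the row from \<open>x\<close> to \<open>K\<close> cannot be bridged: the run of
  an entry \<open>z\<close> cannot reach down across the missing \<open>Suc x\<close>, and a new
  letter \<open>z\<close> bumps an entry above itself.\<close>

lemma bump_gt:
  assumes "infinite S" "\<And>r. r \<in> S \<Longrightarrow> r \<le> x \<or> K < r" "x < K" "x < z"
  shows "K < bump S z"
proof (cases "z \<in> S")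
  case True
  have "\<not> bump S z \<le> x"
  proof
    assume "bump S z \<le> x"
    then have "Suc x \<in> S" using bump_old(2)[OF True] assms(4) by auto
    then show False using assms(2,3) by fastforce
  qed
  then show ?thesis using assms(2) bump_in[OF assms(1)] by blast
next
  case False
  then show ?thesis using bump_new[OF assms(1) False] assms by fastforce
qed

lemma row_insert_gap:
  assumes R: "infinite R" and x: "\<not> (x \<in> R \<and> Suc x \<in> R)" and r: "r \<in> row_insert R x"
  shows "r \<le> x \<or> max (Suc x) (bump R x) < r"
proof (cases "x \<in> R")
  case True
  then show ?thesis using r x bump_old(1)[OF True] unfolding row_insert_def
    by (cases "r = Suc x") (auto simp: max_def)
next
  case False
  have "r \<noteq> bump R x" "r = x \<or> r \<in> R" using r False bump_new(2)[OF R False] unfolding row_insert_def by auto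
  then show ?thesis using bump_new(2,3)[OF R False]
    by (metis Suc_leI le_neq_implies_less max.absorb2 order_le_less linorder_not_le)
qed

lemma bump_mono:
  assumes R: "infinite R" and x: "\<not> (x \<in> R \<and> Suc x \<in> R)" and z: "x < z"
  shows "bump R x < bump (row_insert R x) z"
  using bump_gt[OF infinite_row_insert[OF R] row_insert_gap[OF R x] _ z] by simp

lemma sorted_bumped:
  assumes "infinite R" "separated R xs" "sorted_wrt (<) xs"
  shows "sorted_wrt (<) (bumped R xs)"
  using assms
proof (induction xs arbitrary: R)
  case (Cons x xs)
  have IH: "sorted_wrt (<) (bumped (row_insert R x) xs)" using Cons infinite_row_insert by simp
  show ?case
  proof (cases xs)
    case (Cons z zs)
    have "bump R x < bump (row_insert R x) z" using Cons Cons.prems by (intro bump_mono) auto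
    then show ?thesis using IH Cons by auto
  qed simp
qed simp

lemma bumped_gt:
  assumes "infinite S" "\<And>r. r \<in> S \<Longrightarrow> r \<le> x \<or> K < r" "x < K"
    and "sorted_wrt (<) zs" "\<forall>z\<in>set zs. x < z" "separated S zs"
  shows "\<forall>b\<in>set (bumped S zs). K < b"
proof (cases zs)
  case (Cons z zs')
  have "K < bump S z" using bump_gt[OF assms(1-3)] assms(5) Cons by simp
  then show ?thesis using sorted_bumped[OF assms(1,6,4)] Cons by auto
qed simp

text \<open>The entry \<open>c\<close> without successor is a wall. Inserting \<open>b\<close>
  touches only the row up to \<open>c\<close>, inserting \<open>z\<close> only the part above, and
  no run crosses from \<open>c\<close> to \<open>c + 1\<close>.\<close>

lemma swap_step:
  assumes R: "infinite R" and c: "c \<in> R" "Suc c \<notin> R" and b: "b \<le> c" "c < z"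
  shows "bump (row_insert R z) b = bump R b" "bump (row_insert R b) z = bump R z"
    "row_insert (row_insert R z) b = row_insert (row_insert R b) z"
proof -
  have bb: "bump R b \<le> c" using bump_old(1)[of b R] bump_new(3)[OF R, of b c] b c
    by (cases "b \<in> R") (auto simp: le_less)
  have bz: "c < bump R z"
    using bump_gt[OF R, of c "Suc c" z] b c by (metis Suc_lessD Suc_lessI lessI not_less)
  have mz: "v \<in> row_insert R z \<longleftrightarrow> v \<in> R" if "v \<le> c" for v
    using that b bz unfolding row_insert_def by auto
  have mb: "v \<in> row_insert R b \<longleftrightarrow> v \<in> R" if "c < v" for v
    using that b bb unfolding row_insert_def by auto
  show 1: "bump (row_insert R z) b = bump R b"
  proof (cases "b \<in> R")
    case True
    show ?thesis
      using bump_old[OF True] mz b by (intro bump_oldI) (auto simp: subset_iff)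
  next
    case False
    show ?thesis
    proof (rule bump_newI)
      show "b \<notin> row_insert R z" using False mz b by simp
      show "bump R b \<in> row_insert R z" using bump_new[OF R False] mz bb by simp
      fix v assume v: "v \<in> row_insert R z" "b < v"
      show "bump R b \<le> v"
        using bump_new(3)[OF R False _ v(2)] mz[of v] v bb by (cases "v \<le> c") auto
    qed (use bump_new[OF R False] in auto)
  qed
  show 2: "bump (row_insert R b) z = bump R z"
  proof (cases "z \<in> R")
    case True
    note o = bump_old[OF True]
    have "{bump R z..z} \<subseteq> row_insert R b" using o(2) mb bz by (auto simp: subset_iff)
    moreover have "k \<notin> row_insert R b" if "bump R z = Suc k" for k
    proof (cases "c < k")
      case False
      then have "k = c" using that bz by simp
      then have "Suc c \<in> {bump R z..z}" using that o(1) by simp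
      then show ?thesis using o(2) c by blast
    qed (use mb that o in blast)
    ultimately show ?thesis using o(1) by (intro bump_oldI) auto
  next
    case False
    show ?thesis
    proof (rule bump_newI)
      fix v assume v: "v \<in> row_insert R b" "z < v"
      then show "bump R z \<le> v" using bump_new(3)[OF R False, of v] mb[of v] b by auto
    qed (use bump_new[OF R False] mb b False in auto)
  qed
  show "row_insert (row_insert R z) b = row_insert (row_insert R b) z"
    using mz[OF b(1)] mb[OF b(2)] 1 2 bb bz b unfolding row_insert_def by auto
qed

lemma swap_steps:
  assumes "infinite R" "c \<in> R" "Suc c \<notin> R" "b \<le> c" "sorted_wrt (<) (c # zs)" "separated R zs"
  shows "bumped (row_insert R b) zs = bumped R zs" "bump (row_inserts R zs) b = bump R b"
    "row_insert (row_inserts R zs) b = row_inserts (row_insert R b) zs"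
proof -
  have "bumped (row_insert R b) zs = bumped R zs \<and> bump (row_inserts R zs) b = bump R b \<and>
    row_insert (row_inserts R zs) b = row_inserts (row_insert R b) zs"
    using assms
  proof (induction zs arbitrary: R c)
    case (Cons z zs)
    have "c < z" using Cons.prems by simp
    note s = swap_step[OF Cons.prems(1-4) this]
    \<comment> \<open>The wall moves up to \<open>z\<close>, which is now in the row while
      \<open>Suc z\<close> is not.\<close>
    have "bumped (row_insert (row_insert R z) b) zs = bumped (row_insert R z) zs \<and>
      bump (row_inserts (row_insert R z) zs) b = bump (row_insert R z) b \<and>
      row_insert (row_inserts (row_insert R z) zs) b = row_inserts (row_insert (row_insert R z) b) zs"
      using Cons.prems \<open>c < z\<close>
      by (intro Cons.IH[of _ z]) (auto simp: infinite_row_insert row_insert_Suc)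
    then show ?case using s by simp
  qed simp
  then show "bumped (row_insert R b) zs = bumped R zs" "bump (row_inserts R zs) b = bump R b"
    "row_insert (row_inserts R zs) b = row_inserts (row_insert R b) zs" by auto
qed

section \<open>Paired letters and the operator on two factors\<close>

text \<open>
  For increasing words \<open>us\<close> and \<open>vs\<close>, this is equivalent to the pairing in \<open>f^*_i\<close> leaving no letter of
  \<open>us\<close> unpaired, although that pairing starts from the largest letters.
\<close>

fun paired :: "nat list \<Rightarrow> nat list \<Rightarrow> bool" where
  "paired [] vs = True"
| "paired (a # us) [] = False"
| "paired (a # us) (b # vs) = (b \<le> a \<and> paired us vs)"

text \<open>
  In terms of increasing words, \<open>move us vs us' vs' n\<close> says that \<open>f^*_i\<close> takes
  \<open>(h^(i+1), h^i) = (rev vs, rev us)\<close> to \<open>(rev vs', rev us')\<close>, where \<open>n\<close> is the number of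
  letters of \<open>vs\<close> left unpaired. The letter \<open>x\<close> in the first two rules is the largest unpaired one.
\<close>

inductive move :: "nat list \<Rightarrow> nat list \<Rightarrow> nat list \<Rightarrow> nat list \<Rightarrow> nat \<Rightarrow> bool" where
  base: "paired us vs \<Longrightarrow> \<forall>b\<in>set vs. x < b \<Longrightarrow> Suc x \<notin> set us \<Longrightarrow>
    move (x # us) vs us (x # vs) (length vs - length us)"
| special: "paired us vs \<Longrightarrow>
    move (x # Suc x # us) (Suc x # vs) (x # us) (x # Suc x # vs) (length vs - length us)"
| skip: "move us vs us' vs' n \<Longrightarrow> move (a # us) vs (a # us') vs' n"
| pair: "move us vs us' vs' n \<Longrightarrow> b \<le> a \<Longrightarrow> move (a # us) (b # vs) (a # us') (b # vs') n"

lemma move_subset: "move us vs us' vs' n \<Longrightarrow> set us' \<subseteq> set us"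
  by (induction rule: move.induct) auto

text \<open>A letter of \<open>us\<close> that is at most \<open>b + 1\<close> forces
  \<open>a = b\<close> and \<open>a + 1\<close> in \<open>us\<close>. The two copies of
  \<open>a\<close> would then enclose \<open>a + 1\<close> but not \<open>a - 1\<close>, as all
  letters of \<open>us\<close> exceed \<open>a\<close>. Hence \<open>b\<close> can be moved next to
  its partner \<open>a\<close>.\<close>

lemma pair_far:
  assumes "balanced (w @ b # rev us @ [a])" "b \<le> a" "sorted_wrt (<) (a # us)" "q \<in> set us"
  shows "Suc b < q"
proof (rule ccontr)
  assume "\<not> Suc b < q"
  then have "b = a" "q = Suc a" using assms by fastforce+
  moreover have "a \<notin> set (rev us)" using assms(3) by auto
  ultimately have "(\<exists>j\<in>set us. Suc j = a) \<longleftrightarrow> Suc a \<in> set us"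
    using balanced_pattern[of w a "rev us" "[]"] assms(1) by simp
  then show False using \<open>q = Suc a\<close> assms(3,4) by fastforce
qed

text \<open>Makes balance available after the operator has acted. In the special rule both words
  reduce to \<open>rev vs @ rev us @ [Suc x, x]\<close>; in the pairing rule \<open>b\<close> is
  moved next to \<open>a\<close> and back.\<close>

lemma move_equiv:
  assumes "move us vs us' vs' n" "sorted_wrt (<) us" "balanced (rev vs @ rev us)"
  shows "hecke_equiv (rev vs @ rev us) (rev vs' @ rev us')"
  using assms
proof (induction rule: move.induct)
  case (base us vs x)
  have "Suc x < q" if "q \<in> set (rev us)" for q
    using that base by (auto intro!: Suc_lessI)
  then show ?case
    using hecke_equiv_sym[OF hecke_equiv_commute_context[of "rev us" x "rev vs" "[]"]] by auto
next
  case (special us vs x)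
  have far: "Suc (Suc x) < q" if "q \<in> set us" for q
  proof (rule pair_far[of "rev vs" "Suc x" us "Suc x"])
    show "balanced (rev vs @ Suc x # rev us @ [Suc x])"
      using special.prems(2) balanced_prefix[of "rev vs @ Suc x # rev us @ [Suc x]" "[x]"] by simp
  qed (use special that in auto)
  have "hecke_equiv (rev vs @ Suc x # rev us @ [Suc x, x]) (rev vs @ rev us @ [Suc x, Suc x, x])"
    using hecke_equiv_commute_context[of "rev us" "Suc x" "rev vs" "[Suc x, x]"] far by simp
  also have "hecke_equiv \<dots> (rev vs @ rev us @ [Suc x, x])"
    using hecke_equiv_context[OF hecke_equiv_idem, of "rev vs @ rev us" "Suc x" "[x]" "[]"] by simp
  finally have 1: "hecke_equiv (rev vs @ Suc x # rev us @ [Suc x, x]) (rev vs @ rev us @ [Suc x, x])" .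
  have "hecke_equiv (rev vs @ Suc x # x # rev us @ [x]) (rev vs @ Suc x # rev us @ [x, x])"
    using hecke_equiv_commute_context[of "rev us" x "rev vs @ [Suc x]" "[x]"] far
    by (auto dest: Suc_lessD)
  also have "hecke_equiv \<dots> (rev vs @ Suc x # rev us @ [x])"
    using hecke_equiv_context[OF hecke_equiv_idem, of "rev vs @ Suc x # rev us" x "[]" "[]"] by simp
  also have "hecke_equiv \<dots> (rev vs @ rev us @ [Suc x, x])"
    using hecke_equiv_commute_context[of "rev us" "Suc x" "rev vs" "[x]"] far by simp
  finally show ?case using hecke_equiv_trans[OF 1 hecke_equiv_sym] by simp
next
  case (skip us vs us' vs' n a)
  have "balanced (rev vs @ rev us)"
    using skip.prems(2) balanced_prefix[of "rev vs @ rev us" "[a]"] by simp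
  then have "hecke_equiv (rev vs @ rev us) (rev vs' @ rev us')" using skip by simp
  from hecke_equiv_append[OF this, of "[a]" "[a]"] show ?case by simp
next
  case (pair us vs us' vs' n b a)
  have far: "Suc b < q" if "q \<in> set us" for q
    using pair_far[of "rev vs" b us a q] pair.prems pair.hyps that by simp
  have 1: "hecke_equiv (rev vs @ b # rev us @ [a]) (rev vs @ rev us @ b # [a])"
    by (rule hecke_equiv_commute_context) (use far in auto)
  then have "balanced (rev vs @ rev us @ b # [a])" using balanced_equiv pair.prems(2) by simp
  then have "balanced (rev vs @ rev us)" using balanced_prefix[of "rev vs @ rev us"] by simp
  then have "hecke_equiv (rev vs @ rev us) (rev vs' @ rev us')" using pair by simp
  from hecke_equiv_append[OF this, of "[b, a]" "[b, a]"]
  have 2: "hecke_equiv (rev vs @ rev us @ b # [a]) (rev vs' @ rev us' @ b # [a])" by simp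
  have 3: "hecke_equiv (rev vs' @ b # rev us' @ [a]) (rev vs' @ rev us' @ b # [a])"
    by (rule hecke_equiv_commute_context) (use far move_subset[OF pair.hyps(1)] in auto)
  show ?case using hecke_equiv_trans[OF hecke_equiv_trans[OF 1 2] hecke_equiv_sym[OF 3]] by simp
qed

lemma bump_pair:
  assumes R: "infinite R" and b: "b \<le> a" "\<not> (b \<in> row_insert R a \<and> Suc b \<in> row_insert R a)"
  shows "bump (row_insert R a) b \<le> bump R a"
proof (cases "a \<in> R")
  case True
  then have r: "row_insert R a = R" unfolding row_insert_def by simp
  note o = bump_old[OF True]
  consider "b = a" | "b < bump R a" | "bump R a \<le> b" "b < a" using b(1) by linarith
  then show ?thesis
  proof cases
    case 2
    then show ?thesis
      using r o bump_old(1)[of b R] bump_new(3)[OF R, of b "bump R a"] bump_in[OF R, of a]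
      by (cases "b \<in> R") auto
  next
    case 3
    then have "b \<in> R" "Suc b \<in> R" using o(2) by auto
    then show ?thesis using b(2) r by simp
  qed (use r in simp)
next
  case False
  have "bump (row_insert R a) b \<le> a"
    using bump_old(1)[of b "row_insert R a"] bump_new(3)[OF infinite_row_insert[OF R, of a], of b a] b(1)
    by (cases "b \<in> row_insert R a") (auto simp: le_less)
  then show ?thesis using bump_new(2)[OF R False] by simp
qed

text \<open>A paired letter \<open>b\<close> may be inserted right after its partner
  \<open>a\<close>, before the rest of \<open>us\<close>: the words are equivalent by
  \<open>pair_far\<close>, and the insertions agree by \<open>swap_steps\<close> with
  \<open>a\<close> as the wall. A pair thus acts as one step from \<open>R\<close> to
  \<open>S\<close> and bumps a pair again.\<close>

lemma pair_step:
  assumes R: "infinite R" and g: "balanced_row (rev (b # vs) @ rev (a # us)) R t"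
    and ba: "b \<le> a" and us: "sorted_wrt (<) (a # us)"
  defines "S \<equiv> row_insert (row_insert R a) b"
  shows "infinite S" "balanced_row (rev vs @ rev us) S (bump (row_insert R a) b # bump R a # t)"
    "bumped (row_insert R a) us = bumped S us" "bump (row_inserts (row_insert R a) us) b = bump (row_insert R a) b"
    "row_insert (row_inserts (row_insert R a) us) b = row_inserts S us" "bump (row_insert R a) b \<le> bump R a"
    "\<not> (b \<in> row_insert R a \<and> Suc b \<in> row_insert R a)" "\<And>q. q \<in> set us \<Longrightarrow> Suc b < q"
proof -
  show "infinite S" unfolding S_def using R by (simp add: infinite_row_insert)
  have g': "balanced_row (rev vs @ b # rev us @ [a]) R t" using g by simp
  show far: "Suc b < q" if "q \<in> set us" for q
    using pair_far[OF balanced_row_balanced[OF g'] ba us that] .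
  have "hecke_equiv (rev vs @ b # rev us @ [a]) (rev vs @ rev us @ b # [a])"
    by (rule hecke_equiv_commute_context) (use far in auto)
  from balanced_row_equiv[OF this g'] have g2: "balanced_row ((rev vs @ rev us @ [b]) @ [a]) R t" by simp
  note g3 = balanced_row_step[OF R g2]
  then have g4: "balanced_row ((rev vs @ rev us) @ [b]) (row_insert R a) (bump R a # t)" by simp
  show "balanced_row (rev vs @ rev us) S (bump (row_insert R a) b # bump R a # t)"
    using balanced_row_step[OF infinite_row_insert[OF R] g4] unfolding S_def by simp
  show "\<not> (b \<in> row_insert R a \<and> Suc b \<in> row_insert R a)" using balanced_row_separated[OF g4] by blast
  then show "bump (row_insert R a) b \<le> bump R a" by (rule bump_pair[OF R ba])
  have "separated R (a # us)" using balanced_row_steps(2)[OF R, of "rev vs @ [b]" "a # us" t] g' by simp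
  then have "Suc a \<notin> row_insert R a" "separated (row_insert R a) us" using row_insert_Suc[OF R] by auto
  from swap_steps[OF infinite_row_insert[OF R] row_insert_in this(1) ba us this(2)]
  show "bumped (row_insert R a) us = bumped S us" "bump (row_inserts (row_insert R a) us) b = bump (row_insert R a) b"
    "row_insert (row_inserts (row_insert R a) us) b = row_inserts S us" unfolding S_def by auto
qed

lemma paired_bumped:
  assumes "paired us vs" "infinite R" "sorted_wrt (<) us" "balanced_row (rev vs @ rev us) R t"
  shows "paired (bumped R us) (bumped (row_inserts R us) vs)"
  using assms
proof (induction us vs arbitrary: R t rule: paired.induct)
  case (3 a us b vs)
  note p = pair_step[OF 3(3,5) _ 3(4)]
  have "b \<le> a" using 3 by simp
  have "paired (bumped (row_insert (row_insert R a) b) us) (bumped (row_inserts (row_insert (row_insert R a) b) us) vs)"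
    using 3 p[OF \<open>b \<le> a\<close>] by (intro 3(1)) auto
  then show ?case using p[OF \<open>b \<le> a\<close>] by simp
qed auto

text \<open>Removing the least entry above \<open>x\<close> in favour of \<open>x\<close> is invisible to letters beyond that entry,
  unless a run of the row joins them.\<close>

lemma replace_step:
  assumes S: "infinite S" and x: "x \<notin> S" and y: "y = bump S x" and z: "y < z" "\<not> {y..z} \<subseteq> S"
  shows "bump (row_insert S x) z = bump S z" "row_insert (row_insert S x) z = row_insert (row_insert S z) x"
    "x \<notin> row_insert S z" "bump (row_insert S z) x = y"
proof -
  note n = bump_new[OF S x, folded y]
  have r: "row_insert S x = insert x (S - {y})" using x unfolding row_insert_def y by simp
  have bz: "y < bump S z"
  proof (cases "z \<in> S")
    case True
    note o = bump_old[OF True]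
    show ?thesis
    proof (rule ccontr)
      assume "\<not> y < bump S z"
      then have "{y..z} \<subseteq> {bump S z..z}" by auto
      then show False using o(2) z(2) by blast
    qed
  qed (use bump_new(2)[OF S] z in fastforce)
  show 1: "bump (row_insert S x) z = bump S z"
  proof (cases "z \<in> S")
    case True
    note o = bump_old[OF True]
    have "{bump S z..z} \<subseteq> row_insert S x" using o(2) bz unfolding r by auto
    moreover have "k \<notin> row_insert S x" if "bump S z = Suc k" for k
      using o(3)[OF that] that bz n(2) unfolding r by auto
    ultimately show ?thesis using o(1) by (intro bump_oldI) auto
  next
    case False
    show ?thesis
      using bump_new[OF S False] False bz z(1) n(2) by (intro bump_newI) (auto simp: r)
  qed
  show xn: "x \<notin> row_insert S z" using x n z unfolding row_insert_def by auto
  show 2: "bump (row_insert S z) x = y"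
  proof (rule bump_newI)
    show "y \<in> row_insert S z" using n bz unfolding row_insert_def by auto
    show "y \<le> v" if "v \<in> row_insert S z" "x < v" for v
      using that n(3)[of v] row_insert_subset[of S z] z(1) by fastforce
  qed (use xn n in auto)
  have "row_insert (row_insert S x) z = (if z \<in> S then row_insert S x else insert z (row_insert S x - {bump S z}))"
    using 1 z n unfolding row_insert_def[of "row_insert S x"] by (auto simp: r)
  moreover have "row_insert (row_insert S z) x = insert x (row_insert S z - {y})"
    using xn 2 unfolding row_insert_def[of "row_insert S z" x] by simp
  ultimately show "row_insert (row_insert S x) z = row_insert (row_insert S z) x"
    using bz n z unfolding row_insert_def[of S z] r by auto
qed

text \<open>All letters of \<open>zs\<close> lie beyond \<open>c\<close>, and the missing
  \<open>c + 1\<close> keeps their runs from reaching down to \<open>y\<close>.\<close>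

lemma replace_steps:
  assumes "infinite S" "x \<notin> S" "y = bump S x" "y < c" "Suc c \<notin> S"
    and "sorted_wrt (<) (c # zs)" "separated S zs"
  shows "bumped (row_insert S x) zs = bumped S zs" "bump (row_inserts S zs) x = y"
    "row_insert (row_inserts S zs) x = row_inserts (row_insert S x) zs"
proof -
  have "bumped (row_insert S x) zs = bumped S zs \<and> bump (row_inserts S zs) x = y \<and>
    row_insert (row_inserts S zs) x = row_inserts (row_insert S x) zs"
    using assms
  proof (induction zs arbitrary: S c)
    case (Cons z zs)
    have "c < z" using Cons.prems by simp
    then have z: "y < z" "Suc c \<in> {y..z}" using Cons.prems by auto
    then have "\<not> {y..z} \<subseteq> S" using Cons.prems by blast
    note z = z(1) this
    note s = replace_step[OF Cons.prems(1-3) z]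
    have "bumped (row_insert (row_insert S z) x) zs = bumped (row_insert S z) zs \<and>
      bump (row_inserts (row_insert S z) zs) x = y \<and>
      row_insert (row_inserts (row_insert S z) zs) x = row_inserts (row_insert (row_insert S z) x) zs"
      using Cons.prems z s by (intro Cons.IH[of _ z]) (auto simp: infinite_row_insert row_insert_Suc)
    then show ?case using s by simp
  qed simp
  then show "bumped (row_insert S x) zs = bumped S zs" "bump (row_inserts S zs) x = y"
    "row_insert (row_inserts S zs) x = row_inserts (row_insert S x) zs" by auto
qed

section \<open>The operator commutes with insertion into a row\<close>

text \<open>On one side \<open>x\<close> is inserted before \<open>us\<close>, on the other between
  \<open>us\<close> and \<open>vs\<close>. If \<open>us\<close> is empty, the two sequences
  coincide. Otherwise, let \<open>x\<close> bump \<open>y\<close>, let \<open>z\<close> be the first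
  letter of \<open>us\<close> and \<open>b\<close> its partner. If the insertions can be
  interchanged, \<open>y\<close> is moved by the rule \<open>base\<close>. A run from
  \<open>y\<close> to \<open>z\<close> leads to the rule \<open>special\<close>. If \<open>x\<close>
  is new and \<open>z \<le> y\<close>, a pair splits off and \<open>b\<close> takes over the role of
  \<open>x\<close>.\<close>

lemma base_step:
  assumes "paired us vs" "infinite R" "sorted_wrt (<) (x # us)" "sorted_wrt (<) (x # vs)"
    and "Suc x \<notin> set us" "balanced_row (rev vs @ rev us @ [x]) R t"
  shows "move (bump R x # bumped (row_insert R x) us) (bumped (row_inserts (row_insert R x) us) vs)
      (bumped R us) (bumped (row_inserts R us) (x # vs)) (length vs - length us) \<and>
    row_inserts (row_inserts (row_insert R x) us) vs = row_inserts (row_inserts R us) (x # vs)"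
  using assms
proof (induction us arbitrary: x vs R t)
  case Nil
  then have "balanced_row ((rev vs @ []) @ [x]) R t" by simp
  from balanced_row_step[OF Nil.prems(2) this] balanced_row_separated[OF this]
  have g: "balanced_row (rev vs) (row_insert R x) (bump R x # t)" and s: "\<not> (x \<in> R \<and> Suc x \<in> R)" by auto
  have "separated (row_insert R x) vs"
    using balanced_row_steps(2)[of "row_insert R x" "[]"] g infinite_row_insert[OF Nil.prems(2)] by simp
  then have "\<forall>b\<in>set (bumped (row_insert R x) vs). max (Suc x) (bump R x) < b"
    by (intro bumped_gt[OF infinite_row_insert[OF Nil.prems(2)] row_insert_gap[OF Nil.prems(2) s]])
      (use Nil.prems in auto)
  then show ?case using move.base[of "[]" "bumped (row_insert R x) vs" "bump R x"] by simp
next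
  case (Cons z us)
  note R = Cons.prems(2)
  obtain b vs' where vs: "vs = b # vs'" using Cons.prems(1) by (cases vs) auto
  define y where "y = bump R x"
  define R1 where "R1 = row_insert R x"
  have R1: "infinite R1" unfolding R1_def using R by (rule infinite_row_insert)
  have gA0: "balanced_row ((rev vs @ rev (z # us)) @ [x]) R t" using Cons.prems by simp
  have gA: "balanced_row (rev vs @ rev (z # us)) R1 (y # t)"
    using balanced_row_step[OF R gA0] unfolding R1_def y_def .
  have sx: "\<not> (x \<in> R \<and> Suc x \<in> R)" using balanced_row_separated[OF gA0] by blast
  have sep1: "separated R1 (z # us)" using balanced_row_steps(2)[OF R1 gA] .
  have sepv: "separated (row_inserts R1 (z # us)) vs"
    using balanced_row_steps(2)[OF infinite_row_inserts[OF R1], of "[]" vs "z # us"] balanced_row_steps(1)[OF R1 gA] by simp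
  have xu: "Suc x < q" if "q \<in> set (z # us)" for q
    using that Cons.prems(3,5) by (metis Suc_lessI list.set_intros sorted_wrt.simps(2))
  have "hecke_equiv (rev vs @ x # rev (z # us) @ []) (rev vs @ rev (z # us) @ x # [])"
    by (rule hecke_equiv_commute_context) (use xu in auto)
  then have gB: "balanced_row ((rev vs @ [x]) @ rev (z # us)) R t"
    using balanced_row_equiv[OF hecke_equiv_sym] Cons.prems(6) by simp
  have sepB: "separated R (z # us)" using balanced_row_steps(2)[OF R gB] .
  have hmo: "paired (bumped R1 (z # us)) (bumped (row_inserts R1 (z # us)) vs)"
    using paired_bumped[OF Cons.prems(1) R1 _ gA] Cons.prems(3) by simp
  have zb: "b \<le> z" "x < b" "x < z" "paired us vs'" "sorted_wrt (<) (z # us)" "sorted_wrt (<) vs'"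
    "\<forall>q\<in>set vs'. b < q"
    using Cons.prems vs by auto
  have zx: "Suc x < z" using xu by simp
  note pA = pair_step[OF R1 gA[unfolded vs] zb(1) zb(5)]
  \<comment> \<open>Covers all cases in which both orders bump the same letters; \<open>gap\<close>
    puts all bumped letters of \<open>vs\<close> above \<open>y\<close>, and \<open>S\<close>
    excludes the exceptional clause.\<close>
  have fin: "?case" if o: "bumped R (z # us) = bumped R1 (z # us)" "bump (row_inserts R (z # us)) x = y"
      "row_insert (row_inserts R (z # us)) x = row_inserts R1 (z # us)"
    and gap: "\<And>q. q \<in> set (z # us) \<Longrightarrow> y < q" and S: "Suc y \<notin> set (bumped R1 (z # us))"
  proof -
    have "r \<le> x \<or> max (Suc x) y < r" if "r \<in> row_inserts R1 (z # us)" for r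
      using that row_inserts_subset[of R1 "z # us"] row_insert_gap[OF R sx, of r] gap xu
      unfolding R1_def y_def by (metis UnE max_less_iff_conj subsetD)
    then have "\<forall>q\<in>set (bumped (row_inserts R1 (z # us)) vs). max (Suc x) y < q"
      using Cons.prems(4) sepv by (intro bumped_gt[OF infinite_row_inserts[OF R1]]) auto
    then have "move (y # bumped R1 (z # us)) (bumped (row_inserts R1 (z # us)) vs) (bumped R1 (z # us))
      (y # bumped (row_inserts R1 (z # us)) vs) (length (bumped (row_inserts R1 (z # us)) vs) - length (bumped R1 (z # us)))"
      using hmo S by (intro move.base) auto
    then show ?thesis using o unfolding R1_def[symmetric] y_def[symmetric] by simp
  qed
  show ?case
  proof (cases "x \<in> R")
    case True
    have sw: "Suc x \<notin> R" using sx True by blast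
    have e: "R1 = R" unfolding R1_def row_insert_def using True by simp
    have yx: "y \<le> x" unfolding y_def using bump_old[OF True] by simp
    \<comment> \<open>The letter inserted late and the wall are both \<open>x\<close>.\<close>
    note s = swap_steps[OF R True sw order_refl Cons.prems(3) sepB]
    have "\<forall>q\<in>set (bumped R1 (z # us)). Suc x < q"
    proof (rule bumped_gt[OF R1, of x])
      fix r assume "r \<in> R1"
      then show "r \<le> x \<or> Suc x < r" using row_insert_gap[OF R sx, of r] unfolding R1_def by auto
    qed (use zb sep1 Cons.prems(3) in auto)
    then have "Suc y \<notin> set (bumped R1 (z # us))" using yx by auto
    moreover have "y < q" if "q \<in> set (z # us)" for q using xu[OF that] yx by simp
    moreover have "bump (row_inserts R (z # us)) x = y" "row_insert (row_inserts R (z # us)) x = row_inserts R1 (z # us)"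
      using s(2,3) unfolding R1_def y_def by auto
    ultimately show ?thesis using e by (intro fin) auto
  next
    case False
    note n = bump_new[OF R False, folded y_def]
    have R1e: "R1 = insert x (R - {y})" unfolding R1_def row_insert_def y_def using False by simp
    have yk: "k \<notin> R" if "y = Suc k" for k
      using that n False by (metis Suc_n_not_le_n less_antisym)
    have gap1: "y < r" if "r \<in> R1" "x < r" for r
      using that n(3)[of r] unfolding R1e by (auto simp: le_less)
    show ?thesis
    proof (cases "y < z")
      case yz: True
      show ?thesis
      proof (cases "{y..z} \<subseteq> R")
        \<comment> \<open>No run joins \<open>y\<close> to \<open>z\<close>, so having
          \<open>x\<close> instead of \<open>y\<close> in the row is invisible to \<open>us\<close>.
          It remains to keep \<open>y + 1\<close> out of the bumped letters.\<close>
        case run: False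
        note r = replace_step[OF R False y_def yz run]
        have "Suc z \<notin> row_insert R z" using row_insert_Suc[OF R] sepB by simp
        note rs = replace_steps[OF infinite_row_insert[OF R] r(3) r(4)[symmetric] yz this zb(5)]
        have o: "bumped R (z # us) = bumped R1 (z # us)" "bump (row_inserts R (z # us)) x = y"
          "row_insert (row_inserts R (z # us)) x = row_inserts R1 (z # us)"
          using r rs sepB unfolding R1_def by auto
        have "Suc y < bump R1 z"
        proof (cases "z \<in> R")
          case True
          then have "bump R z \<noteq> y" using run bump_old[OF True] by blast
          moreover have "bump R z \<noteq> Suc y" using bump_old(3)[OF True] n(1) by blast
          moreover have "y < bump R1 z"
            using bump_gt[OF R1, of x y z] gap1 n(2) zb by (meson leI)
          ultimately show ?thesis using r(1) unfolding R1_def by simp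
        next
          case False
          then show ?thesis using bump_new(2)[OF R False] r(1) yz unfolding R1_def by simp
        qed
        then have "\<forall>q\<in>set (bumped R1 (z # us)). Suc y < q"
          using sorted_bumped[OF R1 sep1 zb(5)] by auto
        then show ?thesis using o yz zb(5) by (intro fin) auto
      next
        \<comment> \<open>Here the orders differ: \<open>z\<close> bumps \<open>y\<close> from
          \<open>R\<close>, but \<open>y + 1\<close> once \<open>x\<close> has replaced
          \<open>y\<close>. The partner \<open>b\<close> also bumps \<open>y + 1\<close>, which is
          the configuration of \<open>special\<close>.\<close>
        case run: True
        have zR: "z \<in> R" using run yz by auto
        have bz: "bump R z = y" using run yz yk by (intro bump_oldI) auto
        have rz: "row_insert R z = R" using zR unfolding row_insert_def by simp
        have zR1: "z \<in> R1" using zR yz unfolding R1e by simp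
        have rz1: "row_insert R1 z = R1" using zR1 unfolding row_insert_def by simp
        have bz1: "bump R1 z = Suc y"
          using run yz n(2) by (intro bump_oldI) (auto simp: R1e)
        have "Suc z \<notin> R" using sepB zR by simp
        note rs = replace_steps[OF R False y_def yz this zb(5)]
        have sep: "separated R us" using sepB rz by simp
        have bb: "bump R1 b = Suc y"
        proof (cases "b = z")
          case bz: False
          have "b \<notin> R1"
          proof
            assume "b \<in> R1"
            then have "y < b" using gap1 zb by blast
            then have "Suc b \<in> R1" using run bz zb n(2) unfolding R1e by auto
            then show False using pA(7) \<open>b \<in> R1\<close> rz1 by simp
          qed
          then have "b \<le> y" using run bz zb n(2) unfolding R1e by (metis DiffI atLeastAtMost_iff insertI2 leI less_imp_le singletonD subsetD nat_neq_iff)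
          then show ?thesis using \<open>b \<notin> R1\<close> run yz zb gap1 n(2)
            by (intro bump_newI) (auto simp: R1e Suc_le_eq)
        qed (use bz1 in simp)
        have V: "bumped (row_inserts R1 (z # us)) vs = Suc y # bumped (row_insert (row_inserts R1 us) b) vs'"
          using pA(4) bb rz1 vs by simp
        have hm': "paired (bumped R1 us) (bumped (row_insert (row_inserts R1 us) b) vs')"
          using hmo V bz1 rz1 by simp
        from move.special[OF this, of y] have
          "move (y # bumped R1 (z # us)) (bumped (row_inserts R1 (z # us)) vs) (y # bumped R1 us)
            (y # bumped (row_inserts R1 (z # us)) vs) (length vs - length (z # us))"
          using V bz1 rz1 vs by simp
        then show ?thesis
          using rs(1,2,3)[OF sep] bz rz rz1 unfolding R1_def[symmetric] y_def[symmetric] by simp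
      qed
    next
      \<comment> \<open>Now \<open>x < z \<le> y\<close>. With \<open>x\<close> first,
        \<open>x\<close> bumps \<open>y\<close> and later \<open>b\<close> bumps \<open>z\<close>;
        with \<open>x\<close> late, \<open>z\<close> bumps \<open>y\<close> and later
        \<open>x\<close> bumps \<open>z\<close>. Both orders give the bumped pair of
        \<open>y\<close> and \<open>z\<close>, and the remainder starts from \<open>R1\<close> with
        \<open>b\<close> in place of \<open>x\<close>.\<close>
      case zy: False
      define y2 where "y2 = bump R1 z"
      have zR1: "v \<notin> R1" if "x < v" "v \<le> z" for v using gap1[of v] that zy by auto
      note n2 = bump_new[OF R1 zR1[OF zb(3) order_refl], folded y2_def]
      have R2e: "row_insert R1 z = insert z (R1 - {y2})"
        using zR1[OF zb(3) order_refl] unfolding row_insert_def y2_def by simp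
      have b1: "b \<notin> R1" using zR1 zb by blast
      have y2: "bump R1 b = y2"
      proof (rule bump_newI[OF b1])
        show "y2 \<in> R1" "b < y2" using n2 zb by auto
        fix v assume v: "v \<in> R1" "b < v"
        then have "y < v" using gap1 zb by auto
        then show "y2 \<le> v" using n2(3)[OF v(1)] zy by simp
      qed
      have Re: "row_insert R1 b = insert b (R1 - {y2})" using b1 y2 unfolding row_insert_def by simp
      have R2b: "bump (row_insert R1 z) b = z \<and> row_insert (row_insert R1 z) b = row_insert R1 b"
      proof (cases "b = z")
        case True
        have "k \<notin> row_insert R1 z" if "z = Suc k" for k
          using that zR1[of k] zx unfolding R2e by auto
        then have "bump (row_insert R1 z) z = z" by (intro bump_oldI) auto
        then show ?thesis using True unfolding row_insert_def[of "row_insert R1 z"] by simp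
      next
        case bz: False
        have bn: "b \<notin> row_insert R1 z" using bz b1 unfolding R2e by simp
        have "bump (row_insert R1 z) b = z"
        proof (rule bump_newI[OF bn])
          fix v assume v: "v \<in> row_insert R1 z" "b < v"
          show "z \<le> v" using v zR1[of v] zb unfolding R2e by (cases "v \<le> z") auto
        qed (use bz zb in auto)
        moreover have "insert b (row_insert R1 z - {z}) = row_insert R1 b"
          using zR1[OF zb(3) order_refl] unfolding R2e Re by auto
        ultimately show ?thesis using bn unfolding row_insert_def[of "row_insert R1 z"] by simp
      qed
      have bzR: "bump R z = y \<and> row_insert R z = insert z (R - {y})"
      proof (cases "z = y")
        case True
        then have "bump R z = y" using n yk by (intro bump_oldI) auto
        then show ?thesis using True n unfolding row_insert_def by auto
      next
        case False
        then have zn: "z \<notin> R" using n(3)[of z] zb zy by auto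
        then have "bump R z = y" using n(1) zy False n(3) zb by (intro bump_newI) auto
        then show ?thesis using zn unfolding row_insert_def by simp
      qed
      define Q where "Q = row_insert R z"
      have Q: "infinite Q" unfolding Q_def using R by (rule infinite_row_insert)
      have Qe: "Q = insert z (R - {y})" using bzR unfolding Q_def by simp
      have sQ: "Suc z \<notin> Q" "separated Q us" using row_insert_Suc[OF R] sepB unfolding Q_def by auto
      have xQ: "x \<notin> Q" using False zb unfolding Qe by auto
      have bx: "bump Q x = z"
      proof (rule bump_newI[OF xQ])
        fix v assume v: "v \<in> Q" "x < v"
        then show "z \<le> v" using n(3)[of v] zy unfolding Qe by auto
      qed (use zb Qe in auto)
      have zR1': "z \<notin> R1" using zR1 zb by blast
      have "row_insert Q x = insert x (Q - {z})" using xQ bx unfolding row_insert_def by simp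
      also have "\<dots> = R1" using zR1' unfolding Qe R1e by auto
      finally have rx: "row_insert Q x = R1" .
      have zQ: "z \<in> Q" unfolding Qe by simp
      note sw = swap_steps[OF Q zQ sQ(1) less_imp_le[OF zb(3)] zb(5) sQ(2)]
      have "balanced_row (((rev vs @ [x]) @ rev us) @ [z]) R t" using gB by simp
      from balanced_row_step[OF R this] have "balanced_row (rev vs @ x # rev us @ []) Q (y # t)"
        using bzR unfolding Q_def by simp
      moreover have "hecke_equiv (rev vs @ x # rev us @ []) (rev vs @ rev us @ x # [])"
        by (rule hecke_equiv_commute_context) (use xu in auto)
      ultimately have "balanced_row ((rev vs @ rev us) @ [x]) Q (y # t)" using balanced_row_equiv by simp
      from balanced_row_step[OF Q this] have "balanced_row (rev vs' @ b # rev us @ []) R1 (z # y # t)"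
        using bx rx vs by simp
      moreover have "hecke_equiv (rev vs' @ b # rev us @ []) (rev vs' @ rev us @ b # [])"
        by (rule hecke_equiv_commute_context) (use pA(8) in auto)
      ultimately have gI: "balanced_row (rev vs' @ rev us @ [b]) R1 (z # y # t)" using balanced_row_equiv by simp
      have "Suc b \<notin> set us" using pA(8) by blast
      moreover have "sorted_wrt (<) (b # us)" "sorted_wrt (<) (b # vs')" using zb by auto
      ultimately have IH: "move (y2 # bumped (row_insert R1 b) us) (bumped (row_inserts (row_insert R1 b) us) vs')
          (bumped R1 us) (bumped (row_inserts R1 us) (b # vs')) (length vs' - length us) \<and>
        row_inserts (row_inserts (row_insert R1 b) us) vs' = row_inserts (row_inserts R1 us) (b # vs')"
        using Cons.IH[OF zb(4) R1 _ _ _ gI] y2 by simp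
      have A: "bumped R1 (z # us) = y2 # bumped (row_insert R1 b) us"
        "bumped (row_inserts R1 (z # us)) vs = z # bumped (row_inserts (row_insert R1 b) us) vs'"
        "row_inserts (row_inserts R1 (z # us)) vs = row_inserts (row_inserts (row_insert R1 b) us) vs'"
        using pA(3-5) R2b vs unfolding y2_def by auto
      have B: "bumped R (z # us) = y # bumped R1 us"
        "bumped (row_inserts R (z # us)) (x # vs) = z # bumped (row_inserts R1 us) vs"
        "row_inserts (row_inserts R (z # us)) (x # vs) = row_inserts (row_inserts R1 us) vs"
        using sw bx rx bzR unfolding Q_def by auto
      have "z \<le> y" using zy by simp
      from move.pair[OF conjunct1[OF IH] this] IH show ?thesis
        unfolding R1_def[symmetric] y_def[symmetric] A B using vs by simp
    qed
  qed
qed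

lemma move_sorted: "move us vs us' vs' n \<Longrightarrow> sorted_wrt (<) us \<Longrightarrow> sorted_wrt (<) us'"
proof (induction rule: move.induct)
  case (skip us vs us' vs' n a)
  then show ?case using move_subset[OF skip.hyps(1)] by auto
next
  case (pair us vs us' vs' n b a)
  then show ?case using move_subset[OF pair.hyps(1)] by auto
qed auto

lemma move_bumped:
  assumes "move us vs us' vs' n" "infinite R" "sorted_wrt (<) us" "sorted_wrt (<) vs"
    and "balanced_row (rev vs @ rev us) R t"
  shows "move (bumped R us) (bumped (row_inserts R us) vs) (bumped R us') (bumped (row_inserts R us') vs') n \<and>
    row_inserts (row_inserts R us) vs = row_inserts (row_inserts R us') vs'"
  using assms
proof (induction arbitrary: R t rule: move.induct)
  case (base us vs x)
  then show ?case using base_step[of us vs R x t] by simp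
next
  case (special us vs x)
  note R = special.prems(1)
  \<comment> \<open>The second \<open>x + 1\<close> on one side and the second \<open>x\<close> on
    the other both bump the start of the run of \<open>x\<close> in \<open>R1\<close>. Together with
    \<open>bump R x\<close> this splits off a pair, and \<open>base_step\<close> handles the rest
    with \<open>Suc x\<close> in place of \<open>x\<close>.\<close>
  define R1 where "R1 = row_insert R x"
  define R2 where "R2 = row_insert R1 (Suc x)"
  have R1: "infinite R1" unfolding R1_def using R by (rule infinite_row_insert)
  have g0: "balanced_row ((rev (Suc x # vs) @ rev (Suc x # us)) @ [x]) R t" using special.prems(4) by simp
  have g1: "balanced_row (rev (Suc x # vs) @ rev (Suc x # us)) R1 (bump R x # t)"
    using balanced_row_step[OF R g0] unfolding R1_def .
  have so: "sorted_wrt (<) (Suc x # us)" "sorted_wrt (<) (Suc x # vs)" "sorted_wrt (<) (x # us)"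
    using special.prems by auto
  note p1 = pair_step[OF R1 g1 order_refl so(1), folded R2_def]
  have R2': "row_insert R2 (Suc x) = R2" unfolding R2_def row_insert_def by simp
  have x1: "x \<in> R1" "Suc x \<notin> R1"
    using row_insert_Suc[OF R] balanced_row_separated[OF g0] unfolding R1_def by auto
  have R2e: "R2 = insert (Suc x) (R1 - {bump R1 (Suc x)})" unfolding R2_def row_insert_def using x1 by simp
  have bl: "Suc x < bump R1 (Suc x)" using bump_new[OF R1 x1(2)] by simp
  have l: "bump R2 (Suc x) = bump R1 x"
  proof (rule bump_oldI)
    note o = bump_old[OF x1(1)]
    show "{bump R1 x..Suc x} \<subseteq> R2" using o(1,2) bl unfolding R2e by (auto simp: le_Suc_eq)
    show "bump R1 x \<le> Suc x" using o(1) by simp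
    show "k \<notin> R2" if "bump R1 x = Suc k" for k using o(1) o(3)[OF that] that unfolding R2e by auto
  qed
  have "hecke_equiv (rev (Suc x # vs) @ rev (x # Suc x # us)) (rev (x # Suc x # vs) @ rev (x # us))"
    using move_equiv[OF move.special[OF special.hyps]] special.prems(2) balanced_row_balanced[OF special.prems(4)] by simp
  then have g2: "balanced_row (rev (x # Suc x # vs) @ rev (x # us)) R t"
    using balanced_row_equiv special.prems(4) by blast
  note p2 = pair_step[OF R g2 order_refl so(3), folded R1_def]
  have R1': "row_insert R1 x = R1" using x1 unfolding row_insert_def by simp
  have "balanced_row (rev vs @ Suc x # rev us @ []) R1 (bump R1 x # bump R x # t)" using p2(2) R1' by simp
  moreover have "hecke_equiv (rev vs @ Suc x # rev us @ []) (rev vs @ rev us @ Suc x # [])"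
    by (rule hecke_equiv_commute_context) (use p1(8) in auto)
  ultimately have "balanced_row (rev vs @ rev us @ [Suc x]) R1 (bump R1 x # bump R x # t)" using balanced_row_equiv by simp
  moreover have "Suc (Suc x) \<notin> set us" using p1(8) by blast
  ultimately have b: "move (bump R1 (Suc x) # bumped R2 us) (bumped (row_inserts R2 us) vs)
      (bumped R1 us) (bumped (row_inserts R1 us) (Suc x # vs)) (length vs - length us) \<and>
    row_inserts (row_inserts R2 us) vs = row_inserts (row_inserts R1 us) (Suc x # vs)"
    using base_step[OF special.hyps R1 so(1,2)] unfolding R2_def by blast
  have "bump (row_inserts R2 us) (Suc x) = bump R1 x" "row_insert (row_inserts R2 us) (Suc x) = row_inserts R2 us"
    "bump (row_inserts R1 us) x = bump R1 x" "row_insert (row_inserts R1 us) x = row_inserts R1 us"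
    using p1(4,5) p2(4,5) l R1' R2' by simp_all
  with move.pair[OF conjunct1[OF b] p2(6)] b show ?case
    by (simp add: R1_def[symmetric] R2_def[symmetric])
next
  case (skip us vs us' vs' n a)
  have g: "balanced_row ((rev vs @ rev us) @ [a]) R t" using skip.prems by simp
  have "move (bumped (row_insert R a) us) (bumped (row_inserts (row_insert R a) us) vs)
      (bumped (row_insert R a) us') (bumped (row_inserts (row_insert R a) us') vs') n \<and>
    row_inserts (row_inserts (row_insert R a) us) vs = row_inserts (row_inserts (row_insert R a) us') vs'"
    using skip.IH[OF infinite_row_insert[OF skip.prems(1)] _ _ balanced_row_step[OF skip.prems(1) g]] skip.prems by simp
  then show ?case using move.skip by simp
next
  case (pair us vs us' vs' n b a)
  note R = pair.prems(1)
  note p1 = pair_step[OF R pair.prems(4) pair.hyps(2) pair.prems(2)]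
  note F = move.pair[OF pair.hyps]
  have so: "sorted_wrt (<) (a # us')" using move_sorted[OF F pair.prems(2)] .
  have g: "balanced_row (rev (b # vs') @ rev (a # us')) R t"
    using balanced_row_equiv[OF move_equiv[OF F pair.prems(2)] pair.prems(4)] balanced_row_balanced[OF pair.prems(4)] by blast
  note p2 = pair_step[OF R g pair.hyps(2) so]
  define S where "S = row_insert (row_insert R a) b"
  have "move (bumped S us) (bumped (row_inserts S us) vs) (bumped S us') (bumped (row_inserts S us') vs') n \<and>
    row_inserts (row_inserts S us) vs = row_inserts (row_inserts S us') vs'"
    using pair.IH[OF p1(1) _ _ p1(2)] pair.prems unfolding S_def by simp
  then show ?case using move.pair[OF _ p1(6)] p1(3-5) p2(3-5) by (simp add: S_def)
qed

section \<open>Letters pushed past the end of a row\<close>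

text \<open>If the new least letter \<open>a\<close> finds no partner but \<open>a + 1\<close> is in
  the word, the partner of \<open>a + 1\<close> lies strictly above \<open>a\<close> and must be
  \<open>a + 1\<close> itself. So the exceptional clause arises exactly in the form of the rule
  \<open>special\<close>.\<close>

lemma paired_Cons_cases:
  assumes "paired us vs" "sorted_wrt (<) (a # us)" "sorted_wrt (<) vs"
  shows "paired (a # us) vs \<or> (\<exists>us' vs'. move (a # us) vs us' vs' (length vs - length us))"
  using assms
proof (induction us arbitrary: a vs)
  case Nil
  then show ?case
    using move.base[of "[]" vs a] by (cases vs) (auto simp: not_le, metis less_trans not_le)
next
  case (Cons c us)
  obtain b vs' where vs: "vs = b # vs'" "b \<le> c" "paired us vs'" using Cons.prems(1) by (cases vs) auto
  show ?case
  proof (cases "b \<le> a")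
    case True
    have "paired (c # us) vs' \<or> (\<exists>us' vs''. move (c # us) vs' us' vs'' (length vs' - length us))"
      using Cons vs by auto
    then show ?thesis using True vs move.pair[OF _ True] by fastforce
  next
    case ba: False
    then have gt: "\<forall>q\<in>set vs. a < q" using Cons.prems(3) vs by auto
    show ?thesis
    proof (cases "Suc a \<in> set (c # us)")
      case False
      then show ?thesis using move.base[OF Cons.prems(1) gt] by blast
    next
      case True
      then have "c = Suc a" using Cons.prems(2) by fastforce
      moreover then have "b = Suc a" using vs ba by simp
      ultimately show ?thesis using move.special[OF vs(3), of a] vs by fastforce
    qed
  qed
qed

lemma paired_or_move:
  assumes "sorted_wrt (<) us" "sorted_wrt (<) vs"
  shows "paired us vs \<or> (\<exists>us' vs' n. move us vs us' vs' n)"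
  using assms(1)
proof (induction us)
  case (Cons a us)
  then have "paired us vs \<or> (\<exists>us' vs' n. move us vs us' vs' n)" by simp
  then show ?case using paired_Cons_cases[OF _ Cons.prems assms(2)] move.skip by blast
qed simp

lemma paired_above:
  assumes "paired hs (vs @ ks)" "\<forall>h\<in>set hs. \<forall>k\<in>set ks. h < k"
  shows "length hs \<le> length vs"
  using assms
proof (induction hs vs rule: paired.induct)
  case (2 a us)
  then show ?case by (cases ks) auto
qed auto

text \<open>The letters of \<open>ks\<close> are too large to be partners, so \<open>vs\<close>
  alone has to serve both \<open>us\<close> and \<open>hs\<close>.\<close>

lemma paired_append:
  assumes "paired (us @ hs) (vs @ ks)" "\<forall>h\<in>set (us @ hs). \<forall>k\<in>set ks. h < k"
  shows "paired us vs \<and> length us + length hs \<le> length vs"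
  using assms
proof (induction us vs rule: paired.induct)
  case (1 vs)
  then show ?case using paired_above by simp
next
  case (2 a us)
  then show ?case by (cases ks) auto
qed auto

text \<open>If the small letters leave fewer than \<open>length hs\<close> letters of
  \<open>vs\<close> unpaired, then \<open>hs\<close> cannot be paired completely and its last letter
  moves. Otherwise \<open>hs\<close> is paired completely and the operator acts on the small
  letters. The exceptional clause never concerns large letters, as no two letters of
  \<open>hs\<close> are consecutive. The formulas for \<open>n\<close> are the recursion of
  \<open>opens\<close>.\<close>

lemma move_append:
  assumes "move U V X Y n" "U = us @ hs" "V = vs @ ks"
    and "sorted_wrt (<) U" "sorted_wrt (<) V"
    and "\<forall>a\<in>set us \<union> set vs. a < N" "\<forall>h\<in>set hs \<union> set ks. N < h"
    and "\<forall>h\<in>set hs. Suc h \<notin> set hs" "\<forall>h\<in>set hs. \<forall>k\<in>set ks. h < k"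
  shows "(hs \<noteq> [] \<and> X = us @ butlast hs \<and> Y = vs @ last hs # ks \<and> n = length ks \<and>
      (paired us vs \<and> length vs - length us < length hs \<or>
        (\<exists>us' vs' n'. move us vs us' vs' n' \<and> n' < length hs))) \<or>
    (\<exists>us' vs' n'. move us vs us' vs' n' \<and> X = us' @ hs \<and> Y = vs' @ ks \<and>
      length hs \<le> n' \<and> n = n' - length hs + length ks)"
    (is "?P us hs vs X Y n \<or> ?Q us hs vs X Y n")
  using assms
proof (induction arbitrary: us hs vs rule: move.induct)
  case (base U V x)
  have lt: "\<forall>h\<in>set (us @ hs). \<forall>k\<in>set ks. h < k"
    using base.prems by auto (metis Un_iff less_trans)
  show ?case
  proof (cases us)
    case Nil
    then have hs: "hs = x # U" using base.prems by simp
    then have "vs = []" using base by (cases vs) fastforce+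
    moreover have "paired ([] @ U) (vs @ ks)" using base.hyps(1) base.prems by simp
    then have "U = []" using paired_append[of "[]" U vs ks] lt hs \<open>vs = []\<close> by simp
    ultimately show ?thesis using Nil hs base.prems by simp
  next
    case (Cons a us')
    then have U: "U = us' @ hs" "a = x" using base.prems by auto
    have h: "paired us' vs \<and> length us' + length hs \<le> length vs"
      using paired_append[of us' hs vs ks] base U lt Cons by auto
    have "move (x # us') vs us' (x # vs) (length vs - length us')"
      using h base U by (intro move.base) auto
    then have "?Q us hs vs U (x # V) (length V - length U)"
      using h U Cons base.prems by fastforce
    then show ?thesis by blast
  qed
next
  case (special U V x)
  obtain us' where us: "us = x # Suc x # us'" "U = us' @ hs"
  proof (cases us)
    case Nil
    then show ?thesis using special.prems by auto
  next
    case (Cons a us1)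
    then show ?thesis using special.prems that by (cases us1) auto
  qed
  obtain vs' where vs: "vs = Suc x # vs'" "V = vs' @ ks"
    using special.prems us by (cases vs) auto
  have lt: "\<forall>h\<in>set (us' @ hs). \<forall>k\<in>set ks. h < k"
    using special.prems us by auto (metis Un_iff less_trans)
  have h: "paired us' vs' \<and> length us' + length hs \<le> length vs'"
    using paired_append[of us' hs vs' ks] special.hyps us vs lt by simp
  have "?Q us hs vs (x # U) (x # Suc x # V) (length V - length U)"
    using move.special[OF conjunct1[OF h], of x] h us vs by fastforce
  then show ?case by blast
next
  case (skip U V X Y n a)
  show ?case
  proof (cases us)
    case Nil
    then have hs: "hs = a # U" using skip.prems by simp
    have "?P [] U vs X Y n \<or> ?Q [] U vs X Y n"
      using skip.prems hs by (intro skip.IH) auto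
    moreover have "\<not> move [] vs us' vs' n'" for us' vs' n' by (auto elim: move.cases)
    ultimately have "?P us hs vs (a # X) Y n" using Nil hs by auto
    then show ?thesis by blast
  next
    case (Cons c us')
    then have U: "U = us' @ hs" "c = a" using skip.prems by auto
    have so: "sorted_wrt (<) (a # us')" "sorted_wrt (<) vs"
      using skip.prems Cons U by (auto simp: sorted_wrt_append)
    have "?P us' hs vs X Y n \<or> ?Q us' hs vs X Y n"
      using skip.prems U Cons by (intro skip.IH) auto
    then show ?thesis
    proof
      assume P: "?P us' hs vs X Y n"
      have "paired us vs \<and> length vs - length us < length hs \<or>
        (\<exists>us' vs' n'. move us vs us' vs' n' \<and> n' < length hs)"
        using P paired_Cons_cases[OF _ so] move.skip[of us' vs _ _ _ a] Cons U by fastforce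
      then show ?thesis using P Cons U by auto
    next
      assume "?Q us' hs vs X Y n"
      then show ?thesis using Cons U move.skip[of us' vs _ _ _ a] by fastforce
    qed
  qed
next
  case (pair U V X Y n b a)
  show ?case
  proof (cases us)
    case Nil
    then have hs: "hs = a # U" using pair.prems by simp
    obtain vs' where vs: "vs = b # vs'" "V = vs' @ ks"
      using pair.prems pair.hyps hs by (cases vs) fastforce+
    have "?P [] U vs' X Y n \<or> ?Q [] U vs' X Y n"
      using pair.prems hs vs by (intro pair.IH) auto
    moreover have "\<not> move [] vs' us' vs'' n'" for us' vs'' n' by (auto elim: move.cases)
    ultimately have "?P us hs vs (a # X) (b # Y) n" using Nil hs vs by auto
    then show ?thesis by blast
  next
    case (Cons c us')
    then have U: "U = us' @ hs" "c = a" using pair.prems by auto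
    obtain vs' where vs: "vs = b # vs'" "V = vs' @ ks"
      using pair.prems pair.hyps Cons U by (cases vs) fastforce+
    have "?P us' hs vs' X Y n \<or> ?Q us' hs vs' X Y n"
      using pair.prems U Cons vs by (intro pair.IH) auto
    then show ?thesis
    proof
      assume P: "?P us' hs vs' X Y n"
      have "paired us vs \<and> length vs - length us < length hs \<or>
        (\<exists>us' vs' n'. move us vs us' vs' n' \<and> n' < length hs)"
        using P pair.hyps move.pair[of us' vs' _ _ _ b a] Cons U vs by fastforce
      then show ?thesis using P Cons U vs by auto
    next
      assume "?Q us' hs vs' X Y n"
      then show ?thesis using Cons U vs move.pair[OF _ pair.hyps(2), of us' vs'] by fastforce
    qed
  qed
qed

section \<open>Finite rows\<close>

fun inserts :: "nat list list \<Rightarrow> nat list \<Rightarrow> nat list list \<times> nat list" where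
  "inserts P [] = (P, [])"
| "inserts P (x # xs) = (let (P1, r) = star_insert x P; (P2, rs) = inserts P1 xs in (P2, r # rs))"

text \<open>The number \<open>p\<close> counts the padding letters already bumped. Starting above
  \<open>N + 1\<close> leaves \<open>N\<close> as a buffer; the spacing by two prevents runs, and
  hence exceptional moves, among large letters.\<close>

definition padding :: "nat \<Rightarrow> nat \<Rightarrow> nat set" where
  "padding N p = {N + 2 * k |k. p < k}"

lemma infinite_padding: "infinite (padding N p)"
proof
  assume "finite (padding N p)"
  then obtain m where "\<forall>n\<in>padding N p. n \<le> m" using finite_nat_set_iff_bounded_le by blast
  moreover have "N + 2 * Suc (p + m) \<in> padding N p"
    unfolding padding_def by (rule CollectI, rule exI[of _ "Suc (p + m)"]) simp
  ultimately show False by fastforce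
qed

lemma padding_gt: "h \<in> padding N p \<Longrightarrow> Suc N < h"
  unfolding padding_def by auto

lemma padding_Suc: "padding N (Suc p) = padding N p - {N + 2 * Suc p}"
  unfolding padding_def by (auto intro: Suc_lessI)

lemma row_append:
  fixes p :: nat
  assumes R: "\<forall>r\<in>set R. r < N" "x < N" and app: "R = [] \<or> Max (set R) < x"
  defines "S \<equiv> set R \<union> padding N p"
  shows "bump S x = N + 2 * Suc p" "row_insert S x = set (R @ [x]) \<union> padding N (Suc p)"
proof -
  have lt: "r < x" if "r \<in> set R" for r using app that by (metis List.finite_set Max_ge empty_iff empty_set le_less_trans)
  have x: "x \<notin> S" using lt R(2) padding_gt unfolding S_def by fastforce
  show b: "bump S x = N + 2 * Suc p"
  proof (rule bump_newI[OF x])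
    show "N + 2 * Suc p \<in> S" unfolding S_def padding_def by blast
    fix z assume "z \<in> S" "x < z"
    then have "z \<in> padding N p" using lt unfolding S_def by fastforce
    then show "N + 2 * Suc p \<le> z" unfolding padding_def by auto
  qed (use R(2) in simp)
  have "N + 2 * Suc p \<notin> set R" using R(1) by fastforce
  then show "row_insert S x = set (R @ [x]) \<union> padding N (Suc p)"
    using x b unfolding row_insert_def padding_Suc by (auto simp: S_def)
qed

lemma sorted_replace:
  fixes R :: "nat list"
  assumes "sorted_wrt (<) R" "y \<in> set R" "x < y" "\<And>r. r \<in> set R \<Longrightarrow> r < y \<Longrightarrow> r < x"
  shows "sorted_wrt (<) (map (\<lambda>z. if z = y then x else z) R)"
  unfolding sorted_wrt_map
  by (rule sorted_wrt_mono_rel[OF _ assms(1)]) (use assms in auto)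

text \<open>The two bumping cases never reach the padding: the bumped entry is at most
  \<open>x\<close> if \<open>x\<close> is in the row, and at most the maximum of \<open>R\<close>
  otherwise.\<close>

lemma row_bump:
  fixes p :: nat
  assumes R: "sorted_wrt (<) R" "\<forall>r\<in>set R. r < N" "x < N" and app: "\<not> (R = [] \<or> Max (set R) < x)"
  defines "S \<equiv> set R \<union> padding N p"
  obtains R' where "\<And>P. star_insert x (R # P) =
      (let (P', r) = star_insert (bump S x) P in (R' # P', Suc r))"
    "bump S x < N" "row_insert S x = set R' \<union> padding N p" "sorted_wrt (<) R'" "\<forall>r\<in>set R'. r < N"
proof -
  have R0: "R \<noteq> []" and mx: "x \<le> Max (set R)" using app by auto
  have S: "infinite S" unfolding S_def using infinite_padding by simp
  have SN: "v \<in> S \<longleftrightarrow> v \<in> set R" if "v \<le> N" for v using that padding_gt unfolding S_def by fastforce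
  show ?thesis
  proof (cases "x \<in> set R")
    case True
    then have xS: "x \<in> S" unfolding S_def by simp
    note o = bump_old[OF xS]
    define A where "A = {y \<in> set R. y \<le> x \<and> {y..x} \<subseteq> set R}"
    have sub: "{v..x} \<subseteq> S \<longleftrightarrow> {v..x} \<subseteq> set R" for v
      using SN R(3) by (auto simp: subset_iff)
    have "Min A = bump S x"
    proof (rule Min_eqI)
      show "finite A" unfolding A_def by simp
      have "bump S x \<in> {bump S x..x}" using o(1) by simp
      then show "bump S x \<in> A" unfolding A_def using o sub by blast
      show "bump S x \<le> v" if "v \<in> A" for v using that o(4) sub unfolding A_def by blast
    qed
    then have "star_insert x (R # P) = (let (P', r) = star_insert (bump S x) P in (R # P', Suc r))" for P
      using app True unfolding A_def by (simp add: Let_def)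
    moreover have "bump S x < N" using o(1) R(3) by simp
    moreover have "row_insert S x = set R \<union> padding N p" using xS unfolding row_insert_def S_def by simp
    ultimately show ?thesis using that R by blast
  next
    case False
    then have xS: "x \<notin> S" using SN R(3) by simp
    note n = bump_new[OF S xS]
    have m: "Max (set R) \<in> set R" using R0 by simp
    then have "x < Max (set R)" using mx False by (metis le_neq_implies_less)
    then have "bump S x \<le> Max (set R)" using n(3)[of "Max (set R)"] m unfolding S_def by simp
    then have bN: "bump S x < N" using R(2) m by fastforce
    then have bR: "bump S x \<in> set R" using n(1) SN by simp
    define A where "A = {y \<in> set R. x < y}"
    have "Min A = bump S x"
    proof (rule Min_eqI)
      show "finite A" unfolding A_def by simp
      show "bump S x \<in> A" unfolding A_def using n bR by simp
      show "bump S x \<le> v" if "v \<in> A" for v using that n(3)[of v] unfolding A_def S_def by simp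
    qed
    then have 1: "star_insert x (R # P) = (let (P', r) = star_insert (bump S x) P in
        (map (\<lambda>z. if z = bump S x then x else z) R # P', Suc r))" for P
      using app False unfolding A_def by (simp add: Let_def)
    have 2: "sorted_wrt (<) (map (\<lambda>z. if z = bump S x then x else z) R)"
    proof (rule sorted_replace[OF R(1) bR n(2)])
      fix r assume r: "r \<in> set R" "r < bump S x"
      then show "r < x" using n(3)[of r] False unfolding S_def by (metis UnI1 leD linorder_neqE_nat)
    qed
    have "set (map (\<lambda>z. if z = bump S x then x else z) R) = insert x (set R - {bump S x})"
      using bR by auto
    moreover have "bump S x \<notin> padding N p" using bN padding_gt by fastforce
    ultimately have 3: "row_insert S x = set (map (\<lambda>z. if z = bump S x then x else z) R) \<union> padding N p"
      using xS unfolding row_insert_def by (auto simp: S_def)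
    show ?thesis by (rule that[OF 1 bN 3 2]) (use R in auto)
  qed
qed

text \<open>Each letter appended to the row bumps the next padding letter. Hence the large letters
  bumped are determined by their number, the number of cells gained by this row, and only the small
  ones continue into \<open>P\<close>.\<close>

lemma row_steps:
  fixes p :: nat
  assumes "sorted_wrt (<) R" "\<forall>r\<in>set R. r < N" "\<forall>x\<in>set xs. x < N"
  defines "S \<equiv> set R \<union> padding N p"
  defines "ys \<equiv> filter (\<lambda>y. y < N) (bumped S xs)"
  defines "zs \<equiv> filter (\<lambda>y. \<not> y < N) (bumped S xs)"
  shows "\<exists>R' rs. row_inserts S xs = set R' \<union> padding N (p + length zs) \<and> sorted_wrt (<) R' \<and> (\<forall>r\<in>set R'. r < N) \<and>
    zs = map (\<lambda>k. N + 2 * k) [Suc p..<Suc (p + length zs)] \<and>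
    inserts (R # P) xs = (R' # fst (inserts P ys), rs) \<and>
    count_list rs 0 = length zs \<and> (\<forall>r. count_list rs (Suc r) = count_list (snd (inserts P ys)) r)"
  using assms(1-3) unfolding ys_def zs_def S_def
proof (induction xs arbitrary: R P p)
  case (Cons x xs)
  let ?S = "set R \<union> padding N p"
  show ?case
  proof (cases "R = [] \<or> Max (set R) < x")
    case True
    note a = row_append[OF Cons.prems(2) _ True, of p]
    define O' where "O' = bumped (set (R @ [x]) \<union> padding N (Suc p)) xs"
    have x: "x < N" using Cons.prems by simp
    have "\<forall>r\<in>set R. r < x" using True by (metis List.finite_set Max_ge empty_iff empty_set le_less_trans)
    then have "sorted_wrt (<) (R @ [x])" using Cons.prems by (auto simp: sorted_wrt_append)
    moreover have "\<forall>r\<in>set (R @ [x]). r < N" "\<forall>x\<in>set xs. x < N" using Cons.prems by auto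
    ultimately obtain R' rs where IH:
      "row_inserts (set (R @ [x]) \<union> padding N (Suc p)) xs = set R' \<union> padding N (Suc p + length (filter (\<lambda>y. \<not> y < N) O'))"
      "sorted_wrt (<) R'" "\<forall>r\<in>set R'. r < N"
      "filter (\<lambda>y. \<not> y < N) O' =
        map (\<lambda>k. N + 2 * k) [Suc (Suc p)..<Suc (Suc p + length (filter (\<lambda>y. \<not> y < N) O'))]"
      "inserts ((R @ [x]) # P) xs = (R' # fst (inserts P (filter (\<lambda>y. y < N) O')), rs)"
      "count_list rs 0 = length (filter (\<lambda>y. \<not> y < N) O')"
      "\<forall>r. count_list rs (Suc r) = count_list (snd (inserts P (filter (\<lambda>y. y < N) O'))) r"
      using Cons.IH[of "R @ [x]" "Suc p" P] unfolding O'_def by blast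
    have O: "bumped ?S (x # xs) = (N + 2 * Suc p) # O'" unfolding O'_def using a[OF x] by simp
    have T: "inserts (R # P) (x # xs) = (R' # fst (inserts P (filter (\<lambda>y. y < N) O')), 0 # rs)"
      using IH(5) True by (auto simp: Let_def)
    have U: "[Suc p..<Suc (p + Suc k)] = Suc p # [Suc (Suc p)..<Suc (Suc p + k)]" for k
      by (simp add: upt_conv_Cons)
    have rr: "row_inserts ?S (x # xs) = row_inserts (set (R @ [x]) \<union> padding N (Suc p)) xs" using a[OF x] by simp
    have len: "length (filter (\<lambda>y. \<not> y < N) (bumped ?S (x # xs))) = Suc (length (filter (\<lambda>y. \<not> y < N) O'))"
      unfolding O by simp
    have fil: "filter (\<lambda>y. y < N) (bumped ?S (x # xs)) = filter (\<lambda>y. y < N) O'" unfolding O by simp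
    have fil2: "filter (\<lambda>y. \<not> y < N) (bumped ?S (x # xs)) = (N + 2 * Suc p) # filter (\<lambda>y. \<not> y < N) O'"
      unfolding O by simp
    show ?thesis
      unfolding len fil
      by (rule exI[of _ R'], rule exI[of _ "0 # rs"], unfold fil2 U rr T)
        (use IH(1-4,6,7) in \<open>simp del: upt_Suc\<close>)
  next
    case False
    have x: "x < N" using Cons.prems by simp
    obtain R1 where R1: "\<And>P. star_insert x (R # P) =
        (let (P', r) = star_insert (bump ?S x) P in (R1 # P', Suc r))"
      "bump ?S x < N" "row_insert ?S x = set R1 \<union> padding N p" "sorted_wrt (<) R1" "\<forall>r\<in>set R1. r < N"
      using row_bump[OF Cons.prems(1,2) x False] by blast
    obtain P1 r1 where P1: "star_insert (bump ?S x) P = (P1, r1)" by fastforce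
    define O' where "O' = bumped (set R1 \<union> padding N p) xs"
    obtain R' rs where IH:
      "row_inserts (set R1 \<union> padding N p) xs = set R' \<union> padding N (p + length (filter (\<lambda>y. \<not> y < N) O'))"
      "sorted_wrt (<) R'" "\<forall>r\<in>set R'. r < N"
      "filter (\<lambda>y. \<not> y < N) O' = map (\<lambda>k. N + 2 * k) [Suc p..<Suc (p + length (filter (\<lambda>y. \<not> y < N) O'))]"
      "inserts (R1 # P1) xs = (R' # fst (inserts P1 (filter (\<lambda>y. y < N) O')), rs)"
      "count_list rs 0 = length (filter (\<lambda>y. \<not> y < N) O')"
      "\<forall>r. count_list rs (Suc r) = count_list (snd (inserts P1 (filter (\<lambda>y. y < N) O'))) r"
      using Cons.IH[of R1 p P1] R1(4,5) Cons.prems unfolding O'_def by auto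
    have O: "bumped ?S (x # xs) = bump ?S x # O'" unfolding O'_def using R1(3) by simp
    have rr: "row_inserts ?S (x # xs) = row_inserts (set R1 \<union> padding N p) xs" using R1(3) by simp
    have T: "inserts (R # P) (x # xs) = (R' # fst (inserts P1 (filter (\<lambda>y. y < N) O')), Suc r1 # rs)"
      using R1(1) P1 IH(5) by simp
    have T': "inserts P (filter (\<lambda>y. y < N) (bumped ?S (x # xs))) =
      (fst (inserts P1 (filter (\<lambda>y. y < N) O')), r1 # snd (inserts P1 (filter (\<lambda>y. y < N) O')))"
      using R1(2) P1 unfolding O by (simp add: case_prod_beta)
    have fil2: "filter (\<lambda>y. \<not> y < N) (bumped ?S (x # xs)) = filter (\<lambda>y. \<not> y < N) O'"
      using R1(2) unfolding O by simp
    show ?thesis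
      by (rule exI[of _ R'], rule exI[of _ "Suc r1 # rs"], unfold fil2 rr T T')
        (use IH(1-4,6,7) in auto)
  qed
qed simp

section \<open>Insertion of two factors into a tableau\<close>

text \<open>Rows from the bottom up, each read backwards; with this order, inserting
  \<open>x\<close> turns \<open>x # row_word P\<close> into an equivalent word.\<close>

definition row_word :: "nat list list \<Rightarrow> nat list" where
  "row_word P = concat (map rev P)"

text \<open>Counting the cells per row suffices, because within a row those gained from
  \<open>us\<close> precede those gained from \<open>vs\<close>.\<close>

definition strip_insert :: "nat list list \<Rightarrow> nat list \<Rightarrow> nat list \<Rightarrow> nat list list \<times> (nat \<times> nat) list" where
  "strip_insert P us vs = (let (P1, ru) = inserts P us; (P2, rv) = inserts P1 vs
    in (P2, map (\<lambda>r. (count_list ru r, count_list rv r)) [0..<length P2]))"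

text \<open>
  The signature rule for rows listed from the bottom, the pair \<open>(a, b)\<close> standing for a row with \<open>a\<close>
  entries \<open>i\<close> followed by \<open>b\<close> entries \<open>i + 1\<close>: \<open>opens\<close> counts the unmatched \<open>i + 1\<close>, and
  \<open>move_row\<close> is the row of the last unmatched \<open>i\<close>.
\<close>

fun opens :: "(nat \<times> nat) list \<Rightarrow> nat" where
  "opens [] = 0"
| "opens ((a, b) # l) = b + (opens l - a)"

fun move_row :: "(nat \<times> nat) list \<Rightarrow> nat option" where
  "move_row [] = None"
| "move_row ((a, b) # l) = (if opens l < a then Some 0 else map_option Suc (move_row l))"

definition shift :: "nat \<Rightarrow> (nat \<times> nat) list \<Rightarrow> (nat \<times> nat) list" where
  "shift r l = l[r := (fst (l ! r) - 1, Suc (snd (l ! r)))]"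

text \<open>The value of \<open>opens\<close> is part of the claim because the row below needs it to
  decide whether one of its own cells changes.\<close>

definition commutes :: "nat list list \<Rightarrow> nat list \<Rightarrow> nat list \<Rightarrow> bool" where
  "commutes P us vs \<longleftrightarrow>
    (paired us vs \<longrightarrow> move_row (snd (strip_insert P us vs)) = None \<and> opens (snd (strip_insert P us vs)) = length vs - length us) \<and>
    (\<forall>us' vs' n. move us vs us' vs' n \<longrightarrow>
      fst (strip_insert P us' vs') = fst (strip_insert P us vs) \<and> opens (snd (strip_insert P us vs)) = n \<and>
      (\<exists>r. move_row (snd (strip_insert P us vs)) = Some r \<and>
        snd (strip_insert P us' vs') = shift r (snd (strip_insert P us vs))))"

lemma filter_append_sorted:
  assumes "sorted_wrt (<) (xs :: nat list)"
  shows "xs = filter (\<lambda>y. y < N) xs @ filter (\<lambda>y. \<not> y < N) xs"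
  using assms
proof (induction xs)
  case (Cons x xs)
  show ?case
  proof (cases "x < N")
    case False
    then have "filter (\<lambda>y. y < N) xs = []" using Cons.prems by (auto simp: filter_empty_conv)
    then show ?thesis using Cons False by simp
  qed (use Cons in simp)
qed simp

lemma move_vs_subset: "move us vs us' vs' n \<Longrightarrow> set vs' \<subseteq> set us \<union> set vs"
  by (induction rule: move.induct) auto

lemma strip_insert_Cons:
  assumes "sorted_wrt (<) R" "\<forall>r\<in>set R. r < N" "\<forall>x\<in>set us. x < N" "\<forall>x\<in>set vs. x < N"
  defines "S \<equiv> set R \<union> padding N 0"
  defines "X \<equiv> bumped S us"
  defines "Y \<equiv> bumped (row_inserts S us) vs"
  shows "\<exists>R2. strip_insert (R # P) us vs = (let (P2, l) = strip_insert P (filter (\<lambda>y. y < N) X) (filter (\<lambda>y. y < N) Y)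
      in (R2 # P2, (length (filter (\<lambda>y. \<not> y < N) X), length (filter (\<lambda>y. \<not> y < N) Y)) # l)) \<and>
    sorted_wrt (<) R2 \<and> set R2 = row_inserts (row_inserts S us) vs \<inter> {..<N} \<and>
    filter (\<lambda>y. \<not> y < N) X = map (\<lambda>k. N + 2 * k) [1..<Suc (length (filter (\<lambda>y. \<not> y < N) X))] \<and>
    filter (\<lambda>y. \<not> y < N) Y = map (\<lambda>k. N + 2 * k) [Suc (length (filter (\<lambda>y. \<not> y < N) X))..<
      Suc (length (filter (\<lambda>y. \<not> y < N) X) + length (filter (\<lambda>y. \<not> y < N) Y))]"
proof -
  define p where "p = length (filter (\<lambda>y. \<not> y < N) X)"
  define q where "q = length (filter (\<lambda>y. \<not> y < N) Y)"
  define ys where "ys = filter (\<lambda>y. y < N) X"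
  define zs where "zs = filter (\<lambda>y. y < N) Y"
  obtain R1 ru where 1: "row_inserts S us = set R1 \<union> padding N p" "sorted_wrt (<) R1" "\<forall>r\<in>set R1. r < N"
    "filter (\<lambda>y. \<not> y < N) X = map (\<lambda>k. N + 2 * k) [Suc 0..<Suc p]"
    "inserts (R # P) us = (R1 # fst (inserts P ys), ru)"
    "count_list ru 0 = p" "\<forall>r. count_list ru (Suc r) = count_list (snd (inserts P ys)) r"
    using row_steps[OF assms(1-3), of 0 P] unfolding S_def X_def p_def ys_def add_0 by blast
  obtain R2 rv where 2: "row_inserts (set R1 \<union> padding N p) vs = set R2 \<union> padding N (p + q)"
    "sorted_wrt (<) R2" "\<forall>r\<in>set R2. r < N"
    "filter (\<lambda>y. \<not> y < N) Y = map (\<lambda>k. N + 2 * k) [Suc p..<Suc (p + q)]"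
    "inserts (R1 # fst (inserts P ys)) vs = (R2 # fst (inserts (fst (inserts P ys)) zs), rv)"
    "count_list rv 0 = q" "\<forall>r. count_list rv (Suc r) = count_list (snd (inserts (fst (inserts P ys)) zs)) r"
    using row_steps[OF 1(2,3) assms(4), of p "fst (inserts P ys)"] 1(1)
    unfolding Y_def q_def zs_def by auto
  have "strip_insert (R # P) us vs = (let (P2, l) = strip_insert P ys zs in (R2 # P2, (p, q) # l))"
    unfolding strip_insert_def 1(5) using 1(6,7) 2(5-7)
    by (simp add: case_prod_beta Let_def upt_conv_Cons map_Suc_upt[symmetric] comp_def del: upt_Suc)
  moreover have "set R2 = row_inserts (row_inserts S us) vs \<inter> {..<N}"
    using 2(1,3) 1(1) padding_gt[of _ N "p + q"] by fastforce
  ultimately show ?thesis using 1(4) 2(2,4) unfolding ys_def zs_def p_def q_def by auto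
qed

lemma dec_sorted: "sorted_wrt (<) R \<Longrightarrow> dec (set R) = rev R"
  unfolding dec_def
  by (metis sorted_list_of_set.idem_if_sorted_distinct strict_sorted_iff)

text \<open>The padding letters occur once each and are kept apart from the small ones by the absent
  letter \<open>N\<close>.\<close>

lemma balanced_row_row:
  assumes b: "balanced (w @ rev R @ t)" and R: "sorted_wrt (<) R"
    and N: "\<forall>x\<in>set w \<union> set R \<union> set t. x < N"
  shows "balanced_row w (set R \<union> padding N 0) t"
proof -
  have "balanced (w @ dec ((set R \<union> padding N 0) \<inter> {..<M}) @ t)" if "M \<ge> N" for M
  proof -
    define H where "H = padding N 0 \<inter> {..<M}"
    have H: "finite H" "\<And>h. h \<in> H \<Longrightarrow> N < h" using padding_gt[of _ N 0] unfolding H_def by (auto dest: Suc_lessD)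
    have "x < M" if "x \<in> set R" for x using N \<open>N \<le> M\<close> that by (meson UnI1 UnI2 less_le_trans)
    then have "(set R \<union> padding N 0) \<inter> {..<M} = H \<union> set R" unfolding H_def by auto
    moreover have "dec (H \<union> set R) = dec H @ rev R"
      using dec_Un[of H "set R"] H N dec_sorted[OF R] by (metis List.finite_set UnI1 UnI2 less_trans)
    ultimately have e: "w @ dec ((set R \<union> padding N 0) \<inter> {..<M}) @ t = w @ dec H @ rev R @ t" by simp
    have f: "filter (\<lambda>x. x < N) s = s" "filter (\<lambda>x. N \<le> x) s = []" if "\<forall>x\<in>set s. x < N" for s
      using that by (auto simp: filter_id_conv filter_empty_conv)
    have hN: "\<forall>x\<in>H. N < x" using H(2) by blast
    have h: "filter (\<lambda>x. x < N) (dec H) = []" "filter (\<lambda>x. N \<le> x) (dec H) = dec H"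
      using H(1) hN by (auto simp: filter_id_conv filter_empty_conv dest: less_imp_le)
    have lt: "\<forall>x\<in>set w. x < N" "\<forall>x\<in>set (rev R). x < N" "\<forall>x\<in>set t. x < N" using N by auto
    have "N \<notin> set (w @ dec H @ rev R @ t)" using lt H by auto
    moreover have "distinct (filter (\<lambda>x. N \<le> x) (w @ dec H @ rev R @ t))"
      unfolding filter_append f(2)[OF lt(1)] f(2)[OF lt(2)] f(2)[OF lt(3)] h
      by (simp add: dec_def)
    moreover have "filter (\<lambda>x. x < N) (w @ dec H @ rev R @ t) = w @ rev R @ t"
      unfolding filter_append f(1)[OF lt(1)] f(1)[OF lt(2)] f(1)[OF lt(3)] h by simp
    ultimately show ?thesis using balanced_filter_iff[of N] b e by metis
  qed
  then show ?thesis unfolding balanced_row_def by blast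
qed

lemma sorted_eq_if_set_eq:
  "sorted_wrt (<) (xs :: nat list) \<Longrightarrow> sorted_wrt (<) ys \<Longrightarrow> set xs = set ys \<Longrightarrow> xs = ys"
  by (rule sorted_distinct_set_unique) (auto simp: strict_sorted_iff)

text \<open>The length bounds in the induction hypothesis, strict for an empty row, serve the empty
  tableau: it is treated as one empty row above which the tableau is empty again, so only the words
  get shorter.\<close>

lemma row_case:
  assumes R: "sorted_wrt (<) R" and us: "sorted_wrt (<) us" and vs: "sorted_wrt (<) vs"
    and b: "balanced (rev vs @ rev us @ row_word (R # P))"
    and IH: "\<And>us1 vs1. sorted_wrt (<) us1 \<Longrightarrow> sorted_wrt (<) vs1 \<Longrightarrow>
      balanced (rev vs1 @ rev us1 @ row_word P) \<Longrightarrow> length us1 + length vs1 \<le> length us + length vs \<Longrightarrow>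
      (R = [] \<and> us @ vs \<noteq> [] \<Longrightarrow> length us1 + length vs1 < length us + length vs) \<Longrightarrow>
      commutes P us1 vs1"
  shows "commutes (R # P) us vs"
proof -
  obtain N where N: "\<forall>x\<in>set us \<union> set vs \<union> set R \<union> set (row_word P). x < N"
    using finite_nat_set_iff_bounded[of "set us \<union> set vs \<union> set R \<union> set (row_word P)"] by auto
  define S where "S = set R \<union> padding N 0"
  have S: "infinite S" unfolding S_def using infinite_padding by simp
  define X where "X = bumped S us"
  define Y where "Y = bumped (row_inserts S us) vs"
  define us1 where "us1 = filter (\<lambda>y. y < N) X"
  define vs1 where "vs1 = filter (\<lambda>y. y < N) Y"
  define hs where "hs = filter (\<lambda>y. \<not> y < N) X"
  define ks where "ks = filter (\<lambda>y. \<not> y < N) Y"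
  have g: "balanced_row (rev vs @ rev us) S (row_word P)"
    unfolding S_def using b N R by (intro balanced_row_row) (auto simp: row_word_def)
  have "separated S us" using balanced_row_steps(2)[OF S g] .
  then have X: "sorted_wrt (<) X" unfolding X_def using sorted_bumped[OF S _ us] by blast
  have g2: "balanced_row ([] @ rev vs) (row_inserts S us) (rev X @ row_word P)"
    using balanced_row_steps(1)[OF S g] unfolding X_def by simp
  have Y: "sorted_wrt (<) Y"
    unfolding Y_def using sorted_bumped[OF infinite_row_inserts[OF S] _ vs] balanced_row_steps(2)[OF infinite_row_inserts[OF S] g2] by blast
  have Xe: "X = us1 @ hs" and Ye: "Y = vs1 @ ks"
    using filter_append_sorted[OF X] filter_append_sorted[OF Y]
    unfolding us1_def vs1_def hs_def ks_def by auto
  have lt: "\<forall>r\<in>set R. r < N" "\<forall>x\<in>set us. x < N" "\<forall>x\<in>set vs. x < N" using N by auto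
  obtain R2 where R2: "strip_insert (R # P) us vs = (let (P2, l) = strip_insert P us1 vs1
      in (R2 # P2, (length hs, length ks) # l))"
    "sorted_wrt (<) R2" "set R2 = row_inserts (row_inserts S us) vs \<inter> {..<N}"
    "hs = map (\<lambda>k. N + 2 * k) [1..<Suc (length hs)]"
    "ks = map (\<lambda>k. N + 2 * k) [Suc (length hs)..<Suc (length hs + length ks)]"
    using strip_insert_Cons[OF R lt, of P]
    unfolding S_def[symmetric] X_def[symmetric] Y_def[symmetric]
      us1_def[symmetric] vs1_def[symmetric] hs_def[symmetric] ks_def[symmetric] by blast
  have hk: "\<forall>h\<in>set hs. \<forall>k\<in>set ks. h < k"
    by (subst R2(4), subst R2(5)) auto
  have hk2: "\<forall>h\<in>set hs \<union> set ks. N < h"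
    by (subst R2(4), subst R2(5)) auto
  have hk3: "\<forall>h\<in>set hs. Suc h \<notin> set hs"
    by (subst R2(4), subst (2) R2(4)) (auto, presburger)
  have lt1: "\<forall>a\<in>set us1 \<union> set vs1. a < N" unfolding us1_def vs1_def by auto
  have so: "sorted_wrt (<) us1" "sorted_wrt (<) vs1" "sorted_wrt (<) hs" "sorted_wrt (<) ks"
    using X Y unfolding Xe Ye by (auto simp: sorted_wrt_append)
  have len: "length us = length us1 + length hs" "length vs = length vs1 + length ks"
    using Xe Ye by (metis X_def length_append length_bumped, metis Y_def length_append length_bumped)
  obtain M where "balanced (dec (row_inserts (row_inserts S us) vs \<inter> {..<M}) @ rev Y @ rev X @ row_word P)"
    using balanced_row_steps(1)[OF infinite_row_inserts[OF S] g2] unfolding Y_def[symmetric] balanced_row_def by auto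
  then have bal: "balanced (rev Y @ rev X @ row_word P)" by (rule balanced_suffix)
  have P: "\<forall>x\<in>set (row_word P). x < N" using N by auto
  \<comment> \<open>Discarding the large letters hands the balance hypothesis on to the words
    inserted into \<open>P\<close>.\<close>
  have b1: "balanced (rev vs1 @ rev us1 @ row_word P)"
  proof -
    let ?w = "rev Y @ rev X @ row_word P"
    have f: "filter (\<lambda>x. x < N) ?w = rev vs1 @ rev us1 @ row_word P"
      using P unfolding us1_def vs1_def by (auto simp: rev_filter filter_id_conv)
    have "filter (\<lambda>x. N \<le> x) ?w = rev ks @ rev hs"
      using P unfolding ks_def hs_def by (auto simp: rev_filter filter_empty_conv not_less)
    moreover have "distinct (rev ks @ rev hs)"
      using so hk by (auto simp: strict_sorted_iff)
    moreover have "N \<notin> set ?w" using P lt1 hk2 unfolding Xe Ye by auto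
    ultimately show ?thesis using balanced_filter_iff[of N ?w] bal f by simp
  qed
  have T: "commutes P us1 vs1"
  proof (rule IH[OF so(1,2) b1])
    show "length us1 + length vs1 \<le> length us + length vs" using len by simp
    assume e: "R = [] \<and> us @ vs \<noteq> []"
    \<comment> \<open>The first letter inserted into an empty row is appended, that is, it bumps a
      large letter.\<close>
    have "hs \<noteq> [] \<or> ks \<noteq> []"
    proof (cases us)
      case Nil
      then obtain v vs' where "vs = v # vs'" using e by (cases vs) auto
      then show ?thesis using Nil e row_append(1)[of "[]" N v 0] lt(3) unfolding ks_def Y_def S_def by auto
    next
      case (Cons u us')
      then show ?thesis using e row_append(1)[of "[]" N u 0] lt(2) unfolding hs_def X_def S_def by auto
    qed
    then show "length us1 + length vs1 < length us + length vs" using len by auto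
  qed
  obtain P2 l where Pl: "strip_insert P us1 vs1 = (P2, l)" by fastforce
  then have main: "strip_insert (R # P) us vs = (R2 # P2, (length hs, length ks) # l)" using R2(1) by simp
  have hk4: "\<forall>h\<in>set (us1 @ hs). \<forall>k\<in>set ks. h < k" using hk hk2 lt1 by auto (meson UnI1 UnI2 less_trans)
  show ?thesis
    unfolding commutes_def
  proof (intro conjI impI allI)
    assume "paired us vs"
    then have "paired (us1 @ hs) (vs1 @ ks)"
      using paired_bumped[OF _ S us g] Xe Ye unfolding X_def Y_def by simp
    then have h: "paired us1 vs1" "length us1 + length hs \<le> length vs1" using paired_append[OF _ hk4] by auto
    then have "move_row l = None" "opens l = length vs1 - length us1" using T Pl unfolding commutes_def by auto
    then show "move_row (snd (strip_insert (R # P) us vs)) = None"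
      "opens (snd (strip_insert (R # P) us vs)) = length vs - length us"
      using h main len by auto
  next
    fix us' vs' n
    assume F: "move us vs us' vs' n"
    have lt': "\<forall>x\<in>set us'. x < N" "\<forall>x\<in>set vs'. x < N"
      using lt move_subset[OF F] move_vs_subset[OF F] by auto
    define X' where "X' = bumped S us'"
    define Y' where "Y' = bumped (row_inserts S us') vs'"
    have F1: "move X Y X' Y' n" and rr: "row_inserts (row_inserts S us) vs = row_inserts (row_inserts S us') vs'"
      using move_bumped[OF F S us vs g] unfolding X_def Y_def X'_def Y'_def by auto
    obtain R2' where R2': "strip_insert (R # P) us' vs' =
      (let (P2, l) = strip_insert P (filter (\<lambda>y. y < N) X') (filter (\<lambda>y. y < N) Y')
        in (R2' # P2, (length (filter (\<lambda>y. \<not> y < N) X'), length (filter (\<lambda>y. \<not> y < N) Y')) # l))"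
      "sorted_wrt (<) R2'" "set R2' = row_inserts (row_inserts S us') vs' \<inter> {..<N}"
      using strip_insert_Cons[OF R lt(1) lt', of P]
      unfolding S_def[symmetric] X'_def[symmetric] Y'_def[symmetric] by blast
    have RR: "R2' = R2" using sorted_eq_if_set_eq[OF R2'(2) R2(2)] R2'(3) R2(3) rr by simp
    have fsmall: "filter (\<lambda>y. y < N) s = s" "filter (\<lambda>y. \<not> y < N) s = []" if "\<forall>a\<in>set s. a < N" for s
      using that by (auto simp: filter_id_conv filter_empty_conv)
    have fbig: "filter (\<lambda>y. y < N) s = []" "filter (\<lambda>y. \<not> y < N) s = s" if "\<forall>a\<in>set s. N < a" for s
      using that by (auto simp: filter_id_conv filter_empty_conv)
    consider (huge) "hs \<noteq> []" "X' = us1 @ butlast hs" "Y' = vs1 @ last hs # ks" "n = length ks"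
        "paired us1 vs1 \<and> length vs1 - length us1 < length hs \<or>
          (\<exists>us' vs' n'. move us1 vs1 us' vs' n' \<and> n' < length hs)"
      | (small) us2 vs2 n' where "move us1 vs1 us2 vs2 n'" "X' = us2 @ hs" "Y' = vs2 @ ks"
        "length hs \<le> n'" "n = n' - length hs + length ks"
      using move_append[OF F1 Xe Ye X Y lt1 hk2 hk3 hk] by blast
    then have "fst (strip_insert (R # P) us' vs') = fst (strip_insert (R # P) us vs) \<and>
      opens (snd (strip_insert (R # P) us vs)) = n \<and>
      (\<exists>r. move_row (snd (strip_insert (R # P) us vs)) = Some r \<and>
        snd (strip_insert (R # P) us' vs') = shift r (snd (strip_insert (R # P) us vs)))"
    proof cases
      \<comment> \<open>The small words do not change, so all higher rows agree, and one cell of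
        this row passes from the first factor to the second.\<close>
      case huge
      have el: "opens l < length hs"
        using huge(5) T Pl unfolding commutes_def by fastforce
      have "\<forall>a\<in>set (butlast hs). N < a" "\<forall>a\<in>set (last hs # ks). N < a"
        using hk2 huge(1) by (auto dest: in_set_butlastD)
      then have "filter (\<lambda>y. y < N) X' = us1" "filter (\<lambda>y. y < N) Y' = vs1"
        "length (filter (\<lambda>y. \<not> y < N) X') = length hs - 1"
        "length (filter (\<lambda>y. \<not> y < N) Y') = Suc (length ks)"
        unfolding huge(2,3) filter_append using fsmall lt1 fbig by simp_all
      then have "strip_insert (R # P) us' vs' = (R2 # P2, (length hs - 1, Suc (length ks)) # l)"
        using R2'(1) RR Pl by simp
      then show ?thesis using main el huge(4) by (auto simp: shift_def)
    next
      \<comment> \<open>This row gains the same cells on both sides, and the change takes place in a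
        higher row.\<close>
      case small
      have lt2: "\<forall>a\<in>set us2. a < N" "\<forall>a\<in>set vs2. a < N"
        using move_subset[OF small(1)] move_vs_subset[OF small(1)] lt1 by auto
      have "\<forall>a\<in>set hs. N < a" "\<forall>a\<in>set ks. N < a" using hk2 by auto
      then have "filter (\<lambda>y. y < N) X' = us2" "filter (\<lambda>y. y < N) Y' = vs2"
        "filter (\<lambda>y. \<not> y < N) X' = hs" "filter (\<lambda>y. \<not> y < N) Y' = ks"
        unfolding small(2,3) filter_append using fsmall lt2 fbig by simp_all
      then have t: "strip_insert (R # P) us' vs' = (R2 # fst (strip_insert P us2 vs2), (length hs, length ks) # snd (strip_insert P us2 vs2))"
        using R2'(1) RR by (simp add: case_prod_beta)
      obtain r where "fst (strip_insert P us2 vs2) = P2" "opens l = n'" "move_row l = Some r"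
        "snd (strip_insert P us2 vs2) = shift r l"
        using T small(1) Pl unfolding commutes_def by fastforce
      then show ?thesis using main t small(4,5) by (auto simp: shift_def)
    qed
    then show "fst (strip_insert (R # P) us' vs') = fst (strip_insert (R # P) us vs)"
      "opens (snd (strip_insert (R # P) us vs)) = n"
      "\<exists>r. move_row (snd (strip_insert (R # P) us vs)) = Some r \<and>
        snd (strip_insert (R # P) us' vs') = shift r (snd (strip_insert (R # P) us vs))" by auto
  qed
qed

lemma inserts_Nil: "xs \<noteq> [] \<Longrightarrow> inserts [] xs = inserts [[]] xs"
  by (cases xs) auto

lemma strip_insert_Nil:
  assumes "us @ vs \<noteq> []"
  shows "strip_insert [] us vs = strip_insert [[]] us vs"
proof (cases us)
  case Nil
  then show ?thesis using assms inserts_Nil[of vs] unfolding strip_insert_def by simp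
next
  case (Cons a list)
  then show ?thesis using inserts_Nil[of us] unfolding strip_insert_def by simp
qed

lemma commutes_trivial: "commutes P [] []"
proof -
  have e: "opens (map (\<lambda>r. (0, 0)) rs) = 0" for rs :: "nat list" by (induction rs) auto
  have f: "move_row (map (\<lambda>r. (0, 0)) rs) = None" for rs :: "nat list" by (induction rs) (auto simp: e)
  have "\<not> move [] [] us' vs' n" for us' vs' n by (auto elim: move.cases)
  then show ?thesis unfolding commutes_def strip_insert_def by (simp add: e f)
qed

lemma commutes_tableau:
  assumes "\<forall>R\<in>set P. sorted_wrt (<) R" "sorted_wrt (<) us" "sorted_wrt (<) vs"
    and "balanced (rev vs @ rev us @ row_word P)"
  shows "commutes P us vs"
  using assms
proof (induction "length P + length us + length vs" arbitrary: P us vs rule: less_induct)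
  case less
  show ?case
  proof (cases P)
    case (Cons R P')
    show ?thesis
      unfolding Cons
    proof (rule row_case)
      fix us1 vs1
      assume "sorted_wrt (<) us1" "sorted_wrt (<) vs1" "balanced (rev vs1 @ rev us1 @ row_word P')"
        "length us1 + length vs1 \<le> length us + length vs"
      then show "commutes P' us1 vs1" using less.prems(1) Cons by (intro less.hyps) auto
    qed (use less.prems Cons in auto)
  next
    case Nil
    show ?thesis
    proof (cases "us @ vs = []")
      case True
      then show ?thesis using commutes_trivial by simp
    next
      case False
      have "commutes ([] # []) us vs"
      proof (rule row_case)
        fix us1 vs1
        assume "sorted_wrt (<) us1" "sorted_wrt (<) vs1" "balanced (rev vs1 @ rev us1 @ row_word [])"
          "[] = [] \<and> us @ vs \<noteq> [] \<Longrightarrow> length us1 + length vs1 < length us + length vs"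
        then show "commutes [] us1 vs1" using Nil False by (intro less.hyps) auto
      qed (use less.prems Nil in \<open>auto simp: row_word_def\<close>)
      moreover have "us' @ vs' \<noteq> []" if "move us vs us' vs' n" for us' vs' n
        using that by (auto elim: move.cases)
      ultimately show ?thesis unfolding commutes_def Nil using strip_insert_Nil False by simp
    qed
  qed
qed

section \<open>The pairing of the crystal operator\<close>

lemma unpaired_append: "unpaired (ws @ ws') A = unpaired ws' (unpaired ws A)"
  by (induction ws arbitrary: A) auto

lemma unpaired_subset: "unpaired ws A \<subseteq> A"
proof (induction ws arbitrary: A)
  case (Cons b ws)
  show ?case using Cons[of A] Cons[of "A - {Min {a \<in> A. b \<le> a}}"] by auto
qed simp

lemma unpaired_Un_low:
  "finite A \<Longrightarrow> \<forall>b\<in>set ws. \<forall>c\<in>C. c < b \<Longrightarrow> unpaired ws (C \<union> A) = C \<union> unpaired ws A"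
proof (induction ws arbitrary: A)
  case (Cons b ws)
  let ?m = "Min {a \<in> A. b \<le> a}"
  have e: "{a \<in> C \<union> A. b \<le> a} = {a \<in> A. b \<le> a}" using Cons.prems by fastforce
  show ?case
  proof (cases "\<exists>a\<in>A. b \<le> a")
    case True
    then have "?m \<in> {a \<in> A. b \<le> a}" using Cons.prems(1) by (intro Min_in) auto
    then have "?m \<notin> C" using Cons.prems(2) by fastforce
    then have "C \<union> A - {?m} = C \<union> (A - {?m})" by auto
    moreover have "\<exists>a\<in>C \<union> A. b \<le> a" using True by blast
    ultimately show ?thesis using True e Cons by simp
  next
    case False
    then have "\<not> (\<exists>a\<in>C \<union> A. b \<le> a)" using Cons.prems by fastforce
    then show ?thesis using False Cons by simp
  qed
qed simp

text \<open>A Hall-type criterion for the greedy pairing from above. After pairing \<open>b\<close>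
  with \<open>m\<close>, both counts keep their values for thresholds below \<open>b\<close> and
  drop by one from \<open>m\<close> on; in between, only letters below \<open>b\<close> are left,
  and these are counted at \<open>b - 1\<close>.\<close>

lemma unpaired_eq_empty:
  assumes "finite A" "sorted_wrt (>) ws"
    and "\<And>t. card {a \<in> A. a \<le> t} \<le> length (filter (\<lambda>b. b \<le> t) ws)"
  shows "unpaired ws A = {}"
  using assms
proof (induction ws arbitrary: A)
  case Nil
  have "a \<notin> A" for a
  proof
    assume "a \<in> A"
    then have "card {c \<in> A. c \<le> a} > 0" using Nil.prems(1) by (auto simp: card_gt_0_iff)
    then show False using Nil.prems(3)[of a] unfolding filter.simps list.size by linarith
  qed
  then show ?case by auto
next
  case (Cons b ws)
  have ws: "\<forall>c\<in>set ws. c < b" using Cons.prems by simp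
  have low: "card {a \<in> A. a < b} \<le> length ws"
  proof (cases b)
    case (Suc c)
    have "{a \<in> A. a < b} = {a \<in> A. a \<le> c}" using Suc by auto
    then show ?thesis using Cons.prems(3)[of c] Suc
      by (metis (no_types, lifting) Suc_n_not_le_n filter.simps(2) le_trans length_filter_le)
  qed simp
  have all: "filter (\<lambda>c. c \<le> t) ws = ws" if "b \<le> t" for t
    using ws that by (auto simp: filter_id_conv intro: less_imp_le less_le_trans)
  show ?case
  proof (cases "\<exists>a\<in>A. b \<le> a")
    case True
    define m where "m = Min {a \<in> A. b \<le> a}"
    have "m \<in> {a \<in> A. b \<le> a}" unfolding m_def using Cons.prems(1) True by (intro Min_in) auto
    then have m: "m \<in> A" "b \<le> m" by auto
    have least: "m \<le> a" if "a \<in> A" "b \<le> a" for a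
      unfolding m_def using Cons.prems(1) that by (intro Min_le) auto
    have "unpaired ws (A - {m}) = {}"
    proof (rule Cons.IH)
      fix t
      consider "t < b" | "b \<le> t" "t < m" | "m \<le> t" by linarith
      then show "card {a \<in> A - {m}. a \<le> t} \<le> length (filter (\<lambda>b. b \<le> t) ws)"
      proof cases
        case 1
        then have "{a \<in> A - {m}. a \<le> t} = {a \<in> A. a \<le> t}" using m by auto
        then show ?thesis using Cons.prems(3)[of t] 1 by simp
      next
        case 2
        then have "{a \<in> A - {m}. a \<le> t} = {a \<in> A. a < b}" using least by fastforce
        then show ?thesis using low all[OF 2(1)] by simp
      next
        case 3
        then have "{a \<in> A - {m}. a \<le> t} = {a \<in> A. a \<le> t} - {m}" by auto
        moreover have "m \<in> {a \<in> A. a \<le> t}" using 3 m by simp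
        ultimately have "card {a \<in> A - {m}. a \<le> t} = card {a \<in> A. a \<le> t} - 1"
          using Cons.prems(1) by simp
        then show ?thesis using Cons.prems(3)[of t] 3 m by simp
      qed
    qed (use Cons.prems in auto)
    then show ?thesis using True unfolding m_def by simp
  next
    case False
    have "unpaired ws A = {}"
    proof (rule Cons.IH)
      fix t
      show "card {a \<in> A. a \<le> t} \<le> length (filter (\<lambda>b. b \<le> t) ws)"
      proof (cases "t < b")
        case True
        then show ?thesis using Cons.prems(3)[of t] by simp
      next
        case tb: False
        then have "{a \<in> A. a \<le> t} = {a \<in> A. a < b}" using False by fastforce
        then show ?thesis using low all[of t] tb by simp
      qed
    qed (use Cons.prems in auto)
    then show ?thesis using False by simp
  qed
qed

text \<open>The dual count: every letter of \<open>ws\<close> finds a partner in \<open>A\<close>,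
  and this partner is preferred to the larger letter \<open>x\<close>.\<close>

lemma unpaired_keeps_max:
  assumes "finite A" "\<forall>a\<in>A. a < x" "sorted_wrt (>) ws"
    and "\<And>t. length (filter (\<lambda>b. t \<le> b) ws) \<le> card {a \<in> A. t \<le> a}"
  shows "x \<in> unpaired ws (insert x A)"
  using assms
proof (induction ws arbitrary: A)
  case (Cons b ws)
  have "1 \<le> card {a \<in> A. b \<le> a}" using Cons.prems(4)[of b] by simp
  then have ne: "{a \<in> A. b \<le> a} \<noteq> {}" by (metis card.empty not_one_le_zero)
  define m where "m = Min {a \<in> A. b \<le> a}"
  have "m \<in> {a \<in> A. b \<le> a}" unfolding m_def using Cons.prems(1) ne by (intro Min_in) auto
  then have m: "m \<in> A" "b \<le> m" by auto
  have least: "m \<le> a" if "a \<in> A" "b \<le> a" for a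
    unfolding m_def using Cons.prems(1) that by (intro Min_le) auto
  have min: "Min {a \<in> insert x A. b \<le> a} = m"
    using Cons.prems(1,2) m least by (intro Min_eqI) (auto intro: less_imp_le)
  have "x \<in> unpaired ws (insert x (A - {m}))"
  proof (rule Cons.IH)
    fix t
    show "length (filter (\<lambda>b. t \<le> b) ws) \<le> card {a \<in> A - {m}. t \<le> a}"
    proof (cases "t \<le> b")
      case True
      have "{a \<in> A - {m}. t \<le> a} = {a \<in> A. t \<le> a} - {m}" by auto
      moreover have "m \<in> {a \<in> A. t \<le> a}" using True m by simp
      ultimately have "card {a \<in> A - {m}. t \<le> a} = card {a \<in> A. t \<le> a} - 1"
        using Cons.prems(1) by simp
      then show ?thesis using Cons.prems(4)[of t] True by simp
    next
      case False
      then have "filter (\<lambda>b. t \<le> b) ws = []" using Cons.prems(3) by (auto simp: filter_empty_conv)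
      then show ?thesis by simp
    qed
  qed (use Cons.prems in auto)
  moreover have "insert x A - {m} = insert x (A - {m})" using m Cons.prems(2) by auto
  moreover have "\<exists>a\<in>insert x A. b \<le> a" using m by blast
  ultimately show ?case using min by simp
qed simp

lemma card_filter:
  assumes "sorted_wrt (<) (us :: nat list)"
  shows "card {a \<in> set us. Q a} = length (filter Q us)"
  using assms distinct_card[of "filter Q us"] by (simp add: strict_sorted_iff)

lemma paired_count: "paired us vs \<Longrightarrow> sorted_wrt (<) us \<Longrightarrow>
  length (filter (\<lambda>a. a \<le> t) us) \<le> length (filter (\<lambda>b. b \<le> (t::nat)) vs)"
  by (induction us vs rule: paired.induct) auto

lemma paired_unpaired:
  assumes "paired us vs" "sorted_wrt (<) us" "sorted_wrt (<) vs"
  shows "unpaired (rev vs) (set us) = {}"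
proof (rule unpaired_eq_empty)
  show "sorted_wrt (>) (rev vs)" using assms(3) by (simp add: sorted_wrt_rev)
  show "card {a \<in> set us. a \<le> t} \<le> length (filter (\<lambda>b. b \<le> t) (rev vs))" for t
    unfolding card_filter[OF assms(2)] rev_filter[symmetric] length_rev
    using paired_count[OF assms(1,2)] .
qed simp

text \<open>Unfolds a derivation around the moved letter \<open>x\<close>. Below it, the counts
  guarantee every letter of \<open>vl\<close> a partner in \<open>ul\<close>; above it,
  \<open>vh\<close> serves all of \<open>uh\<close>. These are the two situations in which the
  greedy pairing can be evaluated.\<close>

lemma move_split:
  assumes "move us vs us' vs' n" "sorted_wrt (<) vs"
  shows "\<exists>ul x uh vl vh. us = ul @ x # uh \<and> vs = vl @ vh \<and> vs' = vl @ x # vh \<and>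
    (\<forall>t. length (filter (\<lambda>b. t \<le> b) vl) \<le> length (filter (\<lambda>a. t \<le> a) ul)) \<and>
    paired uh vh \<and> (\<forall>b\<in>set vh. x < b) \<and>
    (Suc x \<notin> set uh \<and> us' = ul @ uh \<or>
     (\<exists>uh' vh'. uh = Suc x # uh' \<and> vh = Suc x # vh' \<and> us' = ul @ x # uh'))"
    (is "\<exists>ul x uh vl vh. ?P us vs us' vs' ul x uh vl vh")
  using assms
proof (induction rule: move.induct)
  case (base us vs x)
  then have "?P (x # us) vs us (x # vs) [] x us [] vs" by auto
  then show ?case by blast
next
  case (special us vs x)
  then have "?P (x # Suc x # us) (Suc x # vs) (x # us) (x # Suc x # vs) [] x (Suc x # us) [] (Suc x # vs)"
    by auto
  then show ?case by blast
next
  case (skip us vs us' vs' n a)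
  then obtain ul x uh vl vh where "?P us vs us' vs' ul x uh vl vh" by blast
  then have "?P (a # us) vs (a # us') vs' (a # ul) x uh vl vh" by (auto intro: le_SucI)
  then show ?case by blast
next
  case (pair us vs us' vs' n b a)
  then have "sorted_wrt (<) vs" by simp
  then obtain ul x uh vl vh where "?P us vs us' vs' ul x uh vl vh" using pair.IH by blast
  then have "?P (a # us) (b # vs) (a # us') (b # vs') (a # ul) x uh (b # vl) vh"
    using pair.hyps(2) by (auto intro: le_SucI dest: le_trans)
  then show ?case by blast
qed

lemma move_unpaired:
  assumes F: "move us vs us' vs' n" and us: "sorted_wrt (<) us" and vs: "sorted_wrt (<) vs"
  defines "U \<equiv> unpaired (rev vs) (set us)"
  defines "z \<equiv> if Suc (Max U) \<in> set us \<inter> set vs then Suc (Max U) else Max U"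
  shows "U \<noteq> {}" "removeAll z (rev us) = rev us'" "add_letter (Max U) (rev vs) = rev vs'"
proof -
  obtain ul x uh vl vh where s: "us = ul @ x # uh" "vs = vl @ vh" "vs' = vl @ x # vh"
    and dom: "\<And>t. length (filter (\<lambda>b. t \<le> b) vl) \<le> length (filter (\<lambda>a. t \<le> a) ul)"
    and h: "paired uh vh" "\<forall>b\<in>set vh. x < b"
    and c: "Suc x \<notin> set uh \<and> us' = ul @ uh \<or>
     (\<exists>uh' vh'. uh = Suc x # uh' \<and> vh = Suc x # vh' \<and> us' = ul @ x # uh')"
    using move_split[OF F vs] by blast
  have so: "sorted_wrt (<) ul" "sorted_wrt (<) uh" "sorted_wrt (<) vl" "sorted_wrt (<) vh"
    "\<forall>a\<in>set ul. a < x" "\<forall>a\<in>set uh. x < a"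
    using us vs unfolding s by (auto simp: sorted_wrt_append)
  have vl: "b < x" if "b \<in> set vl" for b
  proof -
    have "filter (\<lambda>v. b \<le> v) vl \<noteq> []" using that by (auto simp: filter_empty_conv)
    then have "filter (\<lambda>a. b \<le> a) ul \<noteq> []" using dom[of b] by auto
    then show ?thesis using so(5) by (auto simp: filter_empty_conv)
  qed
  \<comment> \<open>The upper letters are processed first. All of \<open>vh\<close> lies above
    \<open>x\<close>, so it can only use up \<open>uh\<close>.\<close>
  have "unpaired (rev vh) (set us) = unpaired (rev vh) (insert x (set ul) \<union> set uh)" unfolding s by simp
  also have "\<dots> = insert x (set ul) \<union> unpaired (rev vh) (set uh)"
    using h(2) so(5) by (intro unpaired_Un_low) fastforce+
  finally have "unpaired (rev vh) (set us) = insert x (set ul)"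
    using paired_unpaired[OF h(1) so(2,4)] by simp
  then have U: "U = unpaired (rev vl) (insert x (set ul))"
    unfolding U_def s(2) by (simp add: unpaired_append)
  have "x \<in> U"
    unfolding U
  proof (rule unpaired_keeps_max)
    show "sorted_wrt (>) (rev vl)" using so(3) by (simp add: sorted_wrt_rev)
    show "length (filter (\<lambda>b. t \<le> b) (rev vl)) \<le> card {a \<in> set ul. t \<le> a}" for t
      unfolding card_filter[OF so(1)] rev_filter[symmetric] length_rev by (rule dom)
  qed (use so in auto)
  then show "U \<noteq> {}" by blast
  have sub: "U \<subseteq> insert x (set ul)" unfolding U by (rule unpaired_subset)
  have mx: "Max U = x"
  proof (rule Max_eqI)
    show "finite U" using finite_subset[OF sub] by simp
    show "y \<le> x" if "y \<in> U" for y using that sub so(5) less_imp_le by blast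
  qed (rule \<open>x \<in> U\<close>)
  have "filter (\<lambda>a. x < a) vl = []" "filter (\<lambda>a. a < x) vl = vl"
    "filter (\<lambda>a. x < a) vh = vh" "filter (\<lambda>a. a < x) vh = []"
    using vl h(2) by (auto simp: filter_empty_conv filter_id_conv dest: less_asym)
  then show "add_letter (Max U) (rev vs) = rev vs'"
    unfolding mx add_letter_def s by (simp add: rev_filter[symmetric])
  have rem: "removeAll y w = w" if "y \<notin> set w" for y and w :: "nat list" using that by simp
  from c show "removeAll z (rev us) = rev us'"
  proof
    assume c: "Suc x \<notin> set uh \<and> us' = ul @ uh"
    then have "Suc x \<notin> set us" using so(5) unfolding s by auto
    then have "z = x" unfolding z_def mx by simp
    moreover have "x \<notin> set ul" "x \<notin> set uh" using so by auto
    ultimately show ?thesis unfolding s(1) using c by simp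
  next
    assume "\<exists>uh' vh'. uh = Suc x # uh' \<and> vh = Suc x # vh' \<and> us' = ul @ x # uh'"
    then obtain uh' vh' where c: "uh = Suc x # uh'" "vh = Suc x # vh'" "us' = ul @ x # uh'" by blast
    then have "z = Suc x" unfolding z_def mx s by simp
    moreover have "Suc x \<notin> set ul" "Suc x \<notin> set uh'" using so(2,5) c(1) by auto
    ultimately show ?thesis unfolding s(1) c by simp
  qed
qed

lemma f_star_paired:
  assumes "sorted_wrt (>) (factor h i)" "sorted_wrt (>) (factor h (Suc i))"
    "paired (rev (factor h i)) (rev (factor h (Suc i)))"
  shows "f_star i h = None"
  using paired_unpaired[OF assms(3)] assms(1,2) unfolding f_star_def by (simp add: sorted_wrt_rev Let_def)

lemma f_star_move:
  assumes "sorted_wrt (>) (factor h i)" "sorted_wrt (>) (factor h (Suc i))"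
    "move (rev (factor h i)) (rev (factor h (Suc i))) us' vs' n"
  shows "f_star i h = Some (set_factor (set_factor h i (rev us')) (Suc i) (rev vs'))"
  using move_unpaired[OF assms(3), unfolded rev_rev_ident set_rev] assms(1,2)
  unfolding f_star_def by (simp add: sorted_wrt_rev Let_def)

section \<open>The recording tableau\<close>

lemma star_insert_length:
  "star_insert x P = (P', r) \<Longrightarrow> r \<le> length P \<and> length P' = max (length P) (Suc r)"
proof (induction P arbitrary: x P' r)
  case (Cons R P)
  show ?case
  proof (cases "R = [] \<or> Max (set R) < x")
    case False
    obtain y R' where y: "star_insert x (R # P) = (let (P', r) = star_insert y P in (R' # P', Suc r))"
      using False by (cases "x \<in> set R") (auto simp: Let_def)
    obtain P1 r1 where P1: "star_insert y P = (P1, r1)" by fastforce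
    then show ?thesis using Cons.IH[OF P1] Cons.prems y by auto
  qed (use Cons.prems in auto)
qed auto

lemma inserts_length: "length (snd (inserts P xs)) = length xs"
  by (induction xs arbitrary: P) (auto simp: case_prod_beta)

lemma inserts_append:
  "inserts P (xs @ ys) = (fst (inserts (fst (inserts P xs)) ys), snd (inserts P xs) @ snd (inserts (fst (inserts P xs)) ys))"
  by (induction xs arbitrary: P) (auto simp: case_prod_beta)

text \<open>With \<open>rs\<close> the rows gained and \<open>qs\<close> the factor indices, this is
  row \<open>r\<close> of the recording tableau.\<close>

definition cells :: "nat list \<Rightarrow> nat list \<Rightarrow> nat \<Rightarrow> nat list" where
  "cells rs qs r = map snd (filter (\<lambda>c. fst c = r) (zip rs qs))"

lemma cells_append: "length rs = length qs \<Longrightarrow> cells (rs @ rs') (qs @ qs') r = cells rs qs r @ cells rs' qs' r"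
  unfolding cells_def by simp

lemma cells_replicate: "cells rs (replicate (length rs) q) r = replicate (count_list rs r) q"
  unfolding cells_def by (induction rs) auto

lemma set_cells: "set (cells rs qs r) \<subseteq> set qs"
  unfolding cells_def by (auto dest: set_zip_rightD)

lemma fold_add_cell:
  assumes "length Q = length P" "length qs = length xs"
  defines "Q' \<equiv> fold (\<lambda>(r, q). add_cell r q) (zip (snd (inserts P xs)) qs) Q"
  shows "length Q' = length (fst (inserts P xs)) \<and> (\<forall>r<length Q'.
    Q' ! r = (if r < length Q then Q ! r else []) @ cells (snd (inserts P xs)) qs r)"
  using assms(1,2) unfolding Q'_def
proof (induction xs arbitrary: P Q qs)
  case Nil
  then show ?case by (simp add: cells_def)
next
  case (Cons x xs)
  obtain q qs' where qs: "qs = q # qs'" "length qs' = length xs" using Cons.prems(2) by (cases qs) auto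
  obtain P1 r1 where P1: "star_insert x P = (P1, r1)" by fastforce
  have l: "r1 \<le> length P" "length P1 = max (length P) (Suc r1)" using star_insert_length[OF P1] by auto
  define Q1 where "Q1 = add_cell r1 q Q"
  have Q1: "length Q1 = length P1" using l Cons.prems(1) unfolding Q1_def add_cell_def by auto
  have nth: "(if r < length Q1 then Q1 ! r else []) =
    (if r < length Q then Q ! r else []) @ (if r = r1 then [q] else [])" for r
    using l Cons.prems(1) unfolding Q1_def add_cell_def by (auto simp: nth_append)
  have "zip (snd (inserts P (x # xs))) qs = (r1, q) # zip (snd (inserts P1 xs)) qs'"
    using P1 qs by (simp add: case_prod_beta)
  moreover have "cells (snd (inserts P (x # xs))) qs r = (if r = r1 then [q] else []) @ cells (snd (inserts P1 xs)) qs' r" for r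
    unfolding cells_def calculation by simp
  moreover have "fst (inserts P (x # xs)) = fst (inserts P1 xs)" using P1 by (simp add: case_prod_beta)
  ultimately show ?case
    using Cons.IH[OF Q1 qs(2)] nth by (simp add: Q1_def[symmetric])
qed

text \<open>The rows gained do not depend on the labels, so the insertion can be studied apart from
  its recording.\<close>

lemma fold_insertion:
  "fold (\<lambda>(q, x) (P, Q). let (P', r) = star_insert x P in (P', add_cell r q Q)) bw (P, Q) =
    (fst (inserts P (map snd bw)),
     fold (\<lambda>(r, q). add_cell r q) (zip (snd (inserts P (map snd bw))) (map fst bw)) Q)"
proof (induction bw arbitrary: P Q)
  case (Cons c bw)
  obtain q x where c: "c = (q, x)" by fastforce
  obtain P1 r1 where "star_insert x P = (P1, r1)" by fastforce
  then show ?case using Cons c by (simp add: case_prod_beta)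
qed simp

lemma Q_star_cells:
  fixes h
  defines "bw \<equiv> rev (biword h)"
  shows "Q_star h = map (cells (snd (inserts [] (map snd bw))) (map fst bw)) [0..<length (fst (inserts [] (map snd bw)))]"
proof -
  let ?Q = "fold (\<lambda>(r, q). add_cell r q) (zip (snd (inserts [] (map snd bw))) (map fst bw)) []"
  have "Q_star h = ?Q"
    unfolding Q_star_def star_insertion_def foldr_conv_fold bw_def[symmetric] fold_insertion by simp
  moreover have "length ?Q = length (fst (inserts [] (map snd bw)))"
    "\<And>r. r < length ?Q \<Longrightarrow> ?Q ! r = cells (snd (inserts [] (map snd bw))) (map fst bw) r"
    using fold_add_cell[of "[]" "[]" "map fst bw" "map snd bw"] by auto
  then have "?Q = map (cells (snd (inserts [] (map snd bw))) (map fst bw)) [0..<length (fst (inserts [] (map snd bw)))]"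
    by (intro nth_equalityI) simp_all
  ultimately show ?thesis by simp
qed

section \<open>The signature rule row by row\<close>

fun opened :: "nat \<Rightarrow> nat \<Rightarrow> ((nat \<times> nat) \<times> nat) list \<Rightarrow> nat" where
  "opened i k [] = k"
| "opened i k ((c, a) # w) =
    (if a = Suc i then opened i (Suc k) w else if a = i then opened i (k - 1) w else opened i k w)"

lemma unmatched_append: "unmatched i k (w @ w') = unmatched i k w @ unmatched i (opened i k w) w'"
  by (induction i k w rule: opened.induct) auto

lemma opened_append: "opened i k (w @ w') = opened i (opened i k w) w'"
  by (induction i k w rule: opened.induct) auto

definition row_cells :: "nat \<Rightarrow> nat \<Rightarrow> nat list \<Rightarrow> ((nat \<times> nat) \<times> nat) list" where
  "row_cells r s xs = map (\<lambda>(c, e). ((r, c), e)) (enumerate s xs)"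

lemma row_cells_append: "row_cells r s (xs @ ys) = row_cells r s xs @ row_cells r (s + length xs) ys"
  unfolding row_cells_def by (simp add: enumerate_append_eq)

lemma row_cells_other:
  "\<forall>a\<in>set xs. a \<noteq> i \<and> a \<noteq> Suc i \<Longrightarrow>
    unmatched i k (row_cells r s xs) = [] \<and> opened i k (row_cells r s xs) = k"
  unfolding row_cells_def by (induction xs arbitrary: s) auto

text \<open>Open brackets are closed from the left, so the unmatched entries form the right end of
  the block.\<close>

lemma row_cells_close:
  "unmatched i k (row_cells r s (replicate a i)) = map (Pair r) [s + k..<s + a] \<and>
    opened i k (row_cells r s (replicate a i)) = k - a"
proof (induction a arbitrary: s k)
  case (Suc a)
  show ?case
  proof (cases k)
    case 0
    then show ?thesis using Suc[of 0 "Suc s"] unfolding row_cells_def by (simp add: upt_conv_Cons)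
  next
    case (Suc k')
    then show ?thesis using Suc.IH[of k' "Suc s"] unfolding row_cells_def by simp
  qed
qed (simp add: row_cells_def)

lemma row_cells_open:
  "unmatched i k (row_cells r s (replicate b (Suc i))) = [] \<and>
    opened i k (row_cells r s (replicate b (Suc i))) = k + b"
  unfolding row_cells_def by (induction b arbitrary: s k) auto

text \<open>Within a row the closing brackets precede the opening ones, so they can only match
  brackets opened in higher rows. This is the source of the recursion for
  \<open>opens\<close>.\<close>

lemma row_cells_row:
  fixes r a b k :: nat
  assumes "\<forall>x\<in>set A. x < i" "\<forall>x\<in>set B. Suc i < x"
  defines "w \<equiv> row_cells r 0 (A @ replicate a i @ replicate b (Suc i) @ B)"
  shows "unmatched i k w = map (Pair r) [length A + k..<length A + a]" "opened i k w = b + (k - a)"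
proof -
  have o: "\<forall>a\<in>set A. a \<noteq> i \<and> a \<noteq> Suc i" "\<forall>a\<in>set B. a \<noteq> i \<and> a \<noteq> Suc i" using assms by auto
  show "unmatched i k w = map (Pair r) [length A + k..<length A + a]" "opened i k w = b + (k - a)"
    unfolding w_def row_cells_append unmatched_append opened_append
    using row_cells_other[OF o(1)] row_cells_other[OF o(2)]
    by (simp_all add: row_cells_close row_cells_open)
qed

text \<open>The common form of the recording tableaux before and after the operator: the labels in
  \<open>A\<close> and \<open>B\<close> stay, and only the counts \<open>l\<close> vary.\<close>

definition strip_tableau :: "nat \<Rightarrow> (nat \<Rightarrow> nat list) \<Rightarrow> (nat \<Rightarrow> nat list) \<Rightarrow> (nat \<times> nat) list \<Rightarrow> nat list list" where
  "strip_tableau i A B l = map (\<lambda>r. A r @ replicate (fst (l ! r)) i @ replicate (snd (l ! r)) (Suc i) @ B r)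
    [0..<length l]"

lemma reading_strip_tableau:
  "reading (strip_tableau i A B l) = concat (map (\<lambda>r. row_cells r 0
    (A r @ replicate (fst (l ! r)) i @ replicate (snd (l ! r)) (Suc i) @ B r)) (rev [0..<length l]))"
proof -
  have e: "map (\<lambda>c. ((r, c), xs ! c)) [0..<length xs] = row_cells r 0 xs" for r :: nat and xs :: "nat list"
    unfolding row_cells_def by (rule nth_equalityI) (auto simp: nth_enumerate_eq)
  let ?T = "strip_tableau i A B l"
  have "reading ?T = concat (map (\<lambda>r. row_cells r 0 (?T ! r)) (rev [0..<length ?T]))"
    unfolding reading_def e ..
  also have "map (\<lambda>r. row_cells r 0 (?T ! r)) (rev [0..<length ?T]) = map (\<lambda>r. row_cells r 0
    (A r @ replicate (fst (l ! r)) i @ replicate (snd (l ! r)) (Suc i) @ B r)) (rev [0..<length l])"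
    by (rule map_cong) (auto simp: strip_tableau_def)
  finally show ?thesis .
qed

text \<open>The reading word starts at the top, so the induction lowers \<open>m\<close>, the lowest
  row read so far. A row with more \<open>i\<close> than brackets open above it supplies the new
  last unmatched \<open>i\<close>, namely its rightmost \<open>i\<close>; any other row leaves the
  previous one in place.\<close>

lemma unmatched_rows:
  assumes A: "\<And>r. \<forall>x\<in>set (A r). x < i" and B: "\<And>r. \<forall>x\<in>set (B r). Suc i < x"
    and m: "m \<le> length l"
  defines "w \<equiv> \<lambda>m. concat (map (\<lambda>r. row_cells r 0
    (A r @ replicate (fst (l ! r)) i @ replicate (snd (l ! r)) (Suc i) @ B r)) (rev [m..<length l]))"
  shows "opened i 0 (w m) = opens (drop m l) \<and>
    (case move_row (drop m l) of None \<Rightarrow> unmatched i 0 (w m) = []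
      | Some d \<Rightarrow> unmatched i 0 (w m) \<noteq> [] \<and> m + d < length l \<and> 0 < fst (l ! (m + d)) \<and>
          last (unmatched i 0 (w m)) = (m + d, length (A (m + d)) + fst (l ! (m + d)) - 1))"
  using m
proof (induction m rule: inc_induct)
  case base
  then show ?case unfolding w_def by simp
next
  case (step m)
  obtain a b where ab: "l ! m = (a, b)" by fastforce
  let ?k = "opens (drop (Suc m) l)"
  have d: "drop m l = (a, b) # drop (Suc m) l" using step.hyps ab by (metis Cons_nth_drop_Suc)
  have w: "w m = w (Suc m) @ row_cells m 0 (A m @ replicate a i @ replicate b (Suc i) @ B m)"
    unfolding w_def using step.hyps ab by (simp add: upt_conv_Cons)
  note r = row_cells_row[OF A[of m] B[of m], where r = m and a = a and b = b]
  have ih: "opened i 0 (w (Suc m)) = ?k" using step.IH by blast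
  have o: "opened i 0 (w m) = opens (drop m l)" unfolding w opened_append r ih d by simp
  have u: "unmatched i 0 (w m) = unmatched i 0 (w (Suc m)) @ map (Pair m) [length (A m) + ?k..<length (A m) + a]"
    unfolding w unmatched_append r ih ..
  show ?case
  proof (cases "?k < a")
    case True
    then have f: "move_row (drop m l) = Some 0" unfolding d by simp
    have ne: "[length (A m) + ?k..<length (A m) + a] \<noteq> []" using True by simp
    have "last (unmatched i 0 (w m)) = (m, last [length (A m) + ?k..<length (A m) + a])"
      unfolding u using ne by (simp add: last_map)
    also have "last [length (A m) + ?k..<length (A m) + a] = length (A m) + a - 1"
      using True by (cases a) simp_all
    finally have "last (unmatched i 0 (w m)) = (m, length (A m) + a - 1)" .
    moreover have "unmatched i 0 (w m) \<noteq> []" unfolding u using ne by simp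
    ultimately show ?thesis using True f o ab step.hyps by simp
  next
    case False
    then have f: "move_row (drop m l) = map_option Suc (move_row (drop (Suc m) l))" unfolding d by simp
    have "unmatched i 0 (w m) = unmatched i 0 (w (Suc m))" unfolding u using False by simp
    then show ?thesis using o step.IH unfolding f by (cases "move_row (drop (Suc m) l)") simp_all
  qed
qed

text \<open>The relabelled cell is the last \<open>i\<close> of its row, so the row keeps its block
  form with one \<open>i\<close> fewer and one \<open>i + 1\<close> more.\<close>

lemma f_tab_strip_tableau:
  assumes A: "\<And>r. \<forall>x\<in>set (A r). x < i" and B: "\<And>r. \<forall>x\<in>set (B r). Suc i < x"
  shows "f_tab i (strip_tableau i A B l) = map_option (\<lambda>r. strip_tableau i A B (shift r l)) (move_row l)"
proof (cases "move_row l")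
  case None
  then show ?thesis using unmatched_rows[of A i B 0 l, OF A B] unfolding f_tab_def reading_strip_tableau by simp
next
  case (Some r)
  let ?T = "strip_tableau i A B l"
  define c where "c = length (A r) + fst (l ! r) - 1"
  have u: "unmatched i 0 (reading ?T) \<noteq> []" "r < length l" "0 < fst (l ! r)"
    "last (unmatched i 0 (reading ?T)) = (r, c)"
    using unmatched_rows[of A i B 0 l, OF A B] Some unfolding reading_strip_tableau c_def by auto
  obtain a b where ab: "l ! r = (Suc a, b)" using u(3) by (cases "l ! r") (auto simp: gr0_conv_Suc)
  let ?Y = "replicate b (Suc i) @ B r"
  have "A r @ replicate (Suc a) i @ ?Y = (A r @ replicate a i) @ i # ?Y"
    by (simp add: replicate_app_Cons_same)
  then have "(A r @ replicate (Suc a) i @ ?Y)[length (A r) + a := Suc i] =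
    A r @ replicate a i @ replicate (Suc b) (Suc i) @ B r"
    using list_update_length[of "A r @ replicate a i" i ?Y "Suc i"] by simp
  then have row: "(?T ! r)[c := Suc i] = A r @ replicate a i @ replicate (Suc b) (Suc i) @ B r"
    using u(2) ab unfolding strip_tableau_def c_def by simp
  have "?T[r := (?T ! r)[c := Suc i]] = strip_tableau i A B (shift r l)"
    unfolding row
  proof (rule nth_equalityI)
    fix k
    assume "k < length (?T[r := A r @ replicate a i @ replicate (Suc b) (Suc i) @ B r])"
    then have "k < length l" by (simp add: strip_tableau_def)
    then show "?T[r := A r @ replicate a i @ replicate (Suc b) (Suc i) @ B r] ! k =
      strip_tableau i A B (shift r l) ! k"
      using ab by (cases "k = r") (simp_all add: strip_tableau_def shift_def)
  qed (simp add: strip_tableau_def shift_def)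
  then show ?thesis using u Some unfolding f_tab_def by simp
qed

section \<open>The theorem\<close>

text \<open>Allows the letters of the lower factors to be replaced by the rows of their tableau, so
  that balance of the whole word yields the hypothesis of \<open>commutes_tableau\<close>. Appending
  a letter does not even change the word; the other cases are the row equivalences on the padded
  row, cut off at \<open>N\<close>.\<close>

lemma star_insert_word:
  assumes "\<forall>R\<in>set P. sorted_wrt (<) R" "balanced (x # row_word P)" "star_insert x P = (P', r)"
  shows "(\<forall>R\<in>set P'. sorted_wrt (<) R) \<and> hecke_equiv (x # row_word P) (row_word P')"
  using assms
proof (induction P arbitrary: x P' r)
  case (Cons R P)
  have R: "sorted_wrt (<) R" using Cons.prems by simp
  show ?case
  proof (cases "R = [] \<or> Max (set R) < x")
    case True
    then have "\<forall>r\<in>set R. r < x" by (metis List.finite_set Max_ge empty_iff empty_set le_less_trans)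
    moreover have "P' = (R @ [x]) # P" using Cons.prems(3) True by auto
    ultimately show ?thesis using Cons.prems R by (auto simp: row_word_def sorted_wrt_append)
  next
    case False
    obtain N where N: "\<forall>y\<in>set [x] \<union> set R \<union> set (row_word P). y < N"
      using finite_nat_set_iff_bounded[of "set [x] \<union> set R \<union> set (row_word P)"] by auto
    then have lt: "\<forall>r\<in>set R. r < N" "x < N" by auto
    define S where "S = set R \<union> padding N 0"
    have S: "infinite S" unfolding S_def using infinite_padding by simp
    obtain R1 where R1: "\<And>P. star_insert x (R # P) =
        (let (P', r) = star_insert (bump S x) P in (R1 # P', Suc r))"
      "bump S x < N" "row_insert S x = set R1 \<union> padding N 0" "sorted_wrt (<) R1" "\<forall>r\<in>set R1. r < N"
      using row_bump[OF R lt False, of 0] unfolding S_def by blast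
    obtain P1 r1 where P1: "star_insert (bump S x) P = (P1, r1)" by fastforce
    have P': "P' = R1 # P1" using Cons.prems(3) R1(1) P1 by simp
    have trunc: "(set T \<union> padding N 0) \<inter> {..<N} = set T" if "\<forall>r\<in>set T. r < N" for T
      using that padding_gt[of _ N 0] by fastforce
    have "balanced_row ([] @ [x]) S (row_word P)"
      unfolding S_def using Cons.prems(2) N R by (intro balanced_row_row) (auto simp: row_word_def)
    then have "Suc x \<notin> S" if "x \<in> S" using balanced_row_separated that by blast
    then have "hecke_equiv (x # dec (S \<inter> {..<N})) (dec (row_insert S x \<inter> {..<N}) @ [bump S x])"
      using row_word_new[OF S _ R1(2)] row_word_old[OF _ _ lt(2)] by blast
    then have "hecke_equiv (x # rev R) (rev R1 @ [bump S x])"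
      unfolding R1(3) trunc[OF R1(5)] unfolding S_def trunc[OF lt(1)] dec_sorted[OF R] dec_sorted[OF R1(4)] .
    from hecke_equiv_append[OF this, of "row_word P" "row_word P"]
    have 1: "hecke_equiv (x # row_word (R # P)) (rev R1 @ bump S x # row_word P)"
      by (simp add: row_word_def)
    then have "balanced (bump S x # row_word P)"
      using Cons.prems(2) balanced_equiv balanced_suffix by blast
    from Cons.IH[OF _ this P1] Cons.prems(1)
    have 2: "\<forall>R\<in>set P1. sorted_wrt (<) R" "hecke_equiv (bump S x # row_word P) (row_word P1)" by auto
    have "hecke_equiv (rev R1 @ bump S x # row_word P) (row_word P')"
      unfolding P' using hecke_equiv_append[OF _ 2(2), of "rev R1"] by (simp add: row_word_def)
    then show ?thesis using 1 2(1) R1(4) hecke_equiv_trans unfolding P' by auto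
  qed
qed (auto simp: row_word_def)

lemma inserts_word:
  assumes "\<forall>R\<in>set P. sorted_wrt (<) R" "balanced (rev xs @ row_word P)"
  shows "(\<forall>R\<in>set (fst (inserts P xs)). sorted_wrt (<) R) \<and>
    hecke_equiv (rev xs @ row_word P) (row_word (fst (inserts P xs)))"
  using assms
proof (induction xs arbitrary: P)
  case (Cons x xs)
  obtain P1 r1 where P1: "star_insert x P = (P1, r1)" by fastforce
  have b: "balanced (rev xs @ x # row_word P)" using Cons.prems(2) by simp
  note s = star_insert_word[OF Cons.prems(1) balanced_suffix[OF b] P1]
  then have 1: "hecke_equiv (rev xs @ x # row_word P) (rev xs @ row_word P1)"
    using hecke_equiv_append[OF hecke_equiv_refl] by blast
  then have "balanced (rev xs @ row_word P1)" using b balanced_equiv by blast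
  with Cons.IH s have 2: "\<forall>R\<in>set (fst (inserts P1 xs)). sorted_wrt (<) R"
    "hecke_equiv (rev xs @ row_word P1) (row_word (fst (inserts P1 xs)))" by blast+
  then show ?case using hecke_equiv_trans[OF 1] P1 by (simp add: case_prod_beta)
qed simp

section \<open>Splitting the insertion around two consecutive factors\<close>

lemma factor_set_factor:
  assumes "1 \<le> i" "i \<le> length h" "1 \<le> j" "j \<le> length h"
  shows "factor (set_factor h i w) j = (if j = i then w else factor h j)"
  using assms unfolding factor_def set_factor_def by (auto simp: nth_list_update)

lemma length_set_factor [simp]: "length (set_factor h i w) = length h"
  unfolding set_factor_def by simp

definition block :: "nat list list \<Rightarrow> nat list \<Rightarrow> (nat \<times> nat) list" where
  "block h qs = concat (map (\<lambda>q. map (Pair q) (rev (factor h q))) qs)"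

lemma rev_biword: "rev (biword h) = block h [1..<Suc (length h)]"
  unfolding biword_def block_def rev_concat by (simp add: rev_map comp_def)

lemma rev_biword_split:
  assumes "1 \<le> i" "i < length h"
  shows "rev (biword h) = block h [1..<i] @ map (Pair i) (rev (factor h i)) @
    map (Pair (Suc i)) (rev (factor h (Suc i))) @ block h [Suc (Suc i)..<Suc (length h)]"
proof -
  have "[1..<Suc (length h)] = [1..<i] @ [i..<Suc (length h)]"
    using assms upt_add_eq_append[of 1 i "Suc (length h) - i"] by simp
  also have "[i..<Suc (length h)] = i # Suc i # [Suc (Suc i)..<Suc (length h)]"
    using assms by (simp add: upt_conv_Cons del: upt_Suc)
  finally show ?thesis unfolding rev_biword by (simp add: block_def)
qed

lemma map_snd_biword: "map snd (biword h) = concat h"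
proof -
  have "map (factor h) (rev [1..<Suc (length h)]) = h"
    unfolding factor_def by (rule nth_equalityI) (auto simp: rev_nth simp del: upt_Suc)
  moreover have "map snd (biword h) = concat (map (factor h) (rev [1..<Suc (length h)]))"
    unfolding biword_def by (simp add: map_concat comp_def del: upt_Suc)
  ultimately show ?thesis by simp
qed

lemma block_cong: "(\<And>q. q \<in> set qs \<Longrightarrow> factor h q = factor h' q) \<Longrightarrow> block h qs = block h' qs"
  unfolding block_def by (metis (no_types, lifting) map_cong)

lemma fst_block: "set (map fst (block h qs)) \<subseteq> set qs"
  unfolding block_def by auto

lemma inserts_rows:
  "length P \<le> length (fst (inserts P xs)) \<and> (\<forall>r\<in>set (snd (inserts P xs)). r < length (fst (inserts P xs)))"
proof (induction xs arbitrary: P)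
  case (Cons x xs)
  obtain P1 r1 where P1: "star_insert x P = (P1, r1)" by fastforce
  then have "r1 < length P1" "length P \<le> length P1" using star_insert_length[OF P1] by auto
  moreover have "length P1 \<le> length (fst (inserts P1 xs))"
    "\<forall>r\<in>set (snd (inserts P1 xs)). r < length (fst (inserts P1 xs))" using Cons by auto
  ultimately show ?case using P1 by (simp add: case_prod_beta)
qed simp

lemma opens_append_zeros: "opens (l @ replicate k (0, 0)) = opens l"
proof (induction l)
  case Nil
  show ?case by (induction k) auto
qed auto

lemma move_row_append_zeros: "move_row (l @ replicate k (0, 0)) = move_row l"
proof (induction l)
  case Nil
  have "opens (replicate k (0, 0)) = 0" for k using opens_append_zeros[of "[]" k] by simp
  then show ?case by (induction k) auto
qed (auto simp: opens_append_zeros)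

lemma move_row_less: "move_row l = Some r \<Longrightarrow> r < length l"
  by (induction l arbitrary: r rule: move_row.induct) (auto split: if_splits)

lemma shift_append: "r < length l \<Longrightarrow> shift r (l @ l') = shift r l @ l'"
  unfolding shift_def by (simp add: nth_append list_update_append)

text \<open>The letters of \<open>L\<close> are inserted before the two factors, those of
  \<open>H\<close> after them. Rows created only by \<open>H\<close> lie beyond \<open>l\<close> and
  receive the counts \<open>(0, 0)\<close>.\<close>

lemma Q_star_strip_tableau:
  assumes i: "1 \<le> i" "i < length h"
  defines "L \<equiv> block h [1..<i]" and "H \<equiv> block h [Suc (Suc i)..<Suc (length h)]"
    and "us \<equiv> rev (factor h i)" and "vs \<equiv> rev (factor h (Suc i))"
  defines "T \<equiv> inserts [] (map snd L)"
  defines "P2 \<equiv> fst (strip_insert (fst T) us vs)" and "l \<equiv> snd (strip_insert (fst T) us vs)"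
  defines "E \<equiv> inserts P2 (map snd H)"
  shows "Q_star h = strip_tableau i (cells (snd T) (map fst L)) (cells (snd E) (map fst H))
    (l @ replicate (length (fst E) - length l) (0, 0))"
proof -
  define T1 where "T1 = inserts (fst T) us"
  define T2 where "T2 = inserts (fst T1) vs"
  have P2: "P2 = fst T2" "l = map (\<lambda>r. (count_list (snd T1) r, count_list (snd T2) r)) [0..<length P2]"
    unfolding P2_def l_def strip_insert_def T1_def T2_def by (simp_all add: case_prod_beta Let_def)
  have bw: "rev (biword h) = L @ map (Pair i) us @ map (Pair (Suc i)) vs @ H"
    unfolding L_def H_def us_def vs_def by (rule rev_biword_split[OF i])
  define xs where "xs = map snd (rev (biword h))"
  have "xs = map snd L @ us @ vs @ map snd H" unfolding xs_def bw by (simp add: comp_def)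
  then have t: "fst (inserts [] xs) = fst E" "snd (inserts [] xs) = snd T @ snd T1 @ snd T2 @ snd E"
    unfolding E_def P2(1) T2_def T1_def T_def by (simp_all add: inserts_append)
  have len: "length (snd T) = length L" "length (snd T1) = length us" "length (snd T2) = length vs"
    unfolding T_def T1_def T2_def by (simp_all add: inserts_length)
  have f: "map fst (rev (biword h)) = map fst L @ replicate (length (snd T1)) i @
    replicate (length (snd T2)) (Suc i) @ map fst H"
    unfolding bw len by (simp add: comp_def map_replicate_const)
  have c: "cells (snd (inserts [] xs)) (map fst (rev (biword h))) r = cells (snd T) (map fst L) r @
    replicate (count_list (snd T1) r) i @ replicate (count_list (snd T2) r) (Suc i) @
    cells (snd E) (map fst H) r" for r
    unfolding t f by (simp add: cells_append cells_replicate len(1))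
  have "length P2 \<le> length (fst E)" unfolding E_def using inserts_rows by blast
  moreover have l: "length l = length P2" unfolding P2(2) by simp
  ultimately have le: "length l \<le> length (fst E)" by simp
  have "\<forall>r\<in>set (snd T1). r < length P2" "\<forall>r\<in>set (snd T2). r < length P2"
    using inserts_rows[of "fst T" us] inserts_rows[of "fst T1" vs]
    unfolding P2(1) T1_def[symmetric] T2_def[symmetric] by fastforce+
  then have "r \<notin> set (snd T1)" "r \<notin> set (snd T2)" if "length P2 \<le> r" for r
    using that by (auto simp: not_less[symmetric])
  then have "(l @ replicate (length (fst E) - length l) (0, 0)) ! r =
    (count_list (snd T1) r, count_list (snd T2) r)" if "r < length (fst E)" for r
    using that l by (cases "r < length P2") (auto simp: nth_append P2(2) count_notin)
  then show ?thesis
    using le unfolding Q_star_cells xs_def[symmetric] t(1) strip_tableau_def by (simp add: c)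
qed

theorem theorem4p22:
  fixes m i :: nat and h :: "nat list list"
  assumes "h \<in> star_factorizations m" and "1 \<le> i" and "i < m"
  shows "(f_star i h \<noteq> None \<longleftrightarrow> f_tab i (Q_star h) \<noteq> None) \<and>
    (f_star i h \<noteq> None \<longrightarrow> Some (Q_star (the (f_star i h))) = f_tab i (Q_star h))"
proof -
  have m: "length h = m" and fc: "fully_commutative (concat h)"
    and dec: "\<And>w. w \<in> set h \<Longrightarrow> sorted_wrt (>) w"
    using assms(1) unfolding star_factorizations_def by auto
  have i: "1 \<le> i" "i < length h" using assms m by auto
  define L where "L = block h [1..<i]"
  define H where "H = block h [Suc (Suc i)..<Suc (length h)]"
  define us where "us = rev (factor h i)"
  define vs where "vs = rev (factor h (Suc i))"
  define T where "T = inserts [] (map snd L)"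
  define l where "l = snd (strip_insert (fst T) us vs)"
  define E where "E = inserts (fst (strip_insert (fst T) us vs)) (map snd H)"
  define zeros where "zeros = replicate (length (fst E) - length l) (0 :: nat, 0 :: nat)"
  define A where "A = cells (snd T) (map fst L)"
  define B where "B = cells (snd E) (map fst H)"
  have Q: "Q_star h = strip_tableau i A B (l @ zeros)"
    unfolding A_def B_def zeros_def E_def l_def T_def us_def vs_def L_def H_def
    by (rule Q_star_strip_tableau[OF i])
  have "set (map fst L) \<subseteq> {1..<i}" "set (map fst H) \<subseteq> {Suc (Suc i)..<Suc (length h)}"
    unfolding L_def H_def using fst_block[of h "[1..<i]"] fst_block[of h "[Suc (Suc i)..<Suc (length h)]"]
    unfolding set_upt by blast+
  then have AB: "\<And>r. \<forall>x\<in>set (A r). x < i" "\<And>r. \<forall>x\<in>set (B r). Suc i < x"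
    using set_cells[of "snd T" "map fst L"] set_cells[of "snd E" "map fst H"]
    unfolding A_def B_def by fastforce+
  have ftab: "f_tab i (Q_star h) = map_option (\<lambda>r. strip_tableau i A B (shift r (l @ zeros))) (move_row l)"
    unfolding Q f_tab_strip_tableau[OF AB] zeros_def move_row_append_zeros ..
  have su: "sorted_wrt (>) (factor h i)" and sv: "sorted_wrt (>) (factor h (Suc i))"
    unfolding factor_def using i by (auto intro!: dec nth_mem)
  then have so: "sorted_wrt (<) us" "sorted_wrt (<) vs" unfolding us_def vs_def by (simp_all add: sorted_wrt_rev)
  have "concat h = rev (map snd (rev (biword h)))" by (simp add: map_snd_biword rev_map)
  also have "\<dots> = rev (map snd H) @ rev vs @ rev us @ rev (map snd L)"
    unfolding rev_biword_split[OF i] L_def H_def us_def vs_def by (simp add: comp_def)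
  finally have "balanced (rev vs @ rev us @ rev (map snd L))"
    using fully_commutative_balanced[OF fc] balanced_suffix by metis
  then have b: "balanced ((rev vs @ rev us) @ rev (map snd L))" by simp
  then have "balanced (rev (map snd L) @ row_word [])" using balanced_suffix by (simp add: row_word_def) blast
  then have P0: "\<forall>R\<in>set (fst T). sorted_wrt (<) R" "hecke_equiv (rev (map snd L)) (row_word (fst T))"
    using inserts_word[of "[]" "map snd L"] unfolding T_def by (auto simp: row_word_def)
  have "balanced (rev vs @ rev us @ row_word (fst T))"
    using balanced_equiv[OF hecke_equiv_append[OF hecke_equiv_refl P0(2), of "rev vs @ rev us"]] b by simp
  from commutes_tableau[OF P0(1) so this] have com: "commutes (fst T) us vs" .
  from paired_or_move[OF so] show ?thesis
  proof
    assume "paired us vs"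
    then have "f_star i h = None" "move_row l = None"
      using f_star_paired[OF su sv] com unfolding us_def vs_def l_def commutes_def by auto
    then show ?thesis using ftab by simp
  next
    assume "\<exists>us' vs' n. move us vs us' vs' n"
    then obtain us' vs' n where F: "move us vs us' vs' n" by blast
    define h' where "h' = set_factor (set_factor h i (rev us')) (Suc i) (rev vs')"
    have f: "f_star i h = Some h'" unfolding h'_def using f_star_move[OF su sv] F unfolding us_def vs_def by blast
    obtain r where r: "fst (strip_insert (fst T) us' vs') = fst (strip_insert (fst T) us vs)" "move_row l = Some r"
      "snd (strip_insert (fst T) us' vs') = shift r l"
      using com F unfolding commutes_def l_def by blast
    have h': "factor h' j = (if j = i then rev us' else if j = Suc i then rev vs' else factor h j)"
      if "1 \<le> j" "j \<le> length h" for j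
      unfolding h'_def using factor_set_factor i that by simp
    have len: "length h' = length h" unfolding h'_def by simp
    have bl: "block h' [1..<i] = L" "block h' [Suc (Suc i)..<Suc (length h')] = H"
      unfolding L_def H_def len using i h' by (auto intro!: block_cong)
    have fac: "rev (factor h' i) = us'" "rev (factor h' (Suc i)) = vs'" using h' i by auto
    \<comment> \<open>By \<open>r(1)\<close> the insertion tableau after the two factors is the same
      as before, so the later factors are inserted identically and \<open>E\<close> serves both
      factorizations.\<close>
    have "Q_star h' = strip_tableau i A B (shift r l @ zeros)"
      using Q_star_strip_tableau[of i h'] i len
      unfolding bl fac T_def[symmetric] r(1) r(3) E_def[symmetric] A_def[symmetric] B_def[symmetric]
      by (simp add: zeros_def shift_def)
    then have "f_tab i (Q_star h) = Some (Q_star h')"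
      using ftab r(2) shift_append[OF move_row_less[OF r(2)]] by simp
    then show ?thesis using f by auto
  qed
qed

end
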